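(* Let $\boldsymbol k$ be an indeterminate and let $\mu$ be a partition. Then $$p_1P_\mu^{(\boldsymbol k)}=\sum_\lambda\ \prod_{s\in R}\frac{b^{(\boldsymbol k)}_\lambda(s)}{b^{(\boldsymbol k)}_\mu(s)}\ P_\lambda^{(\boldsymbol k)},$$ where the sum runs over the partitions $\lambda$ with $|\lambda|=|\mu|+1$ whose Young diagram contains that of $\mu$, and $R=R(\lambda,\mu)$ is the set of boxes of $\mu$ lying in the same row as the single box $\lambda-\mu$ (in the convention for Young diagrams fixed in the context).
   Context: $\Lambda_{\mathbb Q(\boldsymbol k)}$ is the ring of symmetric functions over $\mathbb Q(\boldsymbol k)$ with power sums $p_\lambda=p_{\lambda_1}p_{\lambda_2}\cdots$ and monomial symmetric functions $m_\lambda$. The inner product is $\langle p_\lambda,p_\mu\rangle=\delta_{\lambda\mu}\boldsymbol k^{l(\lambda)}z_\lambda$, where $l(\lambda)$ is the length of $\lambda$ and $z_\lambda=\prod_j j^{m_j}m_j!$ for $\lambda=(1^{m_1}2^{m_2}\cdots)$. Let $\ge$ be the dominance order on partitions. The Jack symmetric function $P^{(\boldsymbol k)}_\lambda$ is characterized by $P^{(\boldsymbol k)}_\lambda=m_\lambda+\sum_{\mu<\lambda}u^{(\boldsymbol k)}_{\lambda\mu}m_\mu$ with $u^{(\boldsymbol k)}_{\lambda\mu}\in\mathbb Q(\boldsymbol k)$, and $\langle P^{(\boldsymbol k)}_\lambda,P^{(\boldsymbol k)}_\mu\rangle=0$ for $\lambda\ne\mu$. Young diagram convention: the boxes of $\lambda=(\lambda_1\ge\lambda_2\ge\cdots)$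 are the pairs $s=(i,j)$ with $i\ge1$, $1\le j\le\lambda_i$; the box $(i,j)$ is placed in the $i$-th column and $j$-th row, so that $\lambda_i$ is the height of the $i$-th column. Thus if $\lambda-\mu$ is the box $(i_0,j_0)$, then $R=\{(i,j_0)\mid 1\le i<i_0\}$. Put $a_\lambda(s)=\lambda_i-j$, $l_\lambda(s)=\lambda_j'-i$ ($\lambda'$ the conjugate partition), and $$b^{(\boldsymbol k)}_\lambda(s)=\frac{l_\lambda(s)+1+\boldsymbol k\,a_\lambda(s)}{l_\lambda(s)+\boldsymbol k\,(a_\lambda(s)+1)},$$ and similarly $b^{(\boldsymbol k)}_\mu(s)$ with arm and leg lengths taken in $\mu$. *)

theory Defs
  imports
    "HOL-Library.Poly_Mapping"
    "HOL-Library.Multiset"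
    "HOL-Combinatorics.Permutations"
    "HOL-Computational_Algebra.Polynomial"
    "HOL-Computational_Algebra.Fraction_Field"
begin

section \<open>The ring of symmetric functions\<close>

text \<open>
  A monomial in the variables $x_0, x_1, \ldots$ is a finitely supported exponent function.
  A symmetric function is a formal power series of bounded degree, given by its coefficients,
  that is invariant under all permutations of the variables.
\<close>

type_synonym monomial = "nat \<Rightarrow>\<^sub>0 nat"

definition mdeg :: "monomial \<Rightarrow> nat" where
  "mdeg m = (\<Sum>i\<in>Poly_Mapping.keys m. Poly_Mapping.lookup m i)"

typedef (overloaded) 'a symfun =
  "{f :: monomial \<Rightarrow> 'a::zero.
      (\<exists>d. \<forall>m. f m \<noteq> 0 \<longrightarrow> mdeg m \<le> d) \<and>
      (\<forall>\<pi> m. bij \<pi> \<longrightarrow> f (Poly_Mapping.map_key \<pi> m) = f m)}"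
  morphisms mcoeff Abs_symfun
  by (rule exI[of _ "\<lambda>_. 0"]) simp

setup_lifting type_definition_symfun

lemma symfun_eqI: "(\<And>m. mcoeff f m = mcoeff g m) \<Longrightarrow> f = g"
  by (simp add: mcoeff_inject[symmetric] fun_eq_iff)

lemma mdeg_add: "mdeg (a + b) = mdeg a + mdeg b"
  unfolding mdeg_def by (rule setsum_keys_plus_distrib) auto

lemma lookup_map_key: "inj \<pi> \<Longrightarrow> Poly_Mapping.lookup (Poly_Mapping.map_key \<pi> m) i = Poly_Mapping.lookup m (\<pi> i)"
  by (simp add: map_key.rep_eq)

lemma map_key_inv:
  assumes "bij \<pi>"
  shows "Poly_Mapping.map_key \<pi> (Poly_Mapping.map_key (inv \<pi>) m) = m"
    and "Poly_Mapping.map_key (inv \<pi>) (Poly_Mapping.map_key \<pi> m) = m"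
  using assms
  by (auto intro!: poly_mapping_eqI simp: lookup_map_key bij_is_inj bij_imp_bij_inv
        bij_is_surj surj_f_inv_f)

text \<open>The multiset of nonzero exponents of a monomial.\<close>

definition exps :: "monomial \<Rightarrow> nat multiset" where
  "exps m = image_mset (Poly_Mapping.lookup m) (mset_set (Poly_Mapping.keys m))"

lemma exps_map_key:
  assumes "bij \<pi>"
  shows "exps (Poly_Mapping.map_key \<pi> m) = exps m"
proof -
  let ?K = "Poly_Mapping.keys (Poly_Mapping.map_key \<pi> m)"
  have inj: "inj \<pi>" using assms by (rule bij_is_inj)
  have K: "?K = \<pi> -` Poly_Mapping.keys m" by (simp add: keys_map_key inj)
  have "Poly_Mapping.lookup (Poly_Mapping.map_key \<pi> m) = Poly_Mapping.lookup m \<circ> \<pi>"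
    by (simp add: fun_eq_iff lookup_map_key inj)
  hence "image_mset (Poly_Mapping.lookup (Poly_Mapping.map_key \<pi> m)) (mset_set ?K)
       = image_mset (Poly_Mapping.lookup m) (image_mset \<pi> (mset_set ?K))"
    by (simp add: multiset.map_comp)
  also have "image_mset \<pi> (mset_set ?K) = mset_set (\<pi> ` ?K)"
    using inj by (intro image_mset_mset_set) (auto intro: inj_on_subset)
  also have "\<pi> ` ?K = Poly_Mapping.keys m"
    unfolding K using assms by (simp add: bij_is_surj surj_image_vimage_eq)
  finally show ?thesis by (simp add: exps_def)
qed

lemma mdeg_exps: "mdeg m = \<Sum>\<^sub># (exps m)"
  by (simp add: mdeg_def exps_def sum_unfold_sum_mset)

definition msplits :: "monomial \<Rightarrow> (monomial \<times> monomial) set" where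
  "msplits m = {(a, b). a + b = m}"

lemma finite_msplits [simp]: "finite (msplits m)"
proof -
  let ?L = "Poly_Mapping.lookup :: monomial \<Rightarrow> _"
  let ?N = "\<Sum>i\<in>Poly_Mapping.keys m. ?L m i"
  let ?F = "{f. \<forall>x. (x \<in> Poly_Mapping.keys m \<longrightarrow> f x \<in> {..?N}) \<and> (x \<notin> Poly_Mapping.keys m \<longrightarrow> f x = 0)}"
  have fin: "finite ?F" by (rule finite_set_of_finite_funs) auto
  have le: "?L a \<in> ?F" if "a + b = m" for a b
  proof -
    have *: "?L a x \<le> ?L m x" for x using that by (auto simp: lookup_add)
    have "?L m x \<le> ?N" if "x \<in> Poly_Mapping.keys m" for x
      using that by (intro member_le_sum) auto
    thus ?thesis using * by (auto simp: in_keys_iff intro: le_trans) (metis le_zero_eq)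
  qed
  have "?L ` (fst ` msplits m) \<subseteq> ?F" using le by (auto simp: msplits_def)
  hence "finite (?L ` (fst ` msplits m))" using fin by (rule finite_subset)
  moreover have "inj_on ?L (fst ` msplits m)" by (auto intro!: inj_onI simp: lookup_inject)
  ultimately have "finite (fst ` msplits m)" by (rule finite_imageD)
  moreover have "inj_on fst (msplits m)" by (auto simp: msplits_def inj_on_def)
  ultimately show ?thesis by (rule finite_imageD)
qed

lemma sum_msplits_map_key:
  assumes "bij \<pi>"
  shows "(\<Sum>(a, b)\<in>msplits (Poly_Mapping.map_key \<pi> m). h a b)
       = (\<Sum>(a, b)\<in>msplits m. h (Poly_Mapping.map_key \<pi> a) (Poly_Mapping.map_key \<pi> b))"
proof (rule sum.reindex_bij_witness[of _ "map_prod (Poly_Mapping.map_key \<pi>) (Poly_Mapping.map_key \<pi>)"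
         "map_prod (Poly_Mapping.map_key (inv \<pi>)) (Poly_Mapping.map_key (inv \<pi>))"], goal_cases)
  case (2 x)
  have i: "inj (inv \<pi>)" using assms by (simp add: bij_imp_bij_inv bij_is_inj)
  show ?case using 2 assms
    by (auto simp: msplits_def map_key_plus[OF i, symmetric] map_key_inv)
next
  case (4 x)
  have i: "inj \<pi>" using assms by (simp add: bij_is_inj)
  show ?case using 4 assms
    by (auto simp: msplits_def map_key_plus[OF i])
qed (use assms in \<open>auto simp: map_key_inv\<close>)

lift_definition scale :: "'a::comm_ring_1 \<Rightarrow> 'a symfun \<Rightarrow> 'a symfun" is
  "\<lambda>c f m. c * f m"
  by (metis mult_zero_right)

instantiation symfun :: (comm_ring_1) comm_ring_1
begin

lift_definition zero_symfun :: "'a symfun" is "\<lambda>_. 0" by simp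

lift_definition one_symfun :: "'a symfun" is "\<lambda>m. if m = 0 then 1 else 0"
proof (intro conjI allI impI)
  show "\<exists>d. \<forall>m. (if m = 0 then 1 else 0 :: 'a) \<noteq> 0 \<longrightarrow> mdeg m \<le> d"
    by (intro exI[of _ 0]) (auto simp: mdeg_def)
  fix \<pi> :: "nat \<Rightarrow> nat" and m :: monomial
  assume \<pi>: "bij \<pi>"
  have "Poly_Mapping.map_key \<pi> m = 0 \<longleftrightarrow> m = 0"
    using map_key_inv(1)[OF \<pi>] map_key_inv(2)[OF \<pi>, of m] \<pi>
    by (metis bij_imp_bij_inv bij_is_inj map_key_zero)
  thus "(if Poly_Mapping.map_key \<pi> m = 0 then 1 else 0 :: 'a) = (if m = 0 then 1 else 0)"
    by simp
qed

lift_definition plus_symfun :: "'a symfun \<Rightarrow> 'a symfun \<Rightarrow> 'a symfun" is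
  "\<lambda>f g m. f m + g m"
proof (elim conjE exE, intro conjI allI impI, goal_cases)
  case (1 f g d e)
  show ?case
  proof (intro exI[of _ "max d e"] allI impI)
    fix m assume "f m + g m \<noteq> 0"
    hence "f m \<noteq> 0 \<or> g m \<noteq> 0" by auto
    thus "mdeg m \<le> max d e" using 1 by (auto simp: le_max_iff_disj)
  qed
qed auto

lift_definition uminus_symfun :: "'a symfun \<Rightarrow> 'a symfun" is "\<lambda>f m. - f m"
  by simp

lift_definition minus_symfun :: "'a symfun \<Rightarrow> 'a symfun \<Rightarrow> 'a symfun" is
  "\<lambda>f g m. f m - g m"
proof (elim conjE exE, intro conjI allI impI, goal_cases)
  case (1 f g d e)
  show ?case
  proof (intro exI[of _ "max d e"] allI impI)
    fix m assume "f m - g m \<noteq> 0"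
    hence "f m \<noteq> 0 \<or> g m \<noteq> 0" by auto
    thus "mdeg m \<le> max d e" using 1 by (auto simp: le_max_iff_disj)
  qed
qed auto

lift_definition times_symfun :: "'a symfun \<Rightarrow> 'a symfun \<Rightarrow> 'a symfun" is
  "\<lambda>f g m. \<Sum>(a, b)\<in>msplits m. f a * g b"
proof (intro conjI allI impI, goal_cases)
  case (1 f g)
  then obtain d e where d: "\<And>m. f m \<noteq> 0 \<Longrightarrow> mdeg m \<le> d" and e: "\<And>m. g m \<noteq> 0 \<Longrightarrow> mdeg m \<le> e"
    by blast
  have "mdeg m \<le> d + e" if nz: "(\<Sum>(a, b)\<in>msplits m. f a * g b) \<noteq> 0" for m
  proof -
    obtain x where "x \<in> msplits m" "(case x of (a, b) \<Rightarrow> f a * g b) \<noteq> 0"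
      using nz by (rule sum.not_neutral_contains_not_neutral)
    then obtain a b where ab: "a + b = m" and nz': "f a * g b \<noteq> 0"
      by (auto simp: msplits_def)
    from nz' have "f a \<noteq> 0" "g b \<noteq> 0" by auto
    thus ?thesis using d[of a] e[of b] ab by (auto simp: mdeg_add)
  qed
  thus ?case by blast
next
  case (2 f g \<pi> m)
  thus ?case by (simp add: sum_msplits_map_key)
qed

instance
proof
  fix f g h :: "'a symfun"
  show "f * g * h = f * (g * h)"
  proof (rule symfun_eqI)
    fix m
    let ?f = "mcoeff f" and ?g = "mcoeff g" and ?h = "mcoeff h"
    have "mcoeff (f * g * h) m
        = (\<Sum>x\<in>msplits m. \<Sum>y\<in>msplits (fst x). ?f (fst y) * ?g (snd y) * ?h (snd x))"
      by (simp add: times_symfun.rep_eq case_prod_unfold sum_distrib_right)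
    also have "\<dots> = (\<Sum>(x, y)\<in>Sigma (msplits m) (\<lambda>x. msplits (fst x)). ?f (fst y) * ?g (snd y) * ?h (snd x))"
      by (simp add: sum.Sigma)
    also have "\<dots> = (\<Sum>(x, y)\<in>Sigma (msplits m) (\<lambda>x. msplits (snd x)). ?f (fst x) * (?g (fst y) * ?h (snd y)))"
      by (rule sum.reindex_bij_witness[of _
            "\<lambda>((a, u), (b, c)). ((a + b, c), (a, b))" "\<lambda>((u, c), (a, b)). ((a, b + c), (b, c))"])
         (auto simp: msplits_def add.assoc mult.assoc)
    also have "\<dots> = (\<Sum>x\<in>msplits m. \<Sum>y\<in>msplits (snd x). ?f (fst x) * (?g (fst y) * ?h (snd y)))"
      by (simp add: sum.Sigma)
    also have "\<dots> = mcoeff (f * (g * h)) m"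
      by (simp add: times_symfun.rep_eq case_prod_unfold sum_distrib_left)
    finally show "mcoeff (f * g * h) m = mcoeff (f * (g * h)) m" .
  qed
  show "f * g = g * f"
  proof (rule symfun_eqI)
    fix m
    show "mcoeff (f * g) m = mcoeff (g * f) m"
      unfolding times_symfun.rep_eq
      by (rule sum.reindex_bij_witness[of _ prod.swap prod.swap])
         (auto simp: msplits_def add.commute mult.commute)
  qed
  show "1 * f = f"
  proof (rule symfun_eqI)
    fix m
    have "mcoeff (1 * f) m = (\<Sum>(a, b)\<in>{(0 :: monomial, m)}. (if a = 0 then 1 else 0) * mcoeff f b)"
      unfolding times_symfun.rep_eq one_symfun.rep_eq
    proof (rule sum.mono_neutral_right)
      show "\<forall>x\<in>msplits m - {(0, m)}. (case x of (a, b) \<Rightarrow> (if a = 0 then 1 else 0) * mcoeff f b) = 0"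
        by (auto simp: msplits_def split: if_splits)
    qed (simp, simp add: msplits_def)
    thus "mcoeff (1 * f) m = mcoeff f m" by simp
  qed
  show "(f + g) * h = f * h + g * h"
    by (rule symfun_eqI)
       (simp add: times_symfun.rep_eq plus_symfun.rep_eq case_prod_unfold distrib_right sum.distrib)
  show "f + g + h = f + (g + h)" by transfer (simp add: add.assoc)
  show "f + g = g + f" by transfer (simp add: add.commute)
  show "0 + f = f" by transfer simp
  show "- f + f = 0" by transfer simp
  show "f - g = f + - g" by transfer simp
  show "(0::'a symfun) \<noteq> 1" by transfer (simp add: fun_eq_iff)
qed

end

interpretation symfun: vector_space "scale :: 'a::field \<Rightarrow> 'a symfun \<Rightarrow> 'a symfun"
  by unfold_locales (transfer; simp add: fun_eq_iff algebra_simps)+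


section \<open>Partitions\<close>

definition partitions :: "nat list set" where
  "partitions = {xs. sorted_wrt (\<ge>) xs \<and> 0 \<notin> set xs}"

text \<open>Parts are numbered from 1, and all parts beyond the length are 0.\<close>

definition part :: "nat list \<Rightarrow> nat \<Rightarrow> nat" where
  "part xs i = (if 1 \<le> i \<and> i \<le> length xs then xs ! (i - 1) else 0)"

definition conj_part :: "nat list \<Rightarrow> nat \<Rightarrow> nat" where
  "conj_part xs j = card {i. 1 \<le> i \<and> i \<le> length xs \<and> j \<le> part xs i}"

definition diagram :: "nat list \<Rightarrow> (nat \<times> nat) set" where
  "diagram xs = {(i, j). 1 \<le> i \<and> 1 \<le> j \<and> j \<le> part xs i}"

definition zee :: "nat list \<Rightarrow> nat" where
  "zee xs = (\<Prod>j\<in>set xs. j ^ count_list xs j * fact (count_list xs j))"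

definition dominates :: "nat list \<Rightarrow> nat list \<Rightarrow> bool" where
  "dominates xs ys \<longleftrightarrow>
     sum_list xs = sum_list ys \<and> (\<forall>n. sum_list (take n ys) \<le> sum_list (take n xs))"

lemma finite_partitions_of: "finite {xs \<in> partitions. sum_list xs = n}"
proof (rule finite_subset)
  show "finite {xs. set xs \<subseteq> {..n} \<and> length xs \<le> n}"
    by (rule finite_lists_length_le) simp
  have "length xs \<le> sum_list xs" if "0 \<notin> set xs" for xs :: "nat list"
    using that by (induction xs) auto
  thus "{xs \<in> partitions. sum_list xs = n} \<subseteq> {xs. set xs \<subseteq> {..n} \<and> length xs \<le> n}"
    by (auto simp: partitions_def dest: member_le_sum_list)
qed

lemma finite_dominated: "finite {xs \<in> partitions. dominates ys xs \<and> xs \<noteq> ys}"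
  by (rule finite_subset[OF _ finite_partitions_of[of "sum_list ys"]])
     (auto simp: dominates_def)


section \<open>Monomial symmetric functions and power sums\<close>

text \<open>For \<open>r = 0\<close>, which does not occur as a part, \<open>psum\<close> takes the junk value 1.\<close>

lift_definition psum :: "nat \<Rightarrow> 'a::comm_ring_1 symfun" is
  "\<lambda>r m. if \<exists>i. m = Poly_Mapping.single i r then 1 else 0"
proof (intro conjI allI impI, goal_cases)
  case (1 r)
  show ?case by (intro exI[of _ r]) (auto simp: mdeg_def)
next
  case (2 r \<pi> m)
  have *: "\<exists>i. Poly_Mapping.map_key \<rho> n = Poly_Mapping.single i r"
    if "bij \<rho>" "n = Poly_Mapping.single i r" for \<rho> n i
  proof (intro exI)
    have "i = \<rho> (inv \<rho> i)" using that by (simp add: bij_is_surj surj_f_inv_f)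
    thus "Poly_Mapping.map_key \<rho> n = Poly_Mapping.single (inv \<rho> i) r"
      using that map_key_single[of \<rho> "inv \<rho> i" r] by (simp add: bij_is_inj)
  qed
  have "(\<exists>i. Poly_Mapping.map_key \<pi> m = Poly_Mapping.single i r) \<longleftrightarrow> (\<exists>i. m = Poly_Mapping.single i r)"
    using *[of \<pi> m] *[of "inv \<pi>" "Poly_Mapping.map_key \<pi> m"] 2
    by (metis map_key_inv(2) bij_imp_bij_inv)
  thus ?case by simp
qed

definition pprod :: "nat list \<Rightarrow> 'a::comm_ring_1 symfun" where
  "pprod xs = prod_list (map psum xs)"

lift_definition msym :: "nat list \<Rightarrow> 'a::comm_ring_1 symfun" is
  "\<lambda>xs m. if exps m = mset xs
          then 1 else 0"
proof (intro conjI allI impI, goal_cases)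
  case (1 xs)
  show ?case by (intro exI[of _ "sum_list xs"]) (auto simp: mdeg_exps sum_mset_sum_list)
next
  case (2 xs \<pi> m)
  thus ?case by (simp only: exps_map_key)
qed


section \<open>The power sum products form a basis\<close>

lemma exps_single_add:
  assumes "i \<notin> Poly_Mapping.keys b" "r > 0"
  shows "exps (Poly_Mapping.single i r + b) = add_mset r (exps b)"
proof -
  let ?m = "Poly_Mapping.single i r + b"
  have lk: "Poly_Mapping.lookup ?m i = r"
    using assms by (simp add: lookup_add in_keys_iff)
  have lk': "Poly_Mapping.lookup ?m j = Poly_Mapping.lookup b j" if "j \<in> Poly_Mapping.keys b" for j
    using that assms by (auto simp: lookup_add lookup_single when_def)
  have "Poly_Mapping.keys ?m = insert i (Poly_Mapping.keys b)"
    using assms by (auto simp: in_keys_iff lookup_add lookup_single when_def split: if_splits)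
  thus ?thesis using assms lk lk'
    by (auto simp: exps_def intro!: image_mset_cong)
qed

lemma size_exps: "size (exps m) = card (Poly_Mapping.keys m)"
  by (simp add: exps_def)

lemma psum_mult_support:
  fixes f :: "'a::comm_ring_1 symfun"
  assumes "mcoeff (psum r * f) m \<noteq> 0"
  obtains i b where "m = Poly_Mapping.single i r + b" "mcoeff f b \<noteq> 0"
proof -
  have "(\<Sum>(a, b)\<in>msplits m. mcoeff (psum r) a * mcoeff f b) \<noteq> 0"
    using assms by (simp add: times_symfun.rep_eq)
  then obtain x where "x \<in> msplits m" "(case x of (a, b) \<Rightarrow> mcoeff (psum r) a * mcoeff f b) \<noteq> 0"
    by (rule sum.not_neutral_contains_not_neutral)
  then obtain a b where ab: "a + b = m" and nz: "mcoeff (psum r) a * mcoeff f b \<noteq> 0"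
    by (auto simp: msplits_def)
  from nz have "mcoeff (psum r :: 'a symfun) a \<noteq> 0" "mcoeff f b \<noteq> 0" by auto
  thus ?thesis using that ab by (auto simp: psum.rep_eq split: if_splits)
qed

lemma pprod_support:
  fixes xs :: "nat list"
  assumes "mcoeff (pprod xs :: 'a::comm_ring_1 symfun) m \<noteq> 0" "0 \<notin> set xs"
  shows "size (exps m) \<le> length xs \<and> (size (exps m) = length xs \<longrightarrow> exps m = mset xs)"
  using assms
proof (induction xs arbitrary: m)
  case Nil
  thus ?case by (auto simp: pprod_def one_symfun.rep_eq exps_def split: if_splits)
next
  case (Cons r xs)
  from Cons.prems have "mcoeff (psum r * (pprod xs :: 'a symfun)) m \<noteq> 0" by (simp add: pprod_def)
  then obtain i b where m: "m = Poly_Mapping.single i r + b" and b: "mcoeff (pprod xs :: 'a symfun) b \<noteq> 0"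
    by (rule psum_mult_support)
  have IH: "size (exps b) \<le> length xs" "size (exps b) = length xs \<Longrightarrow> exps b = mset xs"
    using Cons.IH[OF b] Cons.prems by auto
  have r: "r > 0" using Cons.prems by auto
  show ?case
  proof (cases "i \<in> Poly_Mapping.keys b")
    case True
    have "Poly_Mapping.keys m = Poly_Mapping.keys b"
      using True unfolding m by (auto simp: in_keys_iff lookup_add lookup_single when_def split: if_splits)
    thus ?thesis using IH by (simp add: size_exps)
  next
    case False
    have e: "exps m = add_mset r (exps b)" unfolding m by (rule exps_single_add[OF False r])
    show ?thesis unfolding e using IH by auto
  qed
qed

lemma pprod_nat:
  fixes xs :: "nat list"
  assumes "0 \<notin> set xs"
  shows "\<exists>n::nat. mcoeff (pprod xs :: 'a::comm_ring_1 symfun) m = of_nat n \<and> (exps m = mset xs \<longrightarrow> n > 0)"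
  using assms
proof (induction xs arbitrary: m)
  case Nil
  show ?case
    by (cases "m = 0")
       (auto simp: pprod_def one_symfun.rep_eq exps_def mset_set_empty_iff intro: exI[of _ "0::nat"] exI[of _ "1::nat"])
next
  case (Cons r xs)
  have "\<forall>b. \<exists>n::nat. mcoeff (pprod xs :: 'a symfun) b = of_nat n \<and> (exps b = mset xs \<longrightarrow> n > 0)"
    using Cons by auto
  then obtain N :: "monomial \<Rightarrow> nat" where
    N: "\<And>b. mcoeff (pprod xs :: 'a symfun) b = of_nat (N b)" and N0: "\<And>b. exps b = mset xs \<Longrightarrow> N b > 0"
    by metis
  define Q where "Q = (\<lambda>a::monomial. if \<exists>i. a = Poly_Mapping.single i r then 1 else 0 :: nat)"
  have r: "r > 0" using Cons.prems by auto
  have "mcoeff (pprod (r # xs) :: 'a symfun) m = (\<Sum>(a, b)\<in>msplits m. of_nat (Q a) * of_nat (N b))"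
    unfolding pprod_def list.map prod_list.Cons times_symfun.rep_eq
    by (intro sum.cong) (auto simp: psum.rep_eq Q_def N[unfolded pprod_def])
  also have "\<dots> = of_nat (\<Sum>(a, b)\<in>msplits m. Q a * N b)"
    by (simp add: case_prod_unfold)
  finally have eq: "mcoeff (pprod (r # xs) :: 'a symfun) m = of_nat (\<Sum>(a, b)\<in>msplits m. Q a * N b)" .
  have pos: "(\<Sum>(a, b)\<in>msplits m. Q a * N b) > 0" if e: "exps m = mset (r # xs)"
  proof -
    have "r \<in># exps m" using e by simp
    then obtain i where i: "i \<in> Poly_Mapping.keys m" "Poly_Mapping.lookup m i = r"
      by (auto simp: exps_def)
    define b where "b = m - Poly_Mapping.single i r"
    have m: "m = Poly_Mapping.single i r + b"
      using i by (intro poly_mapping_eqI) (auto simp: b_def lookup_add lookup_minus lookup_single when_def)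
    have "i \<notin> Poly_Mapping.keys b"
      using i by (simp add: b_def in_keys_iff lookup_minus)
    hence "exps b = mset xs" using exps_single_add[of i b r] r e m by simp
    hence "(\<lambda>(a, b). Q a * N b) (Poly_Mapping.single i r, b) > 0" using N0 by (auto simp: Q_def)
    moreover have "(Poly_Mapping.single i r, b) \<in> msplits m" using m by (simp add: msplits_def)
    ultimately show ?thesis
      by (intro sum_pos2[of _ "(Poly_Mapping.single i r, b)"]) auto
  qed
  show ?case using eq pos by blast
qed

lemma pprod_leading:
  assumes "0 \<notin> set xs" "exps m = mset xs"
  shows "mcoeff (pprod xs :: 'a::{comm_ring_1, ring_char_0} symfun) m \<noteq> 0"
  using pprod_nat[OF assms(1), where 'a = 'a, of m] assms(2) by auto

lemma ex_monomial:
  assumes "0 \<notin> set xs"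
  shows "\<exists>m. exps m = mset xs"
  using assms
proof (induction xs)
  case Nil
  show ?case by (intro exI[of _ 0]) (simp add: exps_def)
next
  case (Cons r xs)
  then obtain b where "exps b = mset xs" by auto
  moreover obtain i where "i \<notin> Poly_Mapping.keys b"
    using ex_new_if_finite[OF infinite_UNIV_nat finite_keys] by blast
  ultimately have "exps (Poly_Mapping.single i r + b) = mset (r # xs)"
    using Cons.prems exps_single_add[of i b r] by auto
  thus ?case by blast
qed

lemma partitions_mset_eq:
  assumes "xs \<in> partitions" "ys \<in> partitions" "mset xs = mset ys"
  shows "xs = ys"
proof -
  have "sorted (rev xs)" "sorted (rev ys)" using assms by (auto simp: partitions_def sorted_wrt_rev)
  moreover have "mset (rev xs) = mset (rev ys)" using assms by simp
  ultimately have "rev xs = rev ys" by (metis properties_for_sort)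
  thus ?thesis by simp
qed

lemma ex_partition:
  assumes "0 \<notin># M"
  shows "\<exists>xs\<in>partitions. mset xs = M"
  using assms
  by (intro bexI[of _ "rev (sorted_list_of_multiset M)"])
     (auto simp: partitions_def sorted_wrt_rev simp flip: set_mset_mset)

lemma exps_nonzero: "0 \<notin># exps m"
  by (auto simp: exps_def in_keys_iff)

lemma partition_coeff_unique:
  assumes "xs \<in> partitions" "ys \<in> partitions" "exps m = mset xs" "length ys \<le> length xs" "xs \<noteq> ys"
  shows "mcoeff (pprod ys :: 'a::comm_ring_1 symfun) m = 0"
proof (rule ccontr)
  assume nz: "mcoeff (pprod ys :: 'a symfun) m \<noteq> 0"
  have "0 \<notin> set ys" using assms by (auto simp: partitions_def)
  from pprod_support[OF nz this] assms have "mset xs = mset ys" by auto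
  with assms partitions_mset_eq show False by blast
qed

lemma inj_on_pprod: "inj_on (pprod :: _ \<Rightarrow> 'a::{comm_ring_1, ring_char_0} symfun) partitions"
proof (rule inj_onI, rule ccontr)
  have *: False if "xs \<in> partitions" "ys \<in> partitions" "(pprod xs :: 'a symfun) = pprod ys" "xs \<noteq> ys"
    "length ys \<le> length xs" for xs ys
  proof -
    have z: "0 \<notin> set xs" using that by (auto simp: partitions_def)
    obtain m where m: "exps m = mset xs" using ex_monomial[OF z] by blast
    show False using partition_coeff_unique[OF that(1,2) m that(5,4), where 'a = 'a]
        pprod_leading[OF z m, where 'a = 'a] that by auto
  qed
  fix xs ys assume "xs \<in> partitions" "ys \<in> partitions" "(pprod xs :: 'a symfun) = pprod ys" "xs \<noteq> ys"
  thus False using *[of xs ys] *[of ys xs] by (cases "length ys \<le> length xs") auto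
qed

lemma mcoeff_sum: "mcoeff (sum f A) m = (\<Sum>x\<in>A. mcoeff (f x) m)"
  by (induction A rule: infinite_finite_induct) (auto simp: zero_symfun.rep_eq plus_symfun.rep_eq)

lemma independent_pprod:
  "\<not> symfun.dependent (pprod ` partitions :: 'a::field_char_0 symfun set)"
proof
  assume "symfun.dependent (pprod ` partitions :: 'a symfun set)"
  then obtain S u v where S: "finite S" "S \<subseteq> pprod ` partitions"
    and sum0: "(\<Sum>v\<in>S. scale (u v) v) = 0" and v: "v \<in> S" "u v \<noteq> (0::'a)"
    unfolding symfun.dependent_explicit by blast
  obtain T where T: "T \<subseteq> partitions" "finite T" "S = pprod ` T"
    using S by (meson finite_subset_image)
  define T' where "T' = {xs \<in> T. u (pprod xs) \<noteq> 0}"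
  have T': "finite T'" "T' \<noteq> {}" using T v by (auto simp: T'_def)
  obtain xs where xs: "xs \<in> T'" "\<And>ys. ys \<in> T' \<Longrightarrow> length ys \<le> length xs"
    using Max_in[of "length ` T'"] Max_ge[of "length ` T'"] T' by (metis (no_types, lifting) finite_imageI image_iff image_is_empty)
  have xs': "xs \<in> partitions" "u (pprod xs) \<noteq> 0" "xs \<in> T" using xs T by (auto simp: T'_def)
  have z: "0 \<notin> set xs" using xs' by (auto simp: partitions_def)
  obtain m where m: "exps m = mset xs" using ex_monomial[OF z] by blast
  have "0 = mcoeff (\<Sum>v\<in>S. scale (u v) v) m" by (simp add: sum0 zero_symfun.rep_eq)
  also have "\<dots> = (\<Sum>v\<in>pprod ` T. u v * mcoeff v m)" by (simp add: mcoeff_sum scale.rep_eq T)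
  also have "\<dots> = (\<Sum>ys\<in>T. u (pprod ys) * mcoeff (pprod ys) m)"
    using inj_on_subset[OF inj_on_pprod T(1)] by (subst sum.reindex) simp_all
  also have "\<dots> = (\<Sum>ys\<in>{xs}. u (pprod ys) * mcoeff (pprod ys) m)"
  proof (rule sum.mono_neutral_right)
    show "\<forall>ys\<in>T - {xs}. u (pprod ys) * mcoeff (pprod ys) m = 0"
    proof
      fix ys assume ys: "ys \<in> T - {xs}"
      show "u (pprod ys) * mcoeff (pprod ys) m = 0"
      proof (cases "u (pprod ys) = 0")
        case False
        hence "length ys \<le> length xs" using xs ys by (auto simp: T'_def)
        hence "mcoeff (pprod ys :: 'a symfun) m = 0"
          using ys T xs' by (intro partition_coeff_unique[OF xs'(1) _ m]) auto
        thus ?thesis by simp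
      qed simp
    qed
  qed (use T xs' in auto)
  finally show False using xs' pprod_leading[OF z m, where 'a = 'a] by simp
qed

lemma mcoeff_cong_exps:
  assumes "exps m = exps m'"
  shows "mcoeff f m = mcoeff f m'"
proof -
  define C where "C = Poly_Mapping.keys m \<union> Poly_Mapping.keys m'"
  have ext: "image_mset (Poly_Mapping.lookup n) (mset_set C) = exps n + replicate_mset (card C - size (exps n)) 0"
    if "Poly_Mapping.keys n \<subseteq> C" for n
  proof -
    have fC: "finite C" by (simp add: C_def)
    have "mset_set C = mset_set (Poly_Mapping.keys n) + mset_set (C - Poly_Mapping.keys n)"
      using that fC by (metis Diff_disjoint Un_Diff_cancel finite_Diff finite_keys mset_set_Union sup.absorb_iff2)
    moreover have "image_mset (Poly_Mapping.lookup n) (mset_set (C - Poly_Mapping.keys n))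
        = image_mset (\<lambda>_. 0) (mset_set (C - Poly_Mapping.keys n))"
      using fC by (intro image_mset_cong) (auto simp: in_keys_iff)
    moreover have "\<dots> = replicate_mset (card C - size (exps n)) 0"
      using fC that by (simp add: image_mset_const_eq size_exps card_Diff_subset)
    ultimately show ?thesis by (simp add: exps_def)
  qed
  have "image_mset (Poly_Mapping.lookup m) (mset_set C) = image_mset (Poly_Mapping.lookup m') (mset_set C)"
    using assms ext[of m] ext[of m'] by (simp add: C_def)
  then obtain p where p: "p permutes C" "\<forall>x\<in>C. Poly_Mapping.lookup m x = Poly_Mapping.lookup m' (p x)"
    using image_mset_eq_implies_permutes[of C] by (auto simp: C_def)
  have b: "bij p" using p by (simp add: permutes_bij)
  have "Poly_Mapping.lookup m x = Poly_Mapping.lookup m' (p x)" for x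
  proof (cases "x \<in> C")
    case False
    hence "p x = x" using p by (simp add: permutes_not_in)
    thus ?thesis using False by (simp add: C_def in_keys_iff)
  qed (use p in auto)
  hence "Poly_Mapping.map_key p m' = m"
    by (intro poly_mapping_eqI) (simp add: lookup_map_key b bij_is_inj)
  thus ?thesis using mcoeff[of f] b by (auto dest!: spec)
qed

lemma span_pprod: "symfun.span (pprod ` partitions) = (UNIV :: 'a::field_char_0 symfun set)"
proof -
  let ?V = "symfun.span (pprod ` partitions) :: 'a symfun set"
  have ind: "f \<in> ?V" if "\<And>m. mcoeff f m \<noteq> 0 \<Longrightarrow> size (exps m) < L" for f L
    using that
  proof (induction L arbitrary: f)
    case 0
    hence "f = 0" by (intro symfun_eqI) (auto simp: zero_symfun.rep_eq)
    thus ?case by (simp add: symfun.span_zero)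
  next
    case (Suc L)
    obtain d where d: "\<And>m. mcoeff f m \<noteq> 0 \<Longrightarrow> mdeg m \<le> d" using mcoeff[of f] by blast
    define T where "T = {xs \<in> partitions. length xs = L \<and> sum_list xs \<le> d}"
    have "T \<subseteq> (\<Union>n\<le>d. {xs \<in> partitions. sum_list xs = n})" by (auto simp: T_def)
    hence finT: "finite T" by (rule finite_subset) (simp add: finite_partitions_of)
    define x where "x = (\<lambda>xs. SOME m. exps m = mset xs)"
    have x: "exps (x xs) = mset xs" if "xs \<in> partitions" for xs
      unfolding x_def using that ex_monomial[of xs] by (auto simp: partitions_def intro: someI_ex[where P = "\<lambda>m. exps m = mset xs"])
    define c where "c = (\<lambda>xs. mcoeff f (x xs) / mcoeff (pprod xs) (x xs))"
    define g where "g = (\<Sum>xs\<in>T. scale (c xs) (pprod xs :: 'a symfun))"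
    have g: "g \<in> ?V" unfolding g_def T_def
      by (intro symfun.span_sum symfun.span_scale symfun.span_base) auto
    have "f - g \<in> ?V"
    proof (rule Suc.IH)
      fix m assume nz: "mcoeff (f - g) m \<noteq> 0"
      have gm: "mcoeff g m = (\<Sum>xs\<in>T. c xs * mcoeff (pprod xs) m)"
        by (simp add: g_def mcoeff_sum scale.rep_eq)
      have supp: "size (exps m) < L \<or> exps m = mset xs" if "mcoeff (pprod xs :: 'a symfun) m \<noteq> 0" "xs \<in> T" for xs
        using pprod_support[OF that(1)] that(2) by (auto simp: T_def partitions_def)
      show "size (exps m) < L"
      proof (rule ccontr)
        assume big: "\<not> size (exps m) < L"
        obtain ys where ys: "ys \<in> partitions" "mset ys = exps m" using ex_partition[OF exps_nonzero] by blast
        have fm: "mcoeff f m = mcoeff f (x ys)"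
          using x[OF ys(1)] ys by (intro mcoeff_cong_exps) simp
        have pm: "mcoeff (pprod ys) m = mcoeff (pprod ys :: 'a symfun) (x ys)"
          using x[OF ys(1)] ys by (intro mcoeff_cong_exps) simp
        have z0: "mcoeff (pprod xs :: 'a symfun) m = 0" if "xs \<in> T" "xs \<noteq> ys" for xs
          proof (rule ccontr)
          assume "mcoeff (pprod xs :: 'a symfun) m \<noteq> 0"
          with supp[OF _ that(1)] big have "exps m = mset xs" by blast
          with ys(2) have "mset xs = mset ys" by metis
          moreover have "xs \<in> partitions" using that(1) by (simp add: T_def)
          ultimately show False using ys(1) that(2) partitions_mset_eq by metis
        qed
        have "mcoeff f m = mcoeff g m"
        proof (cases "ys \<in> T")
          case True
          have "mcoeff g m = (\<Sum>xs\<in>{ys}. c xs * mcoeff (pprod xs) m)"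
            unfolding gm using True finT z0 by (intro sum.mono_neutral_right) auto
          also have "\<dots> = mcoeff f m"
            using pprod_leading[of ys m, where 'a = 'a] ys pm by (simp add: c_def fm partitions_def)
          finally show ?thesis by simp
        next
          case False
          hence "mcoeff g m = 0" unfolding gm using z0 by (intro sum.neutral) (metis mult_zero_right)
          moreover have "mcoeff f m = 0"
          proof (rule ccontr)
            assume nf: "mcoeff f m \<noteq> 0"
            have "length ys = L" using Suc.prems[OF nf] big ys by (metis less_SucE size_mset)
            moreover have "sum_list ys \<le> d"
              using d[OF nf] by (simp add: mdeg_exps flip: ys(2) sum_mset_sum_list)
            ultimately show False using False ys by (simp add: T_def)
          qed
          ultimately show ?thesis by simp
        qed
        thus False using nz by (simp add: minus_symfun.rep_eq)
      qed
    qed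
    from symfun.span_add[OF this g] show ?case by simp
  qed
  have "f \<in> ?V" for f
  proof -
    obtain d where d: "\<And>m. mcoeff f m \<noteq> 0 \<Longrightarrow> mdeg m \<le> d" using mcoeff[of f] by blast
    have "size (exps m) \<le> mdeg m" for m
    proof -
      have "card (Poly_Mapping.keys m) = (\<Sum>i\<in>Poly_Mapping.keys m. 1)" by simp
      also have "\<dots> \<le> mdeg m" unfolding mdeg_def by (intro sum_mono) (auto simp: in_keys_iff)
      finally show ?thesis by (simp add: size_exps)
    qed
    thus ?thesis using d by (intro ind[of _ "Suc d"]) (meson le_imp_less_Suc le_trans)
  qed
  thus ?thesis by blast
qed


section \<open>The inner product and Jack symmetric functions\<close>

type_synonym ratfun = "rat poly fract"

definition kk :: ratfun where
  "kk = Fract [:0, 1:] 1"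

definition pcoord :: "ratfun symfun \<Rightarrow> nat list \<Rightarrow> ratfun" where
  "pcoord f xs = symfun.representation (pprod ` partitions) f (pprod xs)"

text \<open>
  The bilinear extension of $\langle p_\lambda, p_\mu\rangle = \delta_{\lambda\mu} k^{l(\lambda)} z_\lambda$,
  expressed through the coordinates of the arguments in the basis of the $p_\lambda$.
\<close>

definition jack_inner :: "ratfun symfun \<Rightarrow> ratfun symfun \<Rightarrow> ratfun" where
  "jack_inner f g =
     (\<Sum>xs | xs \<in> partitions \<and> pcoord f xs \<noteq> 0.
        pcoord f xs * pcoord g xs * kk ^ length xs * of_nat (zee xs))"

lemma pcoord_add: "pcoord (f + g) xs = pcoord f xs + pcoord g xs"
  by (simp add: pcoord_def symfun.representation_add independent_pprod span_pprod)

lemma pcoord_scale: "pcoord (scale c f) xs = c * pcoord f xs"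
  by (simp add: pcoord_def symfun.representation_scale independent_pprod span_pprod)

lemma pcoord_pprod:
  assumes "xs \<in> partitions" "ys \<in> partitions"
  shows "pcoord (pprod xs) ys = (if xs = ys then 1 else 0)"
proof -
  have "(pprod xs :: ratfun symfun) = pprod ys \<longleftrightarrow> xs = ys"
    using assms by (simp add: inj_on_eq_iff[OF inj_on_pprod])
  thus ?thesis using assms by (auto simp: pcoord_def symfun.representation_basis independent_pprod)
qed

lemma finite_pcoord: "finite {xs. xs \<in> partitions \<and> pcoord f xs \<noteq> 0}"
proof (rule finite_imageD)
  show "finite (pprod ` {xs. xs \<in> partitions \<and> pcoord f xs \<noteq> 0} :: ratfun symfun set)"
    by (rule finite_subset[OF _ symfun.finite_representation[of "pprod ` partitions" f]])
       (auto simp: pcoord_def)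
  show "inj_on (pprod :: _ \<Rightarrow> ratfun symfun) {xs. xs \<in> partitions \<and> pcoord f xs \<noteq> 0}"
    by (rule inj_on_subset[OF inj_on_pprod]) auto
qed

lemma jack_inner_eq:
  assumes "finite A" "A \<subseteq> partitions" "\<And>xs. xs \<in> partitions \<Longrightarrow> pcoord f xs \<noteq> 0 \<Longrightarrow> xs \<in> A"
  shows "jack_inner f g = (\<Sum>xs\<in>A. pcoord f xs * pcoord g xs * kk ^ length xs * of_nat (zee xs))"
  unfolding jack_inner_def using assms by (intro sum.mono_neutral_left) auto

lemma jack_inner_pprod:
  assumes "xs \<in> partitions" "ys \<in> partitions"
  shows "jack_inner (pprod xs) (pprod ys) = (if xs = ys then kk ^ length xs * of_nat (zee xs) else 0)"
  using assms by (subst jack_inner_eq[of "{xs}"]) (auto simp: pcoord_pprod split: if_splits)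

lemma jack_inner_add_left: "jack_inner (f + g) h = jack_inner f h + jack_inner g h"
proof -
  let ?A = "{xs. xs \<in> partitions \<and> pcoord f xs \<noteq> 0} \<union> {xs. xs \<in> partitions \<and> pcoord g xs \<noteq> 0}"
  have A: "finite ?A" "?A \<subseteq> partitions" by (auto simp: finite_pcoord)
  show ?thesis
    by (subst (1 2 3) jack_inner_eq[OF A])
       (auto simp: pcoord_add sum.distrib[symmetric] distrib_right)
qed

lemma jack_inner_scale_left: "jack_inner (scale c f) h = c * jack_inner f h"
  by (subst (1 2) jack_inner_eq[OF finite_pcoord[of f]])
     (auto simp: pcoord_scale sum_distrib_left mult.assoc)

lemma jack_inner_commute: "jack_inner f g = jack_inner g f"
proof -
  let ?A = "{xs. xs \<in> partitions \<and> pcoord f xs \<noteq> 0} \<union> {xs. xs \<in> partitions \<and> pcoord g xs \<noteq> 0}"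
  have A: "finite ?A" "?A \<subseteq> partitions" by (auto simp: finite_pcoord)
  show ?thesis
    by (subst (1 2) jack_inner_eq[OF A]) (auto simp: mult_ac)
qed

definition is_jack_family :: "(nat list \<Rightarrow> ratfun symfun) \<Rightarrow> bool" where
  "is_jack_family P \<longleftrightarrow>
     (\<forall>lam\<in>partitions. \<exists>u. P lam = msym lam +
        (\<Sum>mu | mu \<in> partitions \<and> dominates lam mu \<and> mu \<noteq> lam. scale (u mu) (msym mu))) \<and>
     (\<forall>lam\<in>partitions. \<forall>mu\<in>partitions. lam \<noteq> mu \<longrightarrow> jack_inner (P lam) (P mu) = 0)"


section \<open>The Pieri coefficients\<close>

definition arm :: "nat list \<Rightarrow> nat \<times> nat \<Rightarrow> int" where
  "arm lam s = int (part lam (fst s)) - int (snd s)"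

definition leg :: "nat list \<Rightarrow> nat \<times> nat \<Rightarrow> int" where
  "leg lam s = int (conj_part lam (snd s)) - int (fst s)"

definition bfun :: "nat list \<Rightarrow> nat \<times> nat \<Rightarrow> ratfun" where
  "bfun lam s = (of_int (leg lam s) + 1 + kk * of_int (arm lam s)) /
              (of_int (leg lam s) + kk * (of_int (arm lam s) + 1))"

lemma finite_diagram: "finite (diagram xs)"
proof (rule finite_subset)
  show "diagram xs \<subseteq> (SIGMA i:{1..length xs}. {1..part xs i})"
    by (auto simp: diagram_def part_def split: if_splits)
qed simp

text \<open>
  Diagrams are drawn with box \<open>(i, j)\<close> in column \<open>i\<close> and row \<open>j\<close>, so two boxes are in the same
  row if their second coordinates agree.
\<close>

definition row_boxes :: "nat list \<Rightarrow> nat list \<Rightarrow> (nat \<times> nat) set" where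
  "row_boxes lam mu = {s \<in> diagram mu. \<exists>t \<in> diagram lam - diagram mu. snd s = snd t}"

end

(*
  The Laplace-Beltrami operator D is self-adjoint for the inner product and triangular in the
  monomial basis, so the Jack functions are its eigenfunctions. Write mu = (r, m) and single out
  one variable y. Then P_mu(y, x) = y^r P_m(x) + y^(r-1) G_mu(x) + ..., and the coefficient of
  y^(r-1) in the eigenvalue equation expresses G_mu through p_1 P_m. Comparing the coefficients
  of y^(r+1) and y^r on both sides of the Pieri expansion of p_1 P_mu gives
  p_1 P_mu = P_(r+1,m) + (terms P_(r,l)), where the (r,l)-terms are read off from
  p_1 P_m + G_(r,m) - G_(r+1,m); passing from m to (r, m) multiplies the coefficient by exactly
  the factor of the new box in R. Terms P_lam with first part below r do not occur since the
  adjoint of p_1 is a multiple of d/dp_1, which does not raise the first part.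
*)
theory Submission
  imports Defs
begin

text \<open>The pair terms x_i x_j / (x_i - x_j) (d_i - d_j) contribute only to monomials that
  contain both variables. This form of the operator therefore does not depend on the number of
  variables and acts directly on symmetric functions in infinitely many of them. The obstacle is
  that triangularity is visible on monomials while the inner product is known only on power sums.
  The bridge is the commutator of the operator with p_r: it is computed on coefficients, and since
  the p_r generate the ring it determines the operator as a differential operator in the p_r. There
  the adjoint of p_r is k r d/dp_r, and self-adjointness is the symmetry of an explicit formula.
  Eigenvalues are separated only for partitions comparable in dominance, which is all that
  triangular expansions need; the separation already shows in the k-free part -n(lambda). The
  equation for G_mu determines its pairing with P_nu only if a certain linear form in k is nonzero.
  If nu covers m the form is explicit; otherwise a bound on the prefix sums of the partitions
  occurring in G_mu excludes the bad case.\<close>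

abbreviation lookup :: "monomial \<Rightarrow> nat \<Rightarrow> nat" where "lookup \<equiv> Poly_Mapping.lookup"
abbreviation keys :: "monomial \<Rightarrow> nat set" where "keys \<equiv> Poly_Mapping.keys"
abbreviation update :: "monomial \<Rightarrow> nat \<Rightarrow> nat \<Rightarrow> monomial" where
  "update m i a \<equiv> Poly_Mapping.update i a m"

section \<open>Multiplication by power sums\<close>

text \<open>Multiplication by the single power x_l^r. It acts on arbitrary coefficient functions
  because such a product is no longer symmetric.\<close>

definition var_mult :: "nat \<Rightarrow> nat \<Rightarrow> (monomial \<Rightarrow> 'a::zero) \<Rightarrow> monomial \<Rightarrow> 'a" where
  "var_mult r l f m = (if r \<le> lookup m l then f (update m l (lookup m l - r)) else 0)"

text \<open>A variable outside the support of \<open>m\<close> cannot supply a factor x_l^r with r >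
  0. The set \<open>I\<close> is left free so that one index set serves \<open>m\<close> and all
  monomials obtained from it by updating.\<close>

lemma mcoeff_psum_mult:
  fixes f :: "'a::comm_ring_1 symfun"
  assumes "r > 0" "finite I" "keys m \<subseteq> I"
  shows "mcoeff (psum r * f) m = (\<Sum>l\<in>I. var_mult r l (mcoeff f) m)"
proof -
  let ?s = "\<lambda>l. Poly_Mapping.single l r :: monomial"
  let ?J = "{l\<in>I. r \<le> lookup m l}"
  have upd: "update m l (lookup m l - r) = m - ?s l" for l
    by (rule poly_mapping_eqI) (auto simp: lookup_update lookup_minus lookup_single when_def)
  have "mcoeff (psum r * f) m = (\<Sum>(a, b)\<in>msplits m. (if \<exists>i. a = ?s i then 1 else 0) * mcoeff f b)"
    by (simp add: times_symfun.rep_eq psum.rep_eq)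
  also have "\<dots> = (\<Sum>(a, b)\<in>{(a, b)\<in>msplits m. \<exists>i. a = ?s i}. mcoeff f b)"
    by (rule sum.mono_neutral_cong_right) (auto split: if_splits)
  also have "\<dots> = (\<Sum>l\<in>?J. mcoeff f (m - ?s l))"
  proof (rule sym, rule sum.reindex_cong[of "\<lambda>(a, b). THE l. a = ?s l"])
    have s_inj: "?s i = ?s j \<longleftrightarrow> i = j" for i j
      using assms(1) by (auto simp: poly_mapping_eq_iff lookup_single when_def fun_eq_iff split: if_splits)
    hence the: "(THE l. ?s i = ?s l) = i" for i by auto
    show "inj_on (\<lambda>(a, b). THE l. a = ?s l) {(a, b)\<in>msplits m. \<exists>i. a = ?s i}"
      by (auto simp: inj_on_def msplits_def the)
    have mem: "(?s l, m - ?s l) \<in> msplits m" if "r \<le> lookup m l" for l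
      using that by (auto simp: msplits_def intro!: poly_mapping_eqI simp: lookup_add lookup_minus lookup_single when_def)
    have mem': "l \<in> I \<and> r \<le> lookup m l" if "?s l + b = m" for l b
    proof -
      have "r \<le> lookup m l" using that by (auto simp: lookup_add)
      moreover from this have "l \<in> keys m" using assms(1) by (simp add: in_keys_iff)
      ultimately show ?thesis using assms(3) by blast
    qed
    show "?J = (\<lambda>(a, b). THE l. a = ?s l) ` {(a, b)\<in>msplits m. \<exists>i. a = ?s i}"
    proof
      show "?J \<subseteq> (\<lambda>(a, b). THE l. a = ?s l) ` {(a, b)\<in>msplits m. \<exists>i. a = ?s i}"
        using mem the by (auto intro!: image_eqI[of _ _ "(?s l, m - ?s l)" for l])
      show "(\<lambda>(a, b). THE l. a = ?s l) ` {(a, b)\<in>msplits m. \<exists>i. a = ?s i} \<subseteq> ?J"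
        using mem' the by (auto simp: msplits_def)
    qed
    show "mcoeff f (m - ?s (case x of (a, b) \<Rightarrow> THE l. a = ?s l)) = (case x of (a, b) \<Rightarrow> mcoeff f b)"
      if "x \<in> {(a, b)\<in>msplits m. \<exists>i. a = ?s i}" for x
      using that the by (auto simp: msplits_def)
  qed
  also have "\<dots> = (\<Sum>l\<in>I. var_mult r l (mcoeff f) m)"
    using assms(2) by (intro sum.mono_neutral_cong_left) (auto simp: var_mult_def upd)
  finally show ?thesis .
qed

lemma keys_update_subset: "keys (update m i a) \<subseteq> insert i (keys m)"
  by (auto simp: keys_update)

lemma mcoeff_psum_psum_mult:
  fixes f :: "'a::comm_ring_1 symfun"
  assumes "r > 0" "s > 0" "finite I" "keys m \<subseteq> I"
  shows "mcoeff (psum r * (psum s * f)) m = (\<Sum>l\<in>I. \<Sum>j\<in>I. var_mult r l (var_mult s j (mcoeff f)) m)"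
proof -
  have "var_mult r l (mcoeff (psum s * f)) m = (\<Sum>j\<in>I. var_mult r l (var_mult s j (mcoeff f)) m)" if "l \<in> I" for l
    using that assms keys_update_subset[of l "lookup m l - r" m]
    by (simp add: var_mult_def[of r]) (intro impI mcoeff_psum_mult; blast)
  thus ?thesis using assms by (simp add: mcoeff_psum_mult[of r I])
qed

lemma var_mult_twice: "var_mult r l (var_mult s l f) m = var_mult (r + s) l f m"
proof -
  have "update (update m l a) l b = update m l b" for a b
    by (rule poly_mapping_eqI) (simp add: lookup_update)
  thus ?thesis by (auto simp: var_mult_def lookup_update add.commute)
qed

lemma var_mult_commute:
  "l \<noteq> j \<Longrightarrow> var_mult r l (var_mult s j f) m = var_mult s j (var_mult r l f) m"
proof -
  assume "l \<noteq> j"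
  hence "update (update m l a) j b = update (update m j b) l a" for a b
    by (intro poly_mapping_eqI) (simp add: lookup_update)
  with \<open>l \<noteq> j\<close> show ?thesis by (auto simp: var_mult_def lookup_update)
qed

section \<open>The two-variable operator\<close>

text \<open>
  For symmetric \<open>\<phi>\<close> this is the coefficient of $x^a y^b$ in
  $\frac{xy}{x-y}(\partial_x - \partial_y)$ applied to the polynomial with coefficients \<open>\<phi>\<close>,
  obtained by expanding the quotient in powers of $y/x$.
\<close>

definition pair_op :: "(nat \<Rightarrow> nat \<Rightarrow> 'a::comm_ring_1) \<Rightarrow> nat \<Rightarrow> nat \<Rightarrow> 'a" where
  "pair_op \<phi> a b = (\<Sum>t<b. (of_nat (a + b) - 2 * of_nat t) * \<phi> (a + b - t) t) - of_nat b * \<phi> a b"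

text \<open>The reflection t -> a + b - t reverses the sign of the weight and fixes \<psi>, so the
  sum equals its own negative.\<close>

lemma antisym_sum:
  fixes \<psi> :: "nat \<Rightarrow> 'a::field_char_0"
  assumes "\<And>t. t \<in> {b..a} \<Longrightarrow> \<psi> (a + b - t) = \<psi> t"
  shows "(\<Sum>t=b..a. (of_nat (a + b) - 2 * of_nat t) * \<psi> t) = 0"
proof -
  let ?S = "\<Sum>t=b..a. (of_nat (a + b) - 2 * of_nat t) * \<psi> t"
  have "?S = (\<Sum>t=b..a. - ((of_nat (a + b) - 2 * of_nat t) * \<psi> t))"
    by (rule sum.reindex_bij_witness[of _ "\<lambda>t. a + b - t" "\<lambda>t. a + b - t"])
       (auto simp: assms of_nat_diff algebra_simps)
  hence "?S = - ?S" by (simp add: sum_negf)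
  thus ?thesis by (simp add: equation_minus_iff)
qed

text \<open>The quotient by x - y is a polynomial, so expanding in y/x or in x/y must agree. On
  coefficients the two expansions differ by a sum over t from b to a, whose last term accounts for
  the two subtracted terms, and \<open>antisym_sum\<close> kills it.\<close>

lemma pair_op_commute:
  fixes \<phi> :: "nat \<Rightarrow> nat \<Rightarrow> 'a::field_char_0"
  assumes "\<And>x y. \<phi> x y = \<phi> y x"
  shows "pair_op \<phi> a b = pair_op \<phi> b a"
proof -
  have *: "pair_op \<phi> a b = pair_op \<phi> b a" if "b \<le> a" for a b
  proof -
    let ?g = "\<lambda>t. (of_nat (a + b) - 2 * of_nat t) * \<phi> (a + b - t) t"
    have "(\<Sum>t=b..a. ?g t) = 0"
    proof (rule antisym_sum)
      fix t assume "t \<in> {b..a}"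
      thus "\<phi> (a + b - (a + b - t)) (a + b - t) = \<phi> (a + b - t) t"
        using assms[of "a + b - t" t] by simp
    qed
    moreover have "(\<Sum>t=b..a. ?g t) = (\<Sum>t=b..<a. ?g t) + ?g a"
      using that by (simp add: sum.last_plus)
    moreover have "(\<Sum>t<a. ?g t) = (\<Sum>t<b. ?g t) + (\<Sum>t=b..<a. ?g t)"
      using sum.atLeastLessThan_concat[of 0 b a ?g] that by (simp add: lessThan_atLeast0)
    ultimately show ?thesis
      using assms[of a b] by (simp add: pair_op_def add.commute[of b a] algebra_simps)
  qed
  show ?thesis using *[of b a] *[of a b] by (cases "b \<le> a") auto
qed

definition mult_fst :: "nat \<Rightarrow> (nat \<Rightarrow> nat \<Rightarrow> 'a::zero) \<Rightarrow> nat \<Rightarrow> nat \<Rightarrow> 'a" where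
  "mult_fst r \<phi> a b = (if r \<le> a then \<phi> (a - r) b else 0)"

definition mult_snd :: "nat \<Rightarrow> (nat \<Rightarrow> nat \<Rightarrow> 'a::zero) \<Rightarrow> nat \<Rightarrow> nat \<Rightarrow> 'a" where
  "mult_snd r \<phi> a b = (if r \<le> b then \<phi> a (b - r) else 0)"

text \<open>Product rule: d_x applied to x^r leaves r x^r y/(x-y) times the function, and y/(x-y) is
  the sum of (y/x)^n over n >= 1. The index is t = b - n.\<close>

lemma pair_op_mult_fst:
  fixes \<phi> :: "nat \<Rightarrow> nat \<Rightarrow> 'a::field_char_0"
  assumes "\<And>x y. \<phi> x y = \<phi> y x"
  shows "pair_op (mult_fst r \<phi>) a b = mult_fst r (pair_op \<phi>) a b
           + of_nat r * (\<Sum>t | t < b \<and> t + r \<le> a + b. \<phi> (a + b - r - t) t)"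
proof (cases "r \<le> a")
  case True
  hence set: "{t. t < b \<and> t + r \<le> a + b} = {..<b}" by auto
  have *: "(of_nat (a + b) - 2 * of_nat t) * mult_fst r \<phi> (a + b - t) t
      = (of_nat (a - r + b) - 2 * of_nat t) * \<phi> (a - r + b - t) t + of_nat r * \<phi> (a + b - r - t) t"
    if "t < b" for t
  proof -
    have e: "a + b - t - r = a - r + b - t" "a + b - r - t = a - r + b - t" using that True by auto
    have "r \<le> a + b - t" using that True by auto
    thus ?thesis using True by (simp add: mult_fst_def e of_nat_diff algebra_simps)
  qed
  have "(\<Sum>t<b. (of_nat (a + b) - 2 * of_nat t) * mult_fst r \<phi> (a + b - t) t)
      = (\<Sum>t<b. (of_nat (a - r + b) - 2 * of_nat t) * \<phi> (a - r + b - t) t) + of_nat r * (\<Sum>t<b. \<phi> (a + b - r - t) t)"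
    unfolding sum_distrib_left sum.distrib[symmetric] by (intro sum.cong refl *) auto
  thus ?thesis unfolding set using True by (simp add: pair_op_def mult_fst_def)
next
  case False
  show ?thesis
  proof (cases "r \<le> a + b")
    case True
    let ?N = "a + b - r"
    have set: "{t. t < b \<and> t + r \<le> a + b} = {0..?N}" using False True by auto
    have "(\<Sum>t<b. (of_nat (a + b) - 2 * of_nat t) * mult_fst r \<phi> (a + b - t) t)
        = (\<Sum>t=0..?N. (of_nat (a + b) - 2 * of_nat t) * \<phi> (?N - t) t)"
    proof (rule sum.mono_neutral_cong_right)
      show "\<forall>t\<in>{..<b} - {0..?N}. (of_nat (a + b) - 2 * of_nat t) * mult_fst r \<phi> (a + b - t) t = 0"
        using True by (auto simp: mult_fst_def)
      fix t assume "t \<in> {0..?N}"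
      hence "r \<le> a + b - t" "a + b - t - r = ?N - t" using True by auto
      thus "(of_nat (a + b) - 2 * of_nat t) * mult_fst r \<phi> (a + b - t) t = (of_nat (a + b) - 2 * of_nat t) * \<phi> (?N - t) t"
        by (simp add: mult_fst_def)
    qed (use True False in auto)
    also have "\<dots> = (\<Sum>t=0..?N. (of_nat (?N + 0) - 2 * of_nat t) * \<phi> (?N - t) t)
        + of_nat r * (\<Sum>t=0..?N. \<phi> (?N - t) t)"
      unfolding sum_distrib_left sum.distrib[symmetric]
      using True by (intro sum.cong) (auto simp: of_nat_diff algebra_simps)
    \<comment> \<open>As r > a, the cut-off at \<open>b\<close> is no longer felt: the sum runs over
      a whole antidiagonal and vanishes by antisymmetry, matching the zero of
      \<open>mult_fst\<close>.\<close>
    also have "(\<Sum>t=0..?N. (of_nat (?N + 0) - 2 * of_nat t) * \<phi> (?N - t) t) = 0"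
    proof (rule antisym_sum)
      fix t assume "t \<in> {0..?N}"
      thus "\<phi> (?N - (?N + 0 - t)) (?N + 0 - t) = \<phi> (?N - t) t"
        using assms[of "?N - t" t] by (simp only: diff_diff_cancel add_0_right atLeastAtMost_iff)
    qed
    finally show ?thesis unfolding set using False by (simp add: pair_op_def mult_fst_def)
  next
    case F2: False
    hence "{t. t < b \<and> t + r \<le> a + b} = {}" by auto
    moreover have "(\<Sum>t<b. (of_nat (a + b) - 2 * of_nat t) * mult_fst r \<phi> (a + b - t) t) = 0"
      using F2 by (intro sum.neutral) (auto simp: mult_fst_def)
    ultimately show ?thesis using F2 by (simp add: pair_op_def mult_fst_def)
  qed
qed

text \<open>Here the product rule leaves -r x y^r/(x-y), and x/(x-y) is the sum of (y/x)^n over n >=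
  0, so the range of t includes the end point b - r.\<close>

lemma pair_op_mult_snd:
  fixes \<phi> :: "nat \<Rightarrow> nat \<Rightarrow> 'a::comm_ring_1"
  shows "pair_op (mult_snd r \<phi>) a b = mult_snd r (pair_op \<phi>) a b
           - of_nat r * (\<Sum>t | t + r \<le> b. \<phi> (a + b - r - t) t)"
proof (cases "r \<le> b")
  case True
  have "(\<Sum>t<b. (of_nat (a + b) - 2 * of_nat t) * mult_snd r \<phi> (a + b - t) t)
      = (\<Sum>t\<in>{r..<b}. (of_nat (a + b) - 2 * of_nat t) * \<phi> (a + b - t) (t - r))"
    using True by (intro sum.mono_neutral_cong_right) (auto simp: mult_snd_def)
  also have "\<dots> = (\<Sum>t<b - r. (of_nat (a + b) - 2 * of_nat (t + r)) * \<phi> (a + b - (t + r)) t)"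
    by (rule sum.reindex_bij_witness[of _ "\<lambda>t. t + r" "\<lambda>t. t - r"]) (use True in auto)
  also have "\<dots> = (\<Sum>t<b - r. (of_nat (a + (b - r)) - 2 * of_nat t) * \<phi> (a + (b - r) - t) t)
      - of_nat r * (\<Sum>t<b - r. \<phi> (a + b - r - t) t)"
    unfolding sum_distrib_left sum_subtractf[symmetric]
  proof (intro sum.cong refl)
    fix t
    have e: "a + b - (t + r) = a + (b - r) - t" "a + b - r - t = a + (b - r) - t" using True by auto
    show "(of_nat (a + b) - 2 * of_nat (t + r)) * \<phi> (a + b - (t + r)) t
      = (of_nat (a + (b - r)) - 2 * of_nat t) * \<phi> (a + (b - r) - t) t - of_nat r * \<phi> (a + b - r - t) t"
      unfolding e using True by (simp add: of_nat_diff algebra_simps)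
  qed
  finally have 1: "(\<Sum>t<b. (of_nat (a + b) - 2 * of_nat t) * mult_snd r \<phi> (a + b - t) t) = \<dots>" .
  have "{t. t + r \<le> b} = insert (b - r) {..<b - r}" using True by auto
  hence 2: "(\<Sum>t | t + r \<le> b. \<phi> (a + b - r - t) t) = \<phi> a (b - r) + (\<Sum>t<b - r. \<phi> (a + b - r - t) t)"
    using True by simp
  have 3: "mult_snd r \<phi> a b = \<phi> a (b - r)" "mult_snd r (pair_op \<phi>) a b = pair_op \<phi> a (b - r)"
    using True by (simp_all add: mult_snd_def)
  show ?thesis unfolding pair_op_def[of "mult_snd r \<phi>"] 1 2 3 pair_op_def[of \<phi> a "b - r"]
    using True by (simp add: of_nat_diff left_diff_distrib distrib_left)
next
  case False
  hence "{t. t + r \<le> b} = {}" by auto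
  moreover have "(\<Sum>t<b. (of_nat (a + b) - 2 * of_nat t) * mult_snd r \<phi> (a + b - t) t) = 0"
    using False by (intro sum.neutral) (auto simp: mult_snd_def)
  ultimately show ?thesis using False by (simp add: pair_op_def mult_snd_def)
qed

text \<open>The two corrections combine to r (x^r y - x y^r)/(x - y), a genuine polynomial: r times
  the sum of x^u y^(r-u) over 0 < u < r.\<close>

lemma pair_op_mult:
  fixes \<phi> :: "nat \<Rightarrow> nat \<Rightarrow> 'a::field_char_0"
  assumes "\<And>x y. \<phi> x y = \<phi> y x" "r > 0"
  shows "pair_op (mult_fst r \<phi>) a b + pair_op (mult_snd r \<phi>) a b
       = mult_fst r (pair_op \<phi>) a b + mult_snd r (pair_op \<phi>) a b
         + of_nat r * (\<Sum>u=1..<r. mult_fst u (mult_snd (r - u) \<phi>) a b)"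
proof -
  let ?\<psi> = "\<lambda>t. \<phi> (a + b - r - t) t"
  let ?A = "{t. t < b \<and> t + r \<le> a + b}" and ?B = "{t. t + r \<le> b}"
  have BA: "?B \<subseteq> ?A" using assms(2) by auto
  have "finite ?A" by simp
  hence "sum ?\<psi> ?A - sum ?\<psi> ?B = sum ?\<psi> (?A - ?B)"
    using BA by (simp add: sum_diff)
  also have "\<dots> = (\<Sum>u\<in>{u\<in>{1..<r}. u \<le> a \<and> r - u \<le> b}. \<phi> (a - u) (b - (r - u)))"
  proof (rule sum.reindex_bij_witness[of _ "\<lambda>u. b - (r - u)" "\<lambda>t. t + r - b"])
    fix t assume t: "t \<in> ?A - ?B"
    hence "a + b - r - t = a - (t + r - b)" by auto
    moreover have "b - (r - (t + r - b)) = t" using t by auto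
    ultimately show "\<phi> (a - (t + r - b)) (b - (r - (t + r - b))) = ?\<psi> t" by simp
  qed auto
  also have "\<dots> = (\<Sum>u=1..<r. mult_fst u (mult_snd (r - u) \<phi>) a b)"
    by (rule sum.mono_neutral_cong_left) (auto simp: mult_fst_def mult_snd_def)
  finally have "sum ?\<psi> ?A - sum ?\<psi> ?B = (\<Sum>u=1..<r. mult_fst u (mult_snd (r - u) \<phi>) a b)" .
  thus ?thesis
    by (simp add: pair_op_mult_fst[OF assms(1)] pair_op_mult_snd algebra_simps flip: distrib_left right_diff_distrib)
qed

section \<open>The Laplace--Beltrami operator\<close>

lemma mcoeff_map_key: "bij \<pi> \<Longrightarrow> mcoeff f (Poly_Mapping.map_key \<pi> m) = mcoeff f m"
  using mcoeff[of f] by blast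

lemma mcoeff_swap:
  assumes "i \<noteq> j"
  shows "mcoeff f (update (update m i x) j y) = mcoeff f (update (update m i y) j x)"
proof -
  have b: "bij (transpose i j)" by simp
  have "Poly_Mapping.map_key (transpose i j) (update (update m i x) j y) = update (update m i y) j x"
    if "lookup m i = lookup m j" for m
    using assms that
    by (intro poly_mapping_eqI) (auto simp: lookup_map_key b bij_is_inj lookup_update transpose_def)
  note * = this[of "update m i (lookup m j)"]
  have "update (update (update m i z) i x) j y = update (update m i x) j y" for x y z
    by (rule poly_mapping_eqI) (auto simp: lookup_update)
  hence "Poly_Mapping.map_key (transpose i j) (update (update m i x) j y) = update (update m i y) j x"
    using * assms by (simp add: lookup_update)
  thus ?thesis using mcoeff_map_key[OF b] by metis
qed

lemma mdeg_superset: "finite I \<Longrightarrow> keys m \<subseteq> I \<Longrightarrow> mdeg m = (\<Sum>i\<in>I. lookup m i)"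
  unfolding mdeg_def by (rule sum.mono_neutral_left) (auto simp: in_keys_iff)

lemma mdeg_update: "mdeg (update m i x) + lookup m i = mdeg m + x"
proof -
  let ?I = "insert i (keys m)"
  have "mdeg (update m i x) = (\<Sum>l\<in>?I. lookup (update m i x) l)"
    using keys_update_subset by (intro mdeg_superset) auto
  also have "\<dots> = x + (\<Sum>l\<in>?I - {i}. lookup m l)"
    by (subst sum.remove[of _ i]) (auto simp: lookup_update intro!: sum.cong)
  finally have 1: "mdeg (update m i x) = x + (\<Sum>l\<in>?I - {i}. lookup m l)" .
  have "mdeg m = (\<Sum>l\<in>?I. lookup m l)" by (intro mdeg_superset) auto
  also have "\<dots> = lookup m i + (\<Sum>l\<in>?I - {i}. lookup m l)"
    by (subst sum.remove[of _ i]) auto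
  finally show ?thesis using 1 by simp
qed

lemma mdeg_update2:
  assumes "i \<noteq> j" "x + y = lookup m i + lookup m j"
  shows "mdeg (update (update m i x) j y) = mdeg m"
  using mdeg_update[of j y "update m i x"] mdeg_update[of i x m] assms by (simp add: lookup_update)

text \<open>The pair operator in the variables x_i and x_j, applied to the slice of \<open>f\<close>
  in which all other exponents are those of \<open>m\<close>.\<close>

definition var_pair :: "nat \<Rightarrow> nat \<Rightarrow> (monomial \<Rightarrow> 'a::comm_ring_1) \<Rightarrow> monomial \<Rightarrow> 'a" where
  "var_pair i j f m = pair_op (\<lambda>x y. f (update (update m i x) j y)) (lookup m i) (lookup m j)"

lemma update_commute: "i \<noteq> j \<Longrightarrow> update (update m i x) j y = update (update m j y) i x"
  by (rule poly_mapping_eqI) (auto simp: lookup_update)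

lemma update_idem [simp]: "update (update m i x) i y = update m i y"
  by (rule poly_mapping_eqI) (auto simp: lookup_update)

lemma update_same [simp]: "update m i (lookup m i) = m"
  by (rule poly_mapping_eqI) (auto simp: lookup_update)

lemma var_pair_commute:
  fixes f :: "'a::field_char_0 symfun"
  assumes "i \<noteq> j"
  shows "var_pair i j (mcoeff f) m = var_pair j i (mcoeff f) m"
proof -
  have "var_pair i j (mcoeff f) m
      = pair_op (\<lambda>x y. mcoeff f (update (update m i x) j y)) (lookup m j) (lookup m i)"
    unfolding var_pair_def using mcoeff_swap[OF assms] by (rule pair_op_commute)
  also have "(\<lambda>x y. mcoeff f (update (update m i x) j y)) = (\<lambda>x y. mcoeff f (update (update m j x) i y))"
    by (intro ext) (subst mcoeff_swap[OF assms], subst update_commute[OF assms], simp)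
  finally show ?thesis by (simp add: var_pair_def)
qed

lemma var_pair_zero_snd: "lookup m j = 0 \<Longrightarrow> var_pair i j f m = 0"
  by (simp add: var_pair_def pair_op_def)

text \<open>The factor x_i x_j makes the pair term divisible by both variables. For the second
  exponent this is visible in the expansion, for the first it follows by symmetry; hence only pairs
  inside the support of a monomial matter.\<close>

lemma var_pair_zero_fst:
  fixes f :: "'a::field_char_0 symfun"
  shows "i \<noteq> j \<Longrightarrow> lookup m i = 0 \<Longrightarrow> var_pair i j (mcoeff f) m = 0"
  by (subst var_pair_commute) (simp_all add: var_pair_zero_snd)

text \<open>The expansion in powers of x_j/x_i is one-sided: it only uses monomials whose exponent
  at \<open>i\<close> is at least that of \<open>m\<close>. Triangularity rests on this.\<close>

lemma var_pair_eq_0I: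
  assumes "i \<noteq> j"
    "\<And>x y. x + y = lookup m i + lookup m j \<Longrightarrow> lookup m i \<le> x \<Longrightarrow> f (update (update m i x) j y) = 0"
  shows "var_pair i j f m = 0"
  using assms by (simp add: var_pair_def pair_op_def del: update_same)

text \<open>The double sum meets every unordered pair twice, with equal contributions for symmetric
  \<open>f\<close>, hence the halving.\<close>

definition lap_coeff :: "(monomial \<Rightarrow> ratfun) \<Rightarrow> monomial \<Rightarrow> ratfun" where
  "lap_coeff f m =
     (\<Sum>i\<in>keys m. kk * (of_nat (lookup m i) * (of_nat (lookup m i) - 1) / 2)) * f m
     + (\<Sum>i\<in>keys m. \<Sum>j\<in>keys m - {i}. var_pair i j f m) / 2"

text \<open>The operator preserves degree. This supplies the degree bound needed for
  \<open>lap\<close> to be a symmetric function.\<close>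

lemma lap_coeff_eq_0I:
  assumes "\<And>m'. mdeg m' = mdeg m \<Longrightarrow> f m' = 0"
  shows "lap_coeff f m = 0"
proof -
  have "var_pair i j f m = 0" if "i \<noteq> j" for i j
    using that mdeg_update2 assms by (intro var_pair_eq_0I) auto
  hence "(\<Sum>i\<in>keys m. \<Sum>j\<in>keys m - {i}. var_pair i j f m) = 0" by (intro sum.neutral) auto
  thus ?thesis using assms[of m] by (simp add: lap_coeff_def)
qed

lemma update_map_key:
  assumes "bij \<pi>"
  shows "update (Poly_Mapping.map_key \<pi> m) i x = Poly_Mapping.map_key \<pi> (update m (\<pi> i) x)"
  using bij_is_inj[OF assms] by (intro poly_mapping_eqI) (auto simp: lookup_map_key lookup_update inj_eq)

lemma lap_coeff_map_key:
  assumes "bij \<pi>"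
  shows "lap_coeff (mcoeff f) (Poly_Mapping.map_key \<pi> m) = lap_coeff (mcoeff f) m"
proof -
  let ?m = "Poly_Mapping.map_key \<pi> m"
  have inj: "inj \<pi>" using assms by (rule bij_is_inj)
  have K: "keys ?m = \<pi> -` keys m" by (simp add: keys_map_key inj)
  have reindex: "(\<Sum>i\<in>\<pi> -` S. h (\<pi> i)) = (\<Sum>i\<in>S. h i)" for S and h :: "nat \<Rightarrow> ratfun"
    using sum.reindex[of \<pi> "\<pi> -` S" h] inj_on_subset[OF inj] bij_is_surj[OF assms] by simp
  have vp: "var_pair i j (mcoeff f) ?m = var_pair (\<pi> i) (\<pi> j) (mcoeff f) m" for i j
    by (simp add: var_pair_def update_map_key assms mcoeff_map_key lookup_map_key inj)
  have d: "\<pi> -` S - {i} = \<pi> -` (S - {\<pi> i})" for S i using inj by (auto simp: inj_eq)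
  show ?thesis
    unfolding lap_coeff_def K
    by (simp add: vp lookup_map_key inj mcoeff_map_key assms d
        reindex[of "\<lambda>i. kk * (of_nat (lookup m i) * (of_nat (lookup m i) - 1)) / 2"]
        reindex[of "\<lambda>j. var_pair (\<pi> _) j (mcoeff f) m"]
        reindex[of "\<lambda>i. \<Sum>j\<in>keys m - {i}. var_pair i j (mcoeff f) m"])
qed

text \<open>
  In finitely many variables this is the polynomial operator
  $\frac k2\sum_i x_i^2\partial_i^2 + \sum_{i<j}\frac{x_ix_j}{x_i-x_j}(\partial_i-\partial_j)$.
\<close>

definition lap :: "ratfun symfun \<Rightarrow> ratfun symfun" where
  "lap f = Abs_symfun (lap_coeff (mcoeff f))"

lemma mcoeff_lap_keys: "mcoeff (lap f) m = lap_coeff (mcoeff f) m"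
proof -
  obtain d where d: "\<And>m. mcoeff f m \<noteq> 0 \<Longrightarrow> mdeg m \<le> d" using mcoeff[of f] by blast
  have "mdeg m \<le> d" if "lap_coeff (mcoeff f) m \<noteq> 0" for m
    using that lap_coeff_eq_0I[of m "mcoeff f"] d by metis
  thus ?thesis unfolding lap_def using lap_coeff_map_key[of _ f]
    by (subst Abs_symfun_inverse) auto
qed

lemma mcoeff_lap:
  assumes "finite I" "keys m \<subseteq> I"
  shows "mcoeff (lap f) m =
     (\<Sum>i\<in>I. kk * (of_nat (lookup m i) * (of_nat (lookup m i) - 1) / 2)) * mcoeff f m
     + (\<Sum>i\<in>I. \<Sum>j\<in>I - {i}. var_pair i j (mcoeff f) m) / 2"
proof -
  have "(\<Sum>i\<in>keys m. kk * (of_nat (lookup m i) * (of_nat (lookup m i) - 1) / 2))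
      = (\<Sum>i\<in>I. kk * (of_nat (lookup m i) * (of_nat (lookup m i) - 1) / 2))"
    using assms by (intro sum.mono_neutral_left) (auto simp: in_keys_iff)
  moreover have "(\<Sum>i\<in>keys m. \<Sum>j\<in>keys m - {i}. var_pair i j (mcoeff f) m)
      = (\<Sum>i\<in>I. \<Sum>j\<in>I - {i}. var_pair i j (mcoeff f) m)"
    using assms
    by (intro sum.mono_neutral_cong_left ballI sum.neutral)
       (auto simp: in_keys_iff var_pair_zero_fst var_pair_zero_snd)
  ultimately show ?thesis by (simp add: mcoeff_lap_keys lap_coeff_def)
qed

section \<open>Commutator of the operator with a power sum, on coefficients\<close>

lemma var_pair_sum: "var_pair i j (\<lambda>m. \<Sum>l\<in>I. f l m) m = (\<Sum>l\<in>I. var_pair i j (f l) m)"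
  unfolding var_pair_def pair_op_def sum_distrib_left sum_subtractf
  by (subst sum.swap) simp

lemma var_pair_cong:
  assumes "i \<in> I" "j \<in> I" "keys m \<subseteq> I" "\<And>m. keys m \<subseteq> I \<Longrightarrow> f m = g m"
  shows "var_pair i j f m = var_pair i j g m"
proof -
  have "f (update (update m i x) j y) = g (update (update m i x) j y)" for x y
    using assms(1-3) keys_update_subset[of j y "update m i x"] keys_update_subset[of i x m]
    by (intro assms(4)) blast
  thus ?thesis by (simp add: var_pair_def)
qed

lemma var_pair_var_mult_other:
  assumes "l \<noteq> i" "l \<noteq> j"
  shows "var_pair i j (var_mult r l f) m = var_mult r l (var_pair i j f) m"
proof -
  have u: "update (update (update m i x) j y) l z = update (update (update m l z) i x) j y" for x y z
    using assms by (intro poly_mapping_eqI) (auto simp: lookup_update)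
  have v: "update (update (update m l z) i (lookup m i)) j (lookup m j) = update m l z" for z
    using assms by (intro poly_mapping_eqI) (auto simp: lookup_update)
  show ?thesis using assms
    by (auto simp: var_pair_def var_mult_def lookup_update u v pair_op_def)
qed

lemma var_pair_var_mult_fst:
  assumes "i \<noteq> j"
  shows "var_pair i j (var_mult r i f) m
      = pair_op (mult_fst r (\<lambda>x y. f (update (update m i x) j y))) (lookup m i) (lookup m j)"
proof -
  have u: "update (update (update m i x) j y) i z = update (update m i z) j y" for x y z
    using assms by (intro poly_mapping_eqI) (auto simp: lookup_update)
  show ?thesis using assms
    by (simp add: var_pair_def var_mult_def lookup_update u mult_fst_def[abs_def] cong: if_cong)
qed

lemma var_pair_var_mult_snd:
  assumes "i \<noteq> j"
  shows "var_pair i j (var_mult r j f) m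
      = pair_op (mult_snd r (\<lambda>x y. f (update (update m i x) j y))) (lookup m i) (lookup m j)"
  using assms by (simp add: var_pair_def var_mult_def lookup_update mult_snd_def[abs_def] cong: if_cong)

lemma var_mult_fst_var_pair:
  assumes "i \<noteq> j"
  shows "var_mult r i (var_pair i j f) m
      = mult_fst r (pair_op (\<lambda>x y. f (update (update m i x) j y))) (lookup m i) (lookup m j)"
  using assms by (simp add: var_pair_def var_mult_def lookup_update mult_fst_def)

lemma var_mult_snd_var_pair:
  assumes "i \<noteq> j"
  shows "var_mult r j (var_pair i j f) m
      = mult_snd r (pair_op (\<lambda>x y. f (update (update m i x) j y))) (lookup m i) (lookup m j)"
proof -
  have u: "update (update (update m j z) i x) j y = update (update m i x) j y" for x y z
    using assms by (intro poly_mapping_eqI) (auto simp: lookup_update)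
  show ?thesis using assms by (simp add: var_pair_def var_mult_def lookup_update mult_snd_def u)
qed

lemma var_mult_fst_var_mult_snd:
  assumes "i \<noteq> j"
  shows "var_mult u i (var_mult v j f) m
      = mult_fst u (mult_snd v (\<lambda>x y. f (update (update m i x) j y))) (lookup m i) (lookup m j)"
  using assms by (simp add: var_mult_def lookup_update mult_fst_def mult_snd_def)

text \<open>In p_r, the summands x_l^r with l different from i and j commute with the pair operator;
  the remaining two together give the correction of \<open>pair_op_mult\<close>.\<close>

lemma var_pair_psum_mult:
  fixes f :: "'a::field_char_0 symfun"
  assumes r: "r > 0" and I: "finite I" "keys m \<subseteq> I" and ij: "i \<in> I" "j \<in> I" "i \<noteq> j"
  shows "var_pair i j (mcoeff (psum r * f)) m
       = (\<Sum>l\<in>I. var_mult r l (var_pair i j (mcoeff f)) m)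
         + of_nat r * (\<Sum>u=1..<r. var_mult u i (var_mult (r - u) j (mcoeff f)) m)"
proof -
  let ?g = "mcoeff f"
  have "var_pair i j (mcoeff (psum r * f)) m = var_pair i j (\<lambda>m. \<Sum>l\<in>I. var_mult r l ?g m) m"
    using ij I r by (intro var_pair_cong[of i I]) (auto simp: mcoeff_psum_mult)
  also have "\<dots> = (\<Sum>l\<in>I. var_pair i j (var_mult r l ?g) m)" by (rule var_pair_sum)
  also have "\<dots> = (\<Sum>l\<in>I - {i, j}. var_pair i j (var_mult r l ?g) m)
      + (var_pair i j (var_mult r i ?g) m + var_pair i j (var_mult r j ?g) m)"
    using sum.subset_diff[of "{i, j}" I "\<lambda>l. var_pair i j (var_mult r l ?g) m"] ij I by simp
  also have "(\<Sum>l\<in>I - {i, j}. var_pair i j (var_mult r l ?g) m)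
      = (\<Sum>l\<in>I - {i, j}. var_mult r l (var_pair i j ?g) m)"
    by (intro sum.cong refl var_pair_var_mult_other) auto
  also have "var_pair i j (var_mult r i ?g) m + var_pair i j (var_mult r j ?g) m
      = var_mult r i (var_pair i j ?g) m + var_mult r j (var_pair i j ?g) m
        + of_nat r * (\<Sum>u=1..<r. var_mult u i (var_mult (r - u) j ?g) m)"
    unfolding var_pair_var_mult_fst[OF ij(3)] var_pair_var_mult_snd[OF ij(3)]
      var_mult_fst_var_pair[OF ij(3)] var_mult_snd_var_pair[OF ij(3)] var_mult_fst_var_mult_snd[OF ij(3)]
    using mcoeff_swap[OF ij(3)] r by (rule pair_op_mult)
  finally show ?thesis
    using sum.subset_diff[of "{i, j}" I "\<lambda>l. var_mult r l (var_pair i j ?g) m"] ij I by (simp add: add.assoc)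
qed

text \<open>The second-order part yields k r times the sum of x_l^(r+1) d_l and k r(r-1)/2 p_r. The
  pair terms yield r/2 times the sum of x_i^u x_j^(r-u) over i \<noteq> j and 0 < u < r, which is a
  sum of p_u p_(r-u) - p_r.\<close>

lemma mcoeff_lap_psum_mult:
  assumes r: "r > 0" and I: "finite I" "keys m \<subseteq> I"
  shows "mcoeff (lap (psum r * f)) m = mcoeff (psum r * lap f) m
      + kk * of_nat r * (\<Sum>l\<in>I. (of_nat (lookup m l) - of_nat r) * var_mult r l (mcoeff f) m)
      + kk * (of_nat r * (of_nat r - 1) / 2) * mcoeff (psum r * f) m
      + of_nat r / 2 * ((\<Sum>u=1..<r. mcoeff (psum u * (psum (r - u) * f)) m)
          - (of_nat r - 1) * mcoeff (psum r * f) m)"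
proof -
  let ?g = "mcoeff f" and ?h = "mcoeff (psum r * f)"
  let ?c = "\<lambda>n. kk * (of_nat n * (of_nat n - 1) / 2) :: ratfun"
  let ?e = "\<lambda>l. (of_nat (lookup m l) - of_nat r) * var_mult r l (mcoeff f) m"
  have h: "?h m = (\<Sum>l\<in>I. var_mult r l ?g m)" using assms by (simp add: mcoeff_psum_mult)
  have vl: "var_mult r l (mcoeff (lap f)) m
      = (\<Sum>i\<in>I. ?c (lookup m i)) * var_mult r l ?g m - kk * of_nat r * ?e l - ?c r * var_mult r l ?g m
        + (\<Sum>i\<in>I. \<Sum>j\<in>I - {i}. var_mult r l (var_pair i j ?g) m) / 2" if l: "l \<in> I" for l
  proof (cases "r \<le> lookup m l")
    case True
    let ?n = "update m l (lookup m l - r)"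
    have k: "keys ?n \<subseteq> I" using keys_update_subset[of l "lookup m l - r" m] l I by blast
    have "(\<Sum>i\<in>I. ?c (lookup ?n i)) = ?c (lookup m l - r) + (\<Sum>i\<in>I - {l}. ?c (lookup m i))"
      using l I by (subst sum.remove[of _ l]) (auto simp: lookup_update intro!: sum.cong)
    also have "\<dots> = (\<Sum>i\<in>I. ?c (lookup m i)) + (?c (lookup m l - r) - ?c (lookup m l))"
      using l I by (subst (2) sum.remove[of _ l]) auto
    \<comment> \<open>With n the exponent at \<open>l\<close>, this is binomial(n,2) =
      binomial(n-r,2) + binomial(r,2) + r(n-r).\<close>
    also have "?c (lookup m l - r) - ?c (lookup m l) = - kk * of_nat r * (of_nat (lookup m l) - of_nat r) - ?c r"
      using True by (simp add: of_nat_diff field_simps)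
    finally have s: "(\<Sum>i\<in>I. ?c (lookup ?n i)) = (\<Sum>i\<in>I. ?c (lookup m i)) + \<dots>" .
    show ?thesis
      using True unfolding var_mult_def
      by (simp only: if_True mcoeff_lap[OF I(1) k] s) (simp add: algebra_simps)
  qed (simp add: var_mult_def)
  have "(\<Sum>i\<in>I. \<Sum>j\<in>I - {i}. var_pair i j ?h m)
      = (\<Sum>i\<in>I. \<Sum>j\<in>I - {i}. \<Sum>l\<in>I. var_mult r l (var_pair i j ?g) m)
        + of_nat r * (\<Sum>i\<in>I. \<Sum>j\<in>I - {i}. \<Sum>u=1..<r. var_mult u i (var_mult (r - u) j ?g) m)"
    unfolding sum_distrib_left sum.distrib[symmetric]
    using var_pair_psum_mult[OF r I, of _ _ f] by (intro sum.cong refl) (auto simp: sum_distrib_left)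
  also have "(\<Sum>i\<in>I. \<Sum>j\<in>I - {i}. \<Sum>l\<in>I. var_mult r l (var_pair i j ?g) m)
      = (\<Sum>l\<in>I. \<Sum>i\<in>I. \<Sum>j\<in>I - {i}. var_mult r l (var_pair i j ?g) m)"
    by (subst (2) sum.swap, subst sum.swap) simp
  also have "(\<Sum>i\<in>I. \<Sum>j\<in>I - {i}. \<Sum>u=1..<r. var_mult u i (var_mult (r - u) j ?g) m)
      = (\<Sum>u=1..<r. \<Sum>i\<in>I. \<Sum>j\<in>I - {i}. var_mult u i (var_mult (r - u) j ?g) m)"
    by (subst (2) sum.swap, subst sum.swap) simp
  also have "\<dots> = (\<Sum>u=1..<r. mcoeff (psum u * (psum (r - u) * f)) m - ?h m)"
  proof (rule sum.cong, simp)
    fix u assume u: "u \<in> {1..<r}"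
    \<comment> \<open>The excluded diagonal term x_i^u x_i^(r-u) is x_i^r, which is how p_r gets
      subtracted.\<close>
    have "(\<Sum>j\<in>I - {i}. var_mult u i (var_mult (r - u) j ?g) m)
        = (\<Sum>j\<in>I. var_mult u i (var_mult (r - u) j ?g) m) - var_mult r i ?g m" if "i \<in> I" for i
      using u that I by (simp add: sum_diff1 var_mult_twice)
    thus "(\<Sum>i\<in>I. \<Sum>j\<in>I - {i}. var_mult u i (var_mult (r - u) j ?g) m) = mcoeff (psum u * (psum (r - u) * f)) m - ?h m"
      using u I by (simp add: mcoeff_psum_psum_mult[of u "r - u" I] h sum_subtractf)
  qed
  also have "\<dots> = (\<Sum>u=1..<r. mcoeff (psum u * (psum (r - u) * f)) m) - (of_nat r - 1) * ?h m"
    using r by (simp add: sum_subtractf of_nat_diff)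
  finally have vp: "(\<Sum>i\<in>I. \<Sum>j\<in>I - {i}. var_pair i j ?h m)
      = (\<Sum>l\<in>I. \<Sum>i\<in>I. \<Sum>j\<in>I - {i}. var_mult r l (var_pair i j ?g) m)
        + of_nat r * ((\<Sum>u=1..<r. mcoeff (psum u * (psum (r - u) * f)) m) - (of_nat r - 1) * ?h m)" .
  have "mcoeff (psum r * lap f) m = (\<Sum>l\<in>I. var_mult r l (mcoeff (lap f)) m)"
    using assms by (simp add: mcoeff_psum_mult)
  also have "\<dots> = (\<Sum>i\<in>I. ?c (lookup m i)) * ?h m - kk * of_nat r * (\<Sum>l\<in>I. ?e l) - ?c r * ?h m
      + (\<Sum>l\<in>I. \<Sum>i\<in>I. \<Sum>j\<in>I - {i}. var_mult r l (var_pair i j ?g) m) / 2"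
    unfolding h sum_distrib_left sum_divide_distrib sum.distrib[symmetric] sum_subtractf[symmetric]
    by (intro sum.cong refl) (simp add: vl sum_distrib_right sum_divide_distrib)
  finally show ?thesis
    unfolding mcoeff_lap[OF I, of "psum r * f"] vp
    by (simp add: field_simps)
qed

section \<open>The Laplace--Beltrami operator in terms of power sums\<close>

definition const :: "'a::comm_ring_1 \<Rightarrow> 'a symfun" where
  "const c = scale c 1"

lemma scale_conv_const: "scale c f = const c * f"
proof (rule symfun_eqI)
  fix m
  have "mcoeff (scale c 1 * f) m = c * mcoeff (1 * f) m"
    by (simp add: times_symfun.rep_eq scale.rep_eq case_prod_unfold sum_distrib_left mult.assoc del: mult_1)
  thus "mcoeff (scale c f) m = mcoeff (const c * f) m" by (simp add: scale.rep_eq const_def)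
qed

lemma mcoeff_const_mult: "mcoeff (const c * f) m = c * mcoeff f m"
  by (simp add: scale.rep_eq flip: scale_conv_const)

lemma const_add: "const (a + b) = const a + const b"
  and const_diff: "const (a - b) = const a - const b"
  and const_mult: "const (a * b) = const a * const b"
  and const_1: "const 1 = 1"
  and const_0: "const 0 = 0"
  by (simp_all add: symfun_eqI const_def plus_symfun.rep_eq minus_symfun.rep_eq scale.rep_eq
      algebra_simps zero_symfun.rep_eq mcoeff_const_mult[unfolded const_def])

lemma const_of_nat: "const (of_nat n) = of_nat n"
  by (induction n) (simp_all add: const_0 const_1 const_add)

lemma mcoeff_of_nat_mult: "mcoeff (of_nat n * f) m = of_nat n * mcoeff f m"
  by (simp add: mcoeff_const_mult flip: const_of_nat)

text \<open>An indeterminate satisfies no linear relation. Nonvanishing of eigenvalue differences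
  and of the denominators in the Pieri factors is reduced to this.\<close>

lemma kk_linear_eq_0_iff: "of_int a + kk * of_int b = 0 \<longleftrightarrow> a = 0 \<and> b = 0"
proof -
  have nat: "(of_nat n :: ratfun) = Fract (of_nat n) 1" for n
    by (induction n) (simp_all add: Zero_fract_def One_fract_def)
  have int: "(of_int n :: ratfun) = Fract (of_int n) 1" for n
    by (cases n rule: int_diff_cases) (simp add: nat)
  have "of_int a + kk * of_int b = Fract ([:of_int a:] + [:0, 1:] * [:of_int b:]) 1"
    by (simp add: kk_def int of_int_poly)
  also have "\<dots> = 0 \<longleftrightarrow> a = 0 \<and> b = 0"
    by (simp add: Zero_fract_def eq_fract)
  finally show ?thesis .
qed

lemma kk_nz [simp]: "kk \<noteq> 0"
  using kk_linear_eq_0_iff[of 0 1] by simp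

abbreviation K :: "ratfun symfun" where "K \<equiv> const kk"
abbreviation half :: "ratfun symfun" where "half \<equiv> const (1 / 2)"

lemma half_add_half [simp]: "half * f + half * f = f"
  by (simp add: const_1 flip: distrib_right const_add)

text \<open>Obtained by solving the commutator formula for its first-order part. This makes it a
  symmetric function by construction, with no separate check of symmetry and bounded degree.\<close>

definition shear :: "nat \<Rightarrow> ratfun symfun \<Rightarrow> ratfun symfun" where
  "shear r f = const (1 / (kk * of_nat r)) * (lap (psum r * f) - psum r * lap f
     - half * K * of_nat r * (of_nat r - 1) * (psum r * f)
     - half * of_nat r * ((\<Sum>u=1..<r. psum u * (psum (r - u) * f)) - (of_nat r - 1) * (psum r * f)))"

lemma lap_psum_mult:
  assumes "r > 0"
  shows "lap (psum r * f) = psum r * lap f + K * of_nat r * shear r f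
     + half * K * of_nat r * (of_nat r - 1) * (psum r * f)
     + half * of_nat r * ((\<Sum>u=1..<r. psum u * (psum (r - u) * f)) - (of_nat r - 1) * (psum r * f))"
proof -
  have "K * of_nat r * const (1 / (kk * of_nat r)) = 1"
    using assms by (simp flip: const_of_nat const_mult const_1)
  thus ?thesis unfolding shear_def mult.assoc[symmetric] by (simp add: mult.assoc)
qed

text \<open>Thus \<open>shear r\<close> is the derivation $\sum_i x_i^{r+1}\partial_i$.\<close>

lemma mcoeff_shear:
  assumes "r > 0" "finite I" "keys m \<subseteq> I"
  shows "mcoeff (shear r f) m = (\<Sum>l\<in>I. (of_nat (lookup m l) - of_nat r) * var_mult r l (mcoeff f) m)"
proof -
  have 1: "mcoeff ((of_nat r - 1) * g) m = (of_nat r - 1) * mcoeff g m" for g :: "ratfun symfun"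
    by (simp add: minus_symfun.rep_eq left_diff_distrib mcoeff_of_nat_mult)
  show ?thesis
    using mcoeff_lap_psum_mult[OF assms, of f] assms(1)
    by (simp add: shear_def mcoeff_const_mult minus_symfun.rep_eq mcoeff_of_nat_mult 1 mcoeff_sum
        mult.assoc)
qed

text \<open>The product rule for the derivation, which sends p_s to s p_(r+s). On coefficients the
  extra term arises at l = j, where the weight is read off after the exponent has been lowered by
  \<open>s\<close>.\<close>

lemma shear_psum_mult:
  assumes "r > 0" "s > 0"
  shows "shear r (psum s * f) = psum s * shear r f + of_nat s * (psum (r + s) * f)"
proof (rule symfun_eqI)
  fix m
  let ?I = "keys m" and ?g = "mcoeff f"
  let ?w = "\<lambda>l. of_nat (lookup m l) - of_nat r :: ratfun"
  have I: "finite ?I" "keys m \<subseteq> ?I" by auto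
  have upd: "keys (update m j a) \<subseteq> ?I" if "j \<in> ?I" for j a
    using keys_update_subset[of j a m] that by blast
  have 1: "var_mult s j (mcoeff (shear r f)) m
      = (\<Sum>l\<in>?I. ?w l * var_mult r l (var_mult s j ?g) m) - of_nat s * var_mult (r + s) j ?g m"
    if j: "j \<in> ?I" for j
  proof (cases "s \<le> lookup m j")
    case True
    let ?n = "update m j (lookup m j - s)"
    have "var_mult s j (mcoeff (shear r f)) m = (\<Sum>l\<in>?I. (of_nat (lookup ?n l) - of_nat r) * var_mult r l ?g ?n)"
      using True mcoeff_shear[OF assms(1) I(1) upd[OF j]] by (simp add: var_mult_def[of s])
    also have "\<dots> = (\<Sum>l\<in>?I. ?w l * var_mult r l (var_mult s j ?g) m - (if l = j then of_nat s * var_mult (r + s) j ?g m else 0))"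
    proof (rule sum.cong, simp)
      fix l
      show "(of_nat (lookup ?n l) - of_nat r) * var_mult r l ?g ?n
          = ?w l * var_mult r l (var_mult s j ?g) m - (if l = j then of_nat s * var_mult (r + s) j ?g m else 0)"
      proof (cases "l = j")
        case False
        hence "var_mult r l ?g ?n = var_mult r l (var_mult s j ?g) m"
          using True var_mult_commute[OF False, of r s ?g m] by (simp add: var_mult_def[of s])
        thus ?thesis using False by (simp add: lookup_update)
      next
        case l: True
        have "var_mult r l ?g ?n = var_mult (r + s) j ?g m"
          using True by (simp add: l var_mult_def lookup_update add.commute le_diff_conv2)
        thus ?thesis using True l by (simp add: lookup_update var_mult_twice of_nat_diff algebra_simps)
      qed
    qed
    finally show ?thesis using j by (simp add: sum_subtractf)
  next
    case False
    hence "var_mult r l (var_mult s j ?g) m = 0" for l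
      by (auto simp: var_mult_def lookup_update)
    moreover have "var_mult (r + s) j ?g m = 0" using False by (simp add: var_mult_def)
    moreover have "var_mult s j (mcoeff (shear r f)) m = 0" using False by (simp add: var_mult_def)
    ultimately show ?thesis by simp
  qed
  have 2: "var_mult r l (mcoeff (psum s * f)) m = (\<Sum>j\<in>?I. var_mult r l (var_mult s j ?g) m)" if "l \<in> ?I" for l
    using mcoeff_psum_mult[OF assms(2) I(1) upd[OF that], of f] by (simp add: var_mult_def[of r])
  have "mcoeff (shear r (psum s * f)) m = (\<Sum>j\<in>?I. \<Sum>l\<in>?I. ?w l * var_mult r l (var_mult s j ?g) m)"
    unfolding mcoeff_shear[OF assms(1) I]
    by (subst sum.swap) (simp add: 2 sum_distrib_left)
  also have "\<dots> = (\<Sum>j\<in>?I. var_mult s j (mcoeff (shear r f)) m) + of_nat s * (\<Sum>j\<in>?I. var_mult (r + s) j ?g m)"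
    unfolding sum_distrib_left sum.distrib[symmetric] by (intro sum.cong refl) (simp add: 1)
  also have "\<dots> = mcoeff (psum s * shear r f + of_nat s * (psum (r + s) * f)) m"
    using assms by (simp add: plus_symfun.rep_eq mcoeff_of_nat_mult mcoeff_psum_mult[OF _ I])
  finally show "mcoeff (shear r (psum s * f)) m = \<dots>" .
qed

lemma shear_1: "r > 0 \<Longrightarrow> shear r 1 = 0"
proof (rule symfun_eqI)
  fix m assume r: "r > 0"
  \<comment> \<open>An exponent above \<open>r\<close> leaves a nonconstant monomial, an exponent
    equal to \<open>r\<close> has weight zero, and a smaller one is excluded by
    \<open>var_mult\<close>.\<close>
  have z: "(of_nat (lookup m l) - of_nat r) * var_mult r l (mcoeff 1) m = (0 :: ratfun)" for l
  proof (cases "lookup m l > r")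
    case True
    have "update m l (lookup m l - r) \<noteq> 0"
      using True lookup_update[of l "lookup m l - r" m l] by (metis lookup_zero zero_less_diff less_irrefl)
    thus ?thesis by (simp add: var_mult_def one_symfun.rep_eq)
  qed (auto simp: var_mult_def)
  show "mcoeff (shear r 1) m = mcoeff 0 m"
    unfolding mcoeff_shear[OF r finite_keys subset_refl] z by (simp add: zero_symfun.rep_eq)
qed

lemma var_pair_add: "var_pair i j (\<lambda>m. f m + g m) m = var_pair i j f m + var_pair i j g m"
  by (simp add: var_pair_def pair_op_def distrib_left sum.distrib)

lemma var_pair_scale: "var_pair i j (\<lambda>m. c * f m) m = c * var_pair i j f m"
  by (simp add: var_pair_def pair_op_def right_diff_distrib sum_distrib_left mult_ac)

lemma lap_add: "lap (f + g) = lap f + lap g"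
  by (rule symfun_eqI)
     (simp add: mcoeff_lap_keys lap_coeff_def plus_symfun.rep_eq fun_eq_iff var_pair_add sum.distrib algebra_simps add_divide_distrib)

lemma lap_scale: "lap (scale c f) = scale c (lap f)"
  by (rule symfun_eqI)
     (simp add: mcoeff_lap_keys lap_coeff_def scale.rep_eq fun_eq_iff var_pair_scale algebra_simps flip: sum_distrib_left)

lemma lap_1: "lap 1 = 0"
proof (rule symfun_eqI)
  fix m
  show "mcoeff (lap 1) m = mcoeff 0 m"
  proof (cases "m = 0")
    case False
    hence "mdeg m \<noteq> 0" by (auto simp: mdeg_def in_keys_iff poly_mapping_eq_iff fun_eq_iff)
    hence "lap_coeff (mcoeff 1) m = 0"
      by (intro lap_coeff_eq_0I) (auto simp: one_symfun.rep_eq mdeg_def split: if_splits)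
    thus ?thesis by (simp add: mcoeff_lap_keys zero_symfun.rep_eq)
  qed (simp add: mcoeff_lap_keys lap_coeff_def zero_symfun.rep_eq)
qed

lemma pprod_induct [case_names pprod add scale]:
  fixes f :: "'a::field_char_0 symfun"
  assumes pprod: "\<And>xs. 0 \<notin> set xs \<Longrightarrow> Q (pprod xs)"
    and add: "\<And>f g. Q f \<Longrightarrow> Q g \<Longrightarrow> Q (f + g)" and scale: "\<And>c f. Q f \<Longrightarrow> Q (scale c f)"
  shows "Q f"
proof -
  have "f \<in> symfun.span (pprod ` partitions)" by (simp add: span_pprod)
  thus ?thesis
  proof (induction rule: symfun.span_induct_alt)
    case base
    show ?case using scale[OF pprod[of "[]"], of 0] by simp
  next
    case (step c x y)
    then obtain xs where "xs \<in> partitions" "x = pprod xs" by blast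
    thus ?case using step pprod by (auto simp: partitions_def intro!: add scale)
  qed
qed

section \<open>Differentiation by power sums and the adjoint of p_r\<close>

lemma pprod_mset: "mset xs = mset ys \<Longrightarrow> pprod xs = pprod ys"
  unfolding pprod_def by (simp flip: prod_mset_prod_list)

lemma pprod_Cons: "pprod (r # xs) = psum r * pprod xs"
  by (simp add: pprod_def)

text \<open>The partial derivative d/dp_r, with the power sums regarded as free polynomial
  generators.\<close>

definition psum_deriv :: "nat \<Rightarrow> ratfun symfun \<Rightarrow> ratfun symfun" where
  "psum_deriv r f = (\<Sum>xs | xs \<in> partitions \<and> pcoord f xs \<noteq> 0.
     scale (pcoord f xs * of_nat (count_list xs r)) (pprod (remove1 r xs)))"

lemma psum_deriv_eq:
  assumes "finite A" "A \<subseteq> partitions" "\<And>xs. xs \<in> partitions \<Longrightarrow> pcoord f xs \<noteq> 0 \<Longrightarrow> xs \<in> A"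
  shows "psum_deriv r f = (\<Sum>xs\<in>A. scale (pcoord f xs * of_nat (count_list xs r)) (pprod (remove1 r xs)))"
  unfolding psum_deriv_def using assms by (intro sum.mono_neutral_left) auto

lemma psum_deriv_add: "psum_deriv r (f + g) = psum_deriv r f + psum_deriv r g"
proof -
  let ?A = "{xs. xs \<in> partitions \<and> pcoord f xs \<noteq> 0} \<union> {xs. xs \<in> partitions \<and> pcoord g xs \<noteq> 0}"
  have A: "finite ?A" "?A \<subseteq> partitions" by (auto simp: finite_pcoord)
  show ?thesis
    by (subst (1 2 3) psum_deriv_eq[OF A])
       (auto simp: pcoord_add sum.distrib[symmetric] distrib_right symfun.scale_left_distrib)
qed

lemma psum_deriv_scale: "psum_deriv r (scale c f) = scale c (psum_deriv r f)"
  by (subst (1 2) psum_deriv_eq[OF finite_pcoord[of f]])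
     (auto simp: pcoord_scale symfun.scale_sum_right mult.assoc)

lemma psum_deriv_pprod:
  assumes "0 \<notin> set xs"
  shows "psum_deriv r (pprod xs) = of_nat (count_list xs r) * pprod (remove1 r xs)"
proof -
  obtain ys where ys: "ys \<in> partitions" "mset ys = mset xs"
    using ex_partition[of "mset xs"] assms by auto
  have "psum_deriv r (pprod ys) = scale (of_nat (count_list ys r)) (pprod (remove1 r ys))"
    using ys(1) by (subst psum_deriv_eq[of "{ys}"]) (auto simp: pcoord_pprod split: if_splits)
  moreover have "count_list ys r = count_list xs r"
    using ys(2) by (simp flip: count_mset)
  moreover have "pprod (remove1 r ys) = (pprod (remove1 r xs) :: ratfun symfun)"
    using ys(2) by (intro pprod_mset) simp
  ultimately show ?thesis using pprod_mset[OF ys(2), where 'a = ratfun] by (simp add: scale_conv_const const_of_nat)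
qed

lemma psum_deriv_psum_mult:
  assumes "s > 0"
  shows "psum_deriv r (psum s * f) = psum s * psum_deriv r f + (if r = s then f else 0)"
proof (induction f rule: pprod_induct)
  case (pprod xs)
  have *: "psum_deriv r (psum s * pprod xs) = of_nat (count_list (s # xs) r) * pprod (remove1 r (s # xs))"
    using pprod assms psum_deriv_pprod[of "s # xs" r] by (simp add: pprod_Cons)
  show ?case
  proof (cases "r = s")
    case True
    show ?thesis
    proof (cases "r \<in> set xs")
      case r: True
      hence "pprod xs = psum r * (pprod (remove1 r xs) :: ratfun symfun)"
        unfolding pprod_Cons[symmetric] by (intro pprod_mset) simp
      hence "psum r * (of_nat (count_list xs r) * pprod (remove1 r xs)) = of_nat (count_list xs r) * (pprod xs :: ratfun symfun)"
        by (simp add: mult.left_commute)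
      thus ?thesis using True pprod by (simp add: *[unfolded True] psum_deriv_pprod distrib_right)
    qed (use True pprod in \<open>simp add: *[unfolded True] psum_deriv_pprod\<close>)
  qed (use pprod in \<open>simp add: * psum_deriv_pprod pprod_Cons mult.left_commute\<close>)
next
  case (add f g)
  thus ?case by (simp add: psum_deriv_add distrib_left)
next
  case (scale c f)
  have "psum s * scale c f = scale c (psum s * f)" by (simp add: scale_conv_const mult_ac)
  thus ?case using scale by (simp add: psum_deriv_scale symfun.scale_right_distrib) (simp add: scale_conv_const mult_ac)
qed

lemma zee_Cons: "zee (r # xs) = r * (count_list xs r + 1) * zee xs"
proof (cases "r \<in> set xs")
  case True
  let ?h = "\<lambda>ys j. j ^ count_list ys j * fact (count_list ys j) :: nat"
  have "(\<Prod>j\<in>set xs - {r}. ?h (r # xs) j) = (\<Prod>j\<in>set xs - {r}. ?h xs j)"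
    by (intro prod.cong) auto
  thus ?thesis using True
    by (simp add: zee_def insert_absorb prod.remove[of _ r] algebra_simps)
next
  case False
  hence "count_list xs r = 0" by (simp add: count_list_0_iff)
  moreover have "(\<Prod>j\<in>set xs. j ^ count_list (r # xs) j * fact (count_list (r # xs) j)) = zee xs"
    unfolding zee_def using False by (intro prod.cong) auto
  ultimately show ?thesis using False by (simp add: zee_def)
qed

lemma zee_mset:
  assumes "mset xs = mset ys"
  shows "zee xs = zee ys"
proof -
  have "count_list xs = count_list ys" using assms by (simp add: fun_eq_iff flip: count_mset)
  thus ?thesis using mset_eq_setD[OF assms] by (simp add: zee_def)
qed

lemma jack_inner_pprod_mset:
  assumes "0 \<notin> set xs" "0 \<notin> set ys"
  shows "jack_inner (pprod xs) (pprod ys) = (if mset xs = mset ys then kk ^ length xs * of_nat (zee xs) else 0)"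
proof -
  obtain xs' ys' where *: "xs' \<in> partitions" "mset xs' = mset xs" "ys' \<in> partitions" "mset ys' = mset ys"
    using ex_partition[of "mset xs"] ex_partition[of "mset ys"] assms by auto
  have "xs' = ys' \<longleftrightarrow> mset xs = mset ys" using * partitions_mset_eq by metis
  moreover have "length xs' = length xs" using * by (metis size_mset)
  ultimately show ?thesis
    using jack_inner_pprod[OF *(1,3)] pprod_mset[OF *(2), where 'a = ratfun] pprod_mset[OF *(4), where 'a = ratfun] zee_mset[OF *(2)] by simp
qed

text \<open>Appending a part \<open>r\<close> multiplies the norm of p_lambda by k r (m_r + 1),
  where m_r is its multiplicity in lambda. Differentiation supplies the factor m_r + 1, so k r is
  what remains.\<close>

lemma jack_inner_psum_mult:
  assumes "r > 0"
  shows "jack_inner (psum r * f) g = kk * of_nat r * jack_inner f (psum_deriv r g)"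
proof (induction f rule: pprod_induct)
  case (pprod xs)
  note x = this
  show ?case
  proof (induction g rule: pprod_induct)
    case (pprod ys)
    have L: "jack_inner (psum r * pprod xs) (pprod ys)
        = (if mset (r # xs) = mset ys then kk ^ length (r # xs) * of_nat (zee (r # xs)) else 0)"
      using jack_inner_pprod_mset[of "r # xs" ys] x pprod assms by (simp add: pprod_Cons)
    have "jack_inner (pprod xs) (psum_deriv r (pprod ys))
        = of_nat (count_list ys r) * jack_inner (pprod (remove1 r ys)) (pprod xs)"
      using pprod by (subst jack_inner_commute)
         (simp add: psum_deriv_pprod jack_inner_scale_left flip: scale_conv_const const_of_nat)
    also have "\<dots> = of_nat (count_list ys r) * (if mset xs = mset (remove1 r ys) then kk ^ length xs * of_nat (zee xs) else 0)"
      using x pprod jack_inner_pprod_mset[of xs "remove1 r ys"] notin_set_remove1[of 0 ys r]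
      by (simp add: jack_inner_commute)
    finally have R: "jack_inner (pprod xs) (psum_deriv r (pprod ys)) = \<dots>" .
    show ?case
    proof (cases "r \<in> set ys")
      case True
      hence e: "mset (r # xs) = mset ys \<longleftrightarrow> mset xs = mset (remove1 r ys)"
        by (metis add_mset_remove_trivial insert_DiffM mset.simps(2) mset_remove1 set_mset_mset)
      show ?thesis
      proof (cases "mset (r # xs) = mset ys")
        case T: True
        hence "count_list ys r = count (add_mset r (mset xs)) r" by (metis count_mset mset.simps(2))
        hence "count_list ys r = count_list xs r + 1" by (simp add: count_mset)
        thus ?thesis unfolding L R using T e by (simp add: zee_Cons algebra_simps)
      qed (use e in \<open>simp add: L R\<close>)
    next
      case False
      hence "mset (r # xs) \<noteq> mset ys" by (metis list.set_intros(1) mset_eq_setD)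
      thus ?thesis using False by (simp add: L R count_list_0_iff)
    qed
  next
    case (add f g)
    thus ?case
      by (simp add: jack_inner_commute[of "psum r * pprod xs"] jack_inner_commute[of "pprod xs"]
          psum_deriv_add jack_inner_add_left distrib_left)
  next
    case (scale c f)
    thus ?case
      by (simp add: jack_inner_commute[of "psum r * pprod xs"] jack_inner_commute[of "pprod xs"]
          psum_deriv_scale jack_inner_scale_left mult.left_commute)
  qed
next
  case (add f g)
  thus ?case by (simp add: distrib_left jack_inner_add_left)
next
  case (scale c f)
  have "psum r * scale c f = scale c (psum r * f)" by (simp add: scale_conv_const mult_ac)
  thus ?case using scale by (simp add: jack_inner_scale_left mult_ac)
qed

text \<open>A derivation is determined by its values on generators, here j p_(r+j) on p_j;
  \<open>N\<close> only bounds the indices that occur.\<close>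

lemma shear_pprod:
  assumes "r > 0" "set xs \<subseteq> {1..N}"
  shows "shear r (pprod xs) = (\<Sum>j=1..N. of_nat j * psum (r + j) * psum_deriv j (pprod xs))"
  using assms(2)
proof (induction xs)
  case Nil
  have "psum_deriv j 1 = 0" for j using psum_deriv_pprod[of "[]" j] by (simp add: pprod_def)
  thus ?case using assms by (simp add: pprod_def shear_1)
next
  case (Cons s xs)
  hence s: "s \<in> {1..N}" "s > 0" by auto
  have "shear r (pprod (s # xs)) = psum s * shear r (pprod xs) + of_nat s * (psum (r + s) * pprod xs)"
    using s assms by (simp add: pprod_Cons shear_psum_mult)
  also have "\<dots> = (\<Sum>j=1..N. of_nat j * psum (r + j) * (psum s * psum_deriv j (pprod xs)))
      + (\<Sum>j=1..N. of_nat j * psum (r + j) * (if j = s then pprod xs else 0))"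
  proof -
    have "(\<Sum>j=1..N. of_nat j * psum (r + j) * (if j = s then pprod xs else (0 :: ratfun symfun)))
        = (\<Sum>j=1..N. if s = j then of_nat j * psum (r + j) * pprod xs else 0)"
      by (intro sum.cong) auto
    thus ?thesis using Cons s by (simp add: sum_distrib_left mult_ac)
  qed
  also have "\<dots> = (\<Sum>j=1..N. of_nat j * psum (r + j) * psum_deriv j (pprod (s # xs)))"
    using s by (simp add: pprod_Cons psum_deriv_psum_mult distrib_left sum.distrib)
  finally show ?case .
qed

text \<open>The operator written in the p_r: a join part p_(i+j) d_i d_j, a split part p_i p_j
  d_(i+j) and a diagonal part. The cut-off \<open>N\<close> makes the sums finite and is harmless on
  products whose parts are at most \<open>N\<close>.\<close>

definition lap_psum :: "nat \<Rightarrow> ratfun symfun \<Rightarrow> ratfun symfun" where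
  "lap_psum N f =
     half * K * (\<Sum>i=1..N. \<Sum>j=1..N. of_nat i * of_nat j * psum (i + j) * psum_deriv i (psum_deriv j f))
     + half * (\<Sum>i=1..N. \<Sum>j=1..N. (of_nat i + of_nat j) * psum i * psum j * psum_deriv (i + j) f)
     + half * (K - 1) * (\<Sum>i=1..N. of_nat i * (of_nat i - 1) * psum i * psum_deriv i f)"

lemma sum_delta_mult:
  fixes h :: "nat \<Rightarrow> 'a::comm_ring_1"
  assumes "r \<in> {1..N}"
  shows "(\<Sum>i=1..N. h i * (if i = r then c else 0)) = h r * c"
proof -
  have "(\<Sum>i=1..N. h i * (if i = r then c else 0)) = (\<Sum>i=1..N. if i = r then h i * c else 0)"
    by (intro sum.cong) auto
  thus ?thesis using assms by simp
qed

text \<open>The commutator with p_r has the same shape as in \<open>lap_psum_mult\<close>, the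
  derivation now being expressed through the d/dp_j.\<close>

lemma lap_psum_psum_mult:
  assumes r: "r \<in> {1..N}"
  shows "lap_psum N (psum r * f) = psum r * lap_psum N f
     + K * of_nat r * (\<Sum>j=1..N. of_nat j * psum (r + j) * psum_deriv j f)
     + half * of_nat r * (\<Sum>u=1..<r. psum u * psum (r - u) * f)
     + half * (K - 1) * of_nat r * (of_nat r - 1) * psum r * f"
proof -
  have r0: "r > 0" using r by simp
  let ?A = "\<lambda>f. \<Sum>i=1..N. \<Sum>j=1..N. of_nat i * of_nat j * psum (i + j) * psum_deriv i (psum_deriv j f)"
  let ?B = "\<lambda>f. \<Sum>i=1..N. \<Sum>j=1..N. (of_nat i + of_nat j) * psum i * psum j * psum_deriv (i + j) f"
  let ?C = "\<lambda>f. \<Sum>i=1..N. of_nat i * (of_nat i - 1) * psum i * psum_deriv i f"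
  let ?S = "\<Sum>j=1..N. of_nat j * psum (r + j) * psum_deriv j f"
  have dd: "psum_deriv i (psum_deriv j (psum r * f)) = psum r * psum_deriv i (psum_deriv j f)
      + psum_deriv j f * (if i = r then 1 else 0) + psum_deriv i f * (if j = r then 1 else 0)" for i j
  proof -
    have "psum_deriv t 0 = 0" for t using psum_deriv_scale[of t 0 0] by simp
    thus ?thesis by (simp add: psum_deriv_psum_mult[OF r0] psum_deriv_add)
  qed
  have "?A (psum r * f) = psum r * ?A f
      + (\<Sum>i=1..N. \<Sum>j=1..N. of_nat i * of_nat j * psum (i + j) * psum_deriv j f * (if i = r then 1 else 0))
      + (\<Sum>i=1..N. \<Sum>j=1..N. of_nat i * of_nat j * psum (i + j) * psum_deriv i f * (if j = r then 1 else 0))"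
    unfolding dd by (simp add: distrib_left sum.distrib sum_distrib_left mult_ac)
  also have "(\<Sum>i=1..N. \<Sum>j=1..N. of_nat i * of_nat j * psum (i + j) * psum_deriv j f * (if i = r then 1 else 0)) = of_nat r * ?S"
    by (subst sum.swap) (simp only: sum_delta_mult[OF r], simp only: sum_distrib_left mult_1_left mult_1_right mult_ac)
  also have "(\<Sum>i=1..N. \<Sum>j=1..N. of_nat i * of_nat j * psum (i + j) * psum_deriv i f * (if j = r then 1 else 0)) = of_nat r * ?S"
    by (simp only: sum_delta_mult[OF r], simp only: sum_distrib_left mult_1_left mult_1_right mult_ac add.commute[of r])
  finally have A: "?A (psum r * f) = psum r * ?A f + of_nat r * ?S + of_nat r * ?S" .
  have "?B (psum r * f) = psum r * ?B f
      + (\<Sum>i=1..N. \<Sum>j=1..N. if i + j = r then of_nat r * psum i * psum j * f else 0)"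
    unfolding psum_deriv_psum_mult[OF r0] sum_distrib_left sum.distrib[symmetric]
    by (intro sum.cong refl) (auto simp: distrib_left mult_ac simp flip: of_nat_add)
  also have "(\<Sum>i=1..N. \<Sum>j=1..N. if i + j = r then of_nat r * psum i * psum j * f else 0)
      = (\<Sum>i=1..<r. of_nat r * psum i * psum (r - i) * f)"
  proof (rule sum.mono_neutral_cong_right)
    show "\<forall>i\<in>{1..N} - {1..<r}. (\<Sum>j=1..N. if i + j = r then of_nat r * psum i * psum j * f else 0) = 0"
      by (auto intro!: sum.neutral)
    fix i assume i: "i \<in> {1..<r}"
    have "(\<Sum>j=1..N. if i + j = r then of_nat r * psum i * psum j * f else 0)
        = (\<Sum>j=1..N. if j = r - i then of_nat r * psum i * psum j * f else 0)"
      using i by (intro sum.cong refl if_cong) auto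
    thus "(\<Sum>j=1..N. if i + j = r then of_nat r * psum i * psum j * f else 0) = of_nat r * psum i * psum (r - i) * f"
      using i r by (auto simp: Suc_le_eq)
  qed (use r in auto)
  also have "\<dots> = of_nat r * (\<Sum>u=1..<r. psum u * psum (r - u) * f)"
    by (simp add: sum_distrib_left mult_ac)
  finally have B: "?B (psum r * f) = psum r * ?B f + of_nat r * (\<Sum>u=1..<r. psum u * psum (r - u) * f)" .
  have "?C (psum r * f) = psum r * ?C f + (\<Sum>i=1..N. of_nat i * (of_nat i - 1) * psum i * (if i = r then f else 0))"
    unfolding psum_deriv_psum_mult[OF r0] by (simp add: distrib_left sum.distrib sum_distrib_left mult_ac)
  hence C: "?C (psum r * f) = psum r * ?C f + of_nat r * (of_nat r - 1) * psum r * f"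
    unfolding sum_delta_mult[OF r] .
  \<comment> \<open>Either of the two derivatives in the join part may hit p_r. The two
    contributions agree, which cancels the factor 1/2.\<close>
  have h: "half * K * (of_nat r * ?S) + half * K * (of_nat r * ?S) = K * of_nat r * ?S"
    using half_add_half[of "K * (of_nat r * ?S)"] by (simp add: mult_ac)
  show ?thesis unfolding lap_psum_def A B C h[symmetric] by (simp add: distrib_left mult.assoc mult.left_commute)
qed

text \<open>Both operators annihilate 1 and have the same commutator with every p_r for 1 \<le> r
  \<le> N.\<close>

lemma lap_eq_lap_psum:
  assumes "set xs \<subseteq> {1..N}"
  shows "lap (pprod xs) = lap_psum N (pprod xs)"
  using assms
proof (induction xs)
  case Nil
  have d: "psum_deriv j 1 = 0" for j using psum_deriv_pprod[of "[]" j] by (simp add: pprod_def)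
  have "psum_deriv j 0 = 0" for j using psum_deriv_scale[of j 0 0] by simp
  thus ?case by (simp add: pprod_def lap_1 lap_psum_def d)
next
  case (Cons r xs)
  hence r: "r \<in> {1..N}" "r > 0" by auto
  have s: "(\<Sum>u=1..<r. psum u * (psum (r - u) * pprod xs)) = (\<Sum>u=1..<r. psum u * psum (r - u) * pprod xs :: ratfun symfun)"
    by (simp add: mult.assoc)
  have xs: "set xs \<subseteq> {1..N}" using Cons.prems by simp
  have IH: "lap (pprod xs) = lap_psum N (pprod xs)" using Cons.IH xs .
  show ?case
    unfolding pprod_Cons lap_psum_mult[OF r(2)] lap_psum_psum_mult[OF r(1)] s shear_pprod[OF r(2) xs] IH
    by (simp add: algebra_simps)
qed

section \<open>Self-adjointness of the operator\<close>

lemma jack_inner_add_right: "jack_inner f (g + h) = jack_inner f g + jack_inner f h"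
  by (simp add: jack_inner_commute[of f] jack_inner_add_left)

lemma jack_inner_const_left: "jack_inner (const c * f) g = c * jack_inner f g"
  by (simp add: jack_inner_scale_left flip: scale_conv_const)

lemma jack_inner_const_right: "jack_inner f (const c * g) = c * jack_inner f g"
  by (simp add: jack_inner_commute[of f] jack_inner_const_left)

lemma jack_inner_of_nat_left: "jack_inner (of_nat n * f) g = of_nat n * jack_inner f g"
  by (simp add: jack_inner_const_left flip: const_of_nat)

lemma jack_inner_0_left: "jack_inner 0 g = 0"
  using jack_inner_const_left[of 0 0 g] by simp

lemma jack_inner_sum_left: "jack_inner (sum f A) g = (\<Sum>x\<in>A. jack_inner (f x) g)"
  by (induction A rule: infinite_finite_induct) (simp_all add: jack_inner_0_left jack_inner_add_left)

text \<open>Up to a factor, the pairing of the join part of f with g; exchanging the arguments gives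
  the pairing of the split part of f with g.\<close>

definition lap_form :: "nat \<Rightarrow> ratfun symfun \<Rightarrow> ratfun symfun \<Rightarrow> ratfun" where
  "lap_form N f g = (\<Sum>i=1..N. \<Sum>j=1..N. of_nat i * of_nat j * (of_nat i + of_nat j)
     * jack_inner (psum_deriv i (psum_deriv j f)) (psum_deriv (i + j) g))"

text \<open>Moving one power sum across costs one factor k, moving two costs two. The additional k
  carried by the join part balances this, so the right-hand side is symmetric in \<open>f\<close>
  and \<open>g\<close>.\<close>

lemma jack_inner_lap_psum:
  "jack_inner (lap_psum N f) g = kk * kk / 2 * lap_form N f g + kk * kk / 2 * lap_form N g f
     + kk * (kk - 1) / 2 * (\<Sum>i=1..N. of_nat i * of_nat i * (of_nat i - 1) * jack_inner (psum_deriv i f) (psum_deriv i g))"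
proof -
  have 1: "jack_inner (of_nat i * of_nat j * psum (i + j) * h) g
      = kk * (of_nat i * of_nat j * (of_nat i + of_nat j) * jack_inner h (psum_deriv (i + j) g))" if "i \<in> {1..N}" for i j h
  proof -
    have "i + j > 0" using that by simp
    thus ?thesis by (simp only: mult.assoc jack_inner_of_nat_left jack_inner_psum_mult of_nat_add mult.left_commute[of _ kk])
  qed
  have 2: "jack_inner ((of_nat i + of_nat j) * psum i * psum j * h) g
      = kk * kk * (of_nat j * of_nat i * (of_nat j + of_nat i) * jack_inner (psum_deriv j (psum_deriv i g)) h)"
    if "i \<in> {1..N}" "j \<in> {1..N}" for i j h
  proof -
    have "i > 0" "j > 0" using that by auto
    hence "jack_inner (of_nat (i + j) * (psum i * (psum j * h))) g
      = of_nat (i + j) * (kk * of_nat i * (kk * of_nat j * jack_inner h (psum_deriv j (psum_deriv i g))))"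
      by (simp only: jack_inner_of_nat_left jack_inner_psum_mult)
    thus ?thesis by (simp add: mult_ac add.commute jack_inner_commute[of h])
  qed
  have 3: "jack_inner (of_nat i * (of_nat i - 1) * psum i * h) g
      = kk * (of_nat i * of_nat i * (of_nat i - 1) * jack_inner h (psum_deriv i g))" if "i \<in> {1..N}" for i h
  proof -
    have "i > 0" using that by simp
    hence "jack_inner (of_nat (i * (i - 1)) * (psum i * h)) g = of_nat (i * (i - 1)) * (kk * of_nat i * jack_inner h (psum_deriv i g))"
      by (simp only: jack_inner_of_nat_left jack_inner_psum_mult)
    thus ?thesis using \<open>i > 0\<close> by (simp add: of_nat_diff mult_ac)
  qed
  have 4: "jack_inner (half * (K - 1) * h) g = (kk - 1) / 2 * jack_inner h g" for h
  proof -
    have "half * (K - 1) = const ((kk - 1) / 2)" using const_mult[of "1 / 2" "kk - 1"] by (simp add: const_diff const_1)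
    thus ?thesis by (simp only: jack_inner_const_left)
  qed
  have 5: "jack_inner (half * K * h) g = kk / 2 * jack_inner h g" for h
    by (simp add: mult.assoc jack_inner_const_left)
  have A: "(\<Sum>i=1..N. \<Sum>j=1..N. jack_inner (of_nat i * of_nat j * psum (i + j) * psum_deriv i (psum_deriv j f)) g)
    = kk * lap_form N f g"
    unfolding lap_form_def sum_distrib_left by (intro sum.cong refl 1)
  have "(\<Sum>i=1..N. \<Sum>j=1..N. jack_inner ((of_nat i + of_nat j) * psum i * psum j * psum_deriv (i + j) f) g)
    = (\<Sum>i=1..N. \<Sum>j=1..N. kk * kk * (of_nat j * of_nat i * (of_nat j + of_nat i)
        * jack_inner (psum_deriv j (psum_deriv i g)) (psum_deriv (i + j) f)))"
    by (intro sum.cong refl 2)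
  moreover have "lap_form N g f = (\<Sum>i=1..N. \<Sum>j=1..N. of_nat j * of_nat i * (of_nat j + of_nat i)
        * jack_inner (psum_deriv j (psum_deriv i g)) (psum_deriv (i + j) f))"
    unfolding lap_form_def by (subst sum.swap) (simp add: add.commute)
  ultimately have B: "(\<Sum>i=1..N. \<Sum>j=1..N. jack_inner ((of_nat i + of_nat j) * psum i * psum j * psum_deriv (i + j) f) g)
    = kk * kk * lap_form N g f"
    by (simp only: sum_distrib_left)
  have C: "(\<Sum>i=1..N. jack_inner (of_nat i * (of_nat i - 1) * psum i * psum_deriv i f) g)
    = kk * (\<Sum>i=1..N. of_nat i * of_nat i * (of_nat i - 1) * jack_inner (psum_deriv i f) (psum_deriv i g))"
    unfolding sum_distrib_left by (intro sum.cong refl 3)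
  show ?thesis
    unfolding lap_psum_def jack_inner_add_left 4 5 jack_inner_const_left jack_inner_sum_left A B C
    by (simp add: mult_ac)
qed

lemma jack_inner_lap: "jack_inner (lap f) g = jack_inner f (lap g)"
proof (induction f rule: pprod_induct)
  case (pprod xs)
  note x = this
  show ?case
  proof (induction g rule: pprod_induct)
    case (pprod ys)
    \<comment> \<open>A common cut-off for both lists, so that one symmetric formula applies to both
      sides.\<close>
    define N where "N = Max (insert 0 (set xs \<union> set ys))"
    have "z \<in> {1..N}" if "z \<in> set xs \<union> set ys" for z
    proof -
      have "z \<noteq> 0" using that x pprod by (metis Un_iff)
      moreover have "z \<le> N" unfolding N_def using that by (intro Max_ge) auto
      ultimately show ?thesis by auto
    qed
    hence N: "set xs \<subseteq> {1..N}" "set ys \<subseteq> {1..N}" by blast+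
    have "jack_inner (lap_psum N (pprod xs)) (pprod ys) = jack_inner (lap_psum N (pprod ys)) (pprod xs)"
      unfolding jack_inner_lap_psum
      by (simp add: jack_inner_commute[of "psum_deriv _ (pprod xs)"])
    thus ?case
      by (simp add: lap_eq_lap_psum[OF N(1)] lap_eq_lap_psum[OF N(2)] jack_inner_commute[of "pprod xs"])
  next
    case (add f g)
    thus ?case by (simp add: lap_add jack_inner_add_right)
  next
    case (scale c f)
    thus ?case unfolding lap_scale by (simp add: scale_conv_const jack_inner_const_right)
  qed
next
  case (add f g)
  thus ?case by (simp add: lap_add jack_inner_add_left)
next
  case (scale c f)
  thus ?case unfolding lap_scale by (simp add: scale_conv_const jack_inner_const_left)
qed

section \<open>Splitting off one variable\<close>

lift_definition cons_mon :: "nat \<Rightarrow> monomial \<Rightarrow> monomial" is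
  "\<lambda>c f i. case i of 0 \<Rightarrow> c | Suc i \<Rightarrow> f i"
proof -
  fix c and f :: "nat \<Rightarrow> nat" assume "finite {i. f i \<noteq> 0}"
  moreover have "{i. (case i of 0 \<Rightarrow> c | Suc i \<Rightarrow> f i) \<noteq> 0} \<subseteq> insert 0 (Suc ` {i. f i \<noteq> 0})"
  proof
    show "i \<in> insert 0 (Suc ` {i. f i \<noteq> 0})" if "i \<in> {i. (case i of 0 \<Rightarrow> c | Suc i \<Rightarrow> f i) \<noteq> 0}" for i
      using that by (cases i) auto
  qed
  ultimately show "finite {i. (case i of 0 \<Rightarrow> c | Suc i \<Rightarrow> f i) \<noteq> 0}"
    by (meson finite_imageI finite_insert finite_subset)
qed

lemma lookup_cons_mon_0 [simp]: "lookup (cons_mon c m) 0 = c"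
  and lookup_cons_mon_Suc [simp]: "lookup (cons_mon c m) (Suc i) = lookup m i"
  by (simp_all add: cons_mon.rep_eq)

lemma lookup_cons_mon: "lookup (cons_mon c m) i = (case i of 0 \<Rightarrow> c | Suc i \<Rightarrow> lookup m i)"
  by (simp add: cons_mon.rep_eq)

lemma keys_cons_mon: "keys (cons_mon c m) \<subseteq> insert 0 (Suc ` keys m)"
proof
  show "i \<in> insert 0 (Suc ` keys m)" if "i \<in> keys (cons_mon c m)" for i
    using that by (cases i) (auto simp: in_keys_iff)
qed

lemma sum_cons_mon:
  "finite J \<Longrightarrow> (\<Sum>i\<in>insert 0 (Suc ` J). h i) = h 0 + (\<Sum>j\<in>J. h (Suc j))"
  for h :: "nat \<Rightarrow> 'a::comm_monoid_add"
  by (simp add: sum.reindex)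

lemma mdeg_cons_mon: "mdeg (cons_mon c m) = c + mdeg m"
  using mdeg_superset[OF _ keys_cons_mon[of c m]] mdeg_superset[of "keys m" m]
  by (simp add: sum_cons_mon del: sum.insert)

lemma update_cons_mon_0: "update (cons_mon c m) 0 x = cons_mon x m"
  and update_cons_mon_Suc: "update (cons_mon c m) (Suc j) x = cons_mon c (update m j x)"
  by (intro poly_mapping_eqI; simp add: lookup_update lookup_cons_mon split: nat.splits)+

lemma exps_cons_mon_0: "exps (cons_mon 0 m) = exps m"
proof -
  have "keys (cons_mon 0 m) = Suc ` keys m"
  proof (rule set_eqI)
    show "i \<in> keys (cons_mon 0 m) \<longleftrightarrow> i \<in> Suc ` keys m" for i
      by (cases i) (auto simp: in_keys_iff)
  qed
  thus ?thesis
    by (simp add: exps_def image_mset_mset_set[symmetric] multiset.map_comp comp_def)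
qed

lemma exps_cons_mon: "c > 0 \<Longrightarrow> exps (cons_mon c m) = add_mset c (exps m)"
proof -
  assume "c > 0"
  have "cons_mon c m = Poly_Mapping.single 0 c + cons_mon 0 m"
    by (intro poly_mapping_eqI) (auto simp: lookup_add lookup_single lookup_cons_mon split: nat.splits)
  moreover have "0 \<notin> keys (cons_mon 0 m)" by (simp add: in_keys_iff)
  ultimately show ?thesis using \<open>c > 0\<close> by (simp add: exps_single_add exps_cons_mon_0)
qed

text \<open>
  For a function in the variables $y, x_0, x_1, \ldots$, this is the coefficient of $y^c$ as a
  symmetric function in the $x_i$.
\<close>

definition var_coeff :: "nat \<Rightarrow> 'a::zero symfun \<Rightarrow> 'a symfun" where
  "var_coeff c f = Abs_symfun (\<lambda>m. mcoeff f (cons_mon c m))"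

lemma mcoeff_var_coeff: "mcoeff (var_coeff c f) m = mcoeff f (cons_mon c m)"
proof -
  obtain d where d: "\<And>m. mcoeff f m \<noteq> 0 \<Longrightarrow> mdeg m \<le> d" using mcoeff[of f] by blast
  have "mdeg m \<le> d" if "mcoeff f (cons_mon c m) \<noteq> 0" for m
    using d[OF that] by (simp add: mdeg_cons_mon)
  moreover have "mcoeff f (cons_mon c (Poly_Mapping.map_key \<pi> m)) = mcoeff f (cons_mon c m)" if b: "bij \<pi>" for \<pi> m
  proof -
    let ?p = "\<lambda>\<pi> i. case i of 0 \<Rightarrow> 0 | Suc i \<Rightarrow> Suc (\<pi> i)"
    have "bij (?p \<pi>)"
      by (rule o_bij[of "?p (inv \<pi>)"])
         (use b in \<open>auto simp: fun_eq_iff bij_is_inj bij_is_surj surj_f_inv_f split: nat.splits\<close>)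
    moreover from this have "cons_mon c (Poly_Mapping.map_key \<pi> m) = Poly_Mapping.map_key (?p \<pi>) (cons_mon c m)"
      using b by (intro poly_mapping_eqI) (auto simp: lookup_map_key bij_is_inj lookup_cons_mon split: nat.splits)
    ultimately show ?thesis using mcoeff_map_key by metis
  qed
  ultimately show ?thesis unfolding var_coeff_def by (subst Abs_symfun_inverse) auto
qed

lemma var_coeff_0 [simp]: "var_coeff 0 f = f"
  by (rule symfun_eqI) (simp add: mcoeff_var_coeff mcoeff_cong_exps[OF exps_cons_mon_0])

lemma var_coeff_add: "var_coeff c (f + g) = var_coeff c f + var_coeff c g"
  by (rule symfun_eqI) (simp add: mcoeff_var_coeff plus_symfun.rep_eq)

lemma var_coeff_diff: "var_coeff c (f - g) = var_coeff c f - var_coeff c g"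
  by (rule symfun_eqI) (simp add: mcoeff_var_coeff minus_symfun.rep_eq)

lemma var_coeff_scale: "var_coeff c (scale a f) = scale a (var_coeff c f)"
  by (rule symfun_eqI) (simp add: mcoeff_var_coeff scale.rep_eq)

lemma var_coeff_zero [simp]: "var_coeff c 0 = 0"
  by (rule symfun_eqI) (simp add: mcoeff_var_coeff zero_symfun.rep_eq)

lemma var_coeff_sum: "var_coeff c (sum f A) = (\<Sum>x\<in>A. var_coeff c (f x))"
  by (induction A rule: infinite_finite_induct) (simp_all add: var_coeff_add)

lemma var_mult_cons_mon_Suc: "var_mult r (Suc j) f (cons_mon c m) = var_mult r j (\<lambda>m. f (cons_mon c m)) m"
  by (simp add: var_mult_def update_cons_mon_Suc)

lemma mcoeff_var_coeff_abs: "(\<lambda>m. mcoeff f (cons_mon c m)) = mcoeff (var_coeff c f)"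
  by (simp add: fun_eq_iff mcoeff_var_coeff)

text \<open>This is p_r(y,x) = y^r + p_r(x), read off at y^c.\<close>

lemma var_coeff_psum_mult:
  assumes "r > 0"
  shows "var_coeff c (psum r * f) = psum r * var_coeff c f + (if r \<le> c then var_coeff (c - r) f else 0)"
proof (rule symfun_eqI)
  fix m
  have "mcoeff (var_coeff c (psum r * f)) m
      = (\<Sum>l\<in>insert 0 (Suc ` keys m). var_mult r l (mcoeff f) (cons_mon c m))"
    unfolding mcoeff_var_coeff using assms keys_cons_mon by (intro mcoeff_psum_mult) auto
  also have "\<dots> = var_mult r 0 (mcoeff f) (cons_mon c m) + (\<Sum>l\<in>keys m. var_mult r l (mcoeff (var_coeff c f)) m)"
    by (simp only: sum_cons_mon finite_keys var_mult_cons_mon_Suc mcoeff_var_coeff_abs)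
  also have "(\<Sum>l\<in>keys m. var_mult r l (mcoeff (var_coeff c f)) m) = mcoeff (psum r * var_coeff c f) m"
    using assms by (simp add: mcoeff_psum_mult[of r "keys m"])
  also have "var_mult r 0 (mcoeff f) (cons_mon c m) = mcoeff (if r \<le> c then var_coeff (c - r) f else 0) m"
    by (simp add: var_mult_def update_cons_mon_0 mcoeff_var_coeff zero_symfun.rep_eq)
  finally show "mcoeff (var_coeff c (psum r * f)) m
      = mcoeff (psum r * var_coeff c f + (if r \<le> c then var_coeff (c - r) f else 0)) m"
    by (simp add: plus_symfun.rep_eq)
qed

lemma var_coeff_1: "c > 0 \<Longrightarrow> var_coeff c 1 = 0"
proof (rule symfun_eqI)
  fix m assume "c > 0"
  hence "cons_mon c m \<noteq> 0" by (metis lookup_cons_mon_0 lookup_zero less_irrefl)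
  thus "mcoeff (var_coeff c 1) m = mcoeff 0 m" by (simp add: mcoeff_var_coeff one_symfun.rep_eq zero_symfun.rep_eq)
qed

text \<open>In a product of factors p_j(y,x) = y^j + p_j(x), the first power of y can only come from
  a single factor p_1. This is what connects the adjoint of p_1 with monomials.\<close>

lemma psum_deriv_1_eq: "psum_deriv 1 f = var_coeff 1 f"
proof (induction f rule: pprod_induct)
  case (pprod xs)
  thus ?case
  proof (induction xs)
    case Nil
    thus ?case using psum_deriv_pprod[of "[]" 1] by (simp add: pprod_def var_coeff_1)
  next
    case (Cons r xs)
    hence "r > 0" "psum_deriv 1 (pprod xs) = var_coeff 1 (pprod xs)" by auto
    thus ?case unfolding pprod_Cons psum_deriv_psum_mult[OF \<open>r > 0\<close>] var_coeff_psum_mult[OF \<open>r > 0\<close>]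
      using \<open>r > 0\<close> by (auto simp: le_Suc_eq)
  qed
qed (simp_all add: psum_deriv_add var_coeff_add psum_deriv_scale var_coeff_scale)

definition homogeneous :: "nat \<Rightarrow> 'a::zero symfun \<Rightarrow> bool" where
  "homogeneous d f \<longleftrightarrow> (\<forall>m. mcoeff f m \<noteq> 0 \<longrightarrow> mdeg m = d)"

lemma var_pair_cons_mon_Suc:
  "var_pair (Suc i) (Suc j) f (cons_mon c m) = var_pair i j (\<lambda>m. f (cons_mon c m)) m"
  by (simp add: var_pair_def update_cons_mon_Suc)

text \<open>Since no power of y above c + 1 occurs, only the term t = b - 1 of the expansion
  survives, where b is the exponent of x_j. Its weight c + b - 2(b - 1) is rewritten to expose the
  weight b - 1 of the derivation \<open>shear 1\<close>.\<close>

lemma var_pair_cons_mon_0: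
  assumes "\<And>s. s \<ge> 2 \<Longrightarrow> var_coeff (c + s) f = 0"
  shows "var_pair 0 (Suc j) (mcoeff f) (cons_mon c m)
      = (of_nat (c + 1) - (of_nat (lookup m j) - 1)) * var_mult 1 j (mcoeff (var_coeff (c + 1) f)) m
        - of_nat (lookup m j) * mcoeff (var_coeff c f) m"
proof -
  let ?b = "lookup m j"
  let ?g = "\<lambda>t. (of_nat (c + ?b) - 2 * of_nat t) * mcoeff (var_coeff (c + ?b - t) f) (update m j t)"
  have "(\<Sum>t<?b. ?g t) = (of_nat (c + 1) - (of_nat ?b - 1)) * var_mult 1 j (mcoeff (var_coeff (c + 1) f)) m"
  proof (cases "?b = 0")
    case False
    have "?g t = 0" if "t < ?b - 1" for t
    proof -
      have "c + ?b - t = c + (?b - t)" "?b - t \<ge> 2" using that by auto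
      thus ?thesis using assms[of "?b - t"] by (simp add: zero_symfun.rep_eq)
    qed
    hence "(\<Sum>t<?b - 1. ?g t) = 0" by (intro sum.neutral) auto
    moreover have "{..<?b} = insert (?b - 1) {..<?b - 1}" using False by auto
    ultimately have "(\<Sum>t<?b. ?g t) = ?g (?b - 1)" by simp
    moreover have "c + ?b - (?b - 1) = c + 1" using False by simp
    ultimately show ?thesis using False by (simp add: var_mult_def of_nat_diff algebra_simps)
  qed (simp add: var_mult_def)
  thus ?thesis
    by (simp add: var_pair_def pair_op_def update_cons_mon_0 update_cons_mon_Suc flip: mcoeff_var_coeff)
qed

text \<open>The pairs containing y contribute -d, as the exponents of a monomial of degree d add up
  to d, and couple the coefficient of y^c to that of y^(c+1) through p_1 and \<open>shear 1\<close>.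
  The pairs not containing y form the operator in the remaining variables.\<close>

lemma var_coeff_lap:
  assumes top: "\<And>s. s \<ge> 2 \<Longrightarrow> var_coeff (c + s) f = 0" and hom: "homogeneous d (var_coeff c f)"
  shows "var_coeff c (lap f) = lap (var_coeff c f)
      + const (kk * (of_nat c * (of_nat c - 1) / 2) - of_nat d) * var_coeff c f
      + of_nat (c + 1) * (psum 1 * var_coeff (c + 1) f) - shear 1 (var_coeff (c + 1) f)"
proof (rule symfun_eqI)
  fix m
  let ?J = "keys m" and ?F = "mcoeff f" and ?m = "cons_mon c m"
  let ?I = "insert 0 (Suc ` ?J)"
  let ?f0 = "var_coeff c f" and ?f1 = "var_coeff (c + 1) f"
  let ?w = "\<lambda>n. kk * (of_nat n * (of_nat n - 1) / 2) :: ratfun"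
  let ?S = "\<Sum>j\<in>?J. var_pair 0 (Suc j) ?F ?m"
  have d0: "?I - {0} = Suc ` ?J" by auto
  have dS: "?I - {Suc i} = insert 0 (Suc ` (?J - {i}))" for i by auto
  have "(\<Sum>i\<in>?I. \<Sum>j\<in>?I - {i}. var_pair i j ?F ?m)
      = (\<Sum>j\<in>Suc ` ?J. var_pair 0 j ?F ?m) + (\<Sum>i\<in>?J. \<Sum>j\<in>insert 0 (Suc ` (?J - {i})). var_pair (Suc i) j ?F ?m)"
    by (simp only: sum_cons_mon finite_keys d0 dS)
  also have "(\<Sum>i\<in>?J. \<Sum>j\<in>insert 0 (Suc ` (?J - {i})). var_pair (Suc i) j ?F ?m)
      = (\<Sum>i\<in>?J. var_pair (Suc i) 0 ?F ?m) + (\<Sum>i\<in>?J. \<Sum>j\<in>?J - {i}. var_pair i j (mcoeff ?f0) m)"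
    by (simp only: sum_cons_mon finite_keys finite_Diff sum.distrib var_pair_cons_mon_Suc mcoeff_var_coeff_abs)
  also have "(\<Sum>i\<in>?J. var_pair (Suc i) 0 ?F ?m) = ?S"
    by (intro sum.cong refl var_pair_commute) simp
  also have "(\<Sum>j\<in>Suc ` ?J. var_pair 0 j ?F ?m) = ?S" by (simp add: sum.reindex)
  finally have pairs: "(\<Sum>i\<in>?I. \<Sum>j\<in>?I - {i}. var_pair i j ?F ?m)
      = ?S + (?S + (\<Sum>i\<in>?J. \<Sum>j\<in>?J - {i}. var_pair i j (mcoeff ?f0) m))" .
  have diag: "(\<Sum>i\<in>?I. ?w (lookup ?m i)) = ?w c + (\<Sum>i\<in>?J. ?w (lookup m i))"
    by (simp only: sum_cons_mon finite_keys lookup_cons_mon_0 lookup_cons_mon_Suc)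
  have vp: "var_pair 0 (Suc j) ?F ?m
      = (of_nat (c + 1) - (of_nat (lookup m j) - 1)) * var_mult 1 j (mcoeff ?f1) m - of_nat (lookup m j) * mcoeff ?f0 m" for j
    by (rule var_pair_cons_mon_0) (rule top)
  have "?S = of_nat (c + 1) * (\<Sum>j\<in>?J. var_mult 1 j (mcoeff ?f1) m)
      - (\<Sum>j\<in>?J. (of_nat (lookup m j) - of_nat 1) * var_mult 1 j (mcoeff ?f1) m)
      - (\<Sum>j\<in>?J. of_nat (lookup m j)) * mcoeff ?f0 m"
    unfolding vp sum_distrib_left sum_distrib_right sum_subtractf[symmetric]
    by (intro sum.cong refl) (simp add: algebra_simps)
  also have "(\<Sum>j\<in>?J. of_nat (lookup m j)) * mcoeff ?f0 m = of_nat d * mcoeff ?f0 m"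
  proof (cases "mcoeff ?f0 m = 0")
    case False
    hence "mdeg m = d" using hom by (simp add: homogeneous_def)
    thus ?thesis by (simp add: mdeg_def flip: of_nat_sum)
  qed simp
  also have "(\<Sum>j\<in>?J. var_mult 1 j (mcoeff ?f1) m) = mcoeff (psum 1 * ?f1) m"
    by (rule mcoeff_psum_mult[symmetric]) auto
  also have "(\<Sum>j\<in>?J. (of_nat (lookup m j) - of_nat 1) * var_mult 1 j (mcoeff ?f1) m) = mcoeff (shear 1 ?f1) m"
    by (rule mcoeff_shear[symmetric]) auto
  finally have S: "?S = of_nat (c + 1) * mcoeff (psum 1 * ?f1) m - mcoeff (shear 1 ?f1) m - of_nat d * mcoeff ?f0 m" .
  have "mcoeff (var_coeff c (lap f)) m = (\<Sum>i\<in>?I. ?w (lookup ?m i)) * ?F ?m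
      + (\<Sum>i\<in>?I. \<Sum>j\<in>?I - {i}. var_pair i j ?F ?m) / 2"
    unfolding mcoeff_var_coeff using keys_cons_mon by (intro mcoeff_lap) auto
  also have "\<dots> = mcoeff (lap ?f0) m + ?w c * mcoeff ?f0 m + ?S"
    unfolding diag pairs mcoeff_lap[OF finite_keys subset_refl]
    by (simp add: mcoeff_var_coeff field_simps)
  also have "\<dots> = mcoeff (lap ?f0 + const (?w c - of_nat d) * ?f0 + of_nat (c + 1) * (psum 1 * ?f1) - shear 1 ?f1) m"
    unfolding S plus_symfun.rep_eq minus_symfun.rep_eq mcoeff_const_mult mcoeff_of_nat_mult
    by (simp add: left_diff_distrib)
  finally show "mcoeff (var_coeff c (lap f)) m = \<dots>" .
qed

section \<open>Dominance order and triangularity\<close>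

primrec mon :: "nat list \<Rightarrow> monomial" where
  "mon [] = 0"
| "mon (x # xs) = cons_mon x (mon xs)"

lemma exps_mon: "0 \<notin> set xs \<Longrightarrow> exps (mon xs) = mset xs"
  by (induction xs) (auto simp: exps_cons_mon, simp add: exps_def)

lemma sum_mon: "(\<Sum>i<n. lookup (mon xs) i) = sum_list (take n xs)"
proof (induction xs arbitrary: n)
  case (Cons x xs)
  show ?case
  proof (cases n)
    case (Suc k)
    have "(\<Sum>i<Suc k. lookup (mon (x # xs)) i) = x + (\<Sum>i<k. lookup (mon xs) i)"
      by (subst sum.lessThan_Suc_shift) simp
    thus ?thesis using Suc Cons by simp
  qed simp
qed simp

lemma mdeg_mon: "mdeg (mon xs) = sum_list xs"
  by (induction xs) (simp_all add: mdeg_cons_mon, simp add: mdeg_def)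

text \<open>Remove the head \<open>x\<close> from \<open>M\<close> if it occurs there, and any
  element otherwise. The removed element is at most \<open>x\<close>, and the rest lies in the
  tail.\<close>

lemma sum_mset_le_sum_take:
  fixes M :: "nat multiset"
  assumes "M \<subseteq># mset xs" "sorted_wrt (\<ge>) xs" "size M \<le> n"
  shows "\<Sum>\<^sub># M \<le> sum_list (take n xs)"
  using assms
proof (induction xs arbitrary: M n)
  case (Cons x xs)
  show ?case
  proof (cases "M = {#}")
    case False
    then obtain k where n: "n = Suc k" using Cons.prems(3) by (cases n) auto
    obtain y where y: "y \<in># M" "M - {#y#} \<subseteq># mset xs" "y \<le> x"
    proof (cases "x \<in># M")
      case True
      thus ?thesis using that[of x] Cons.prems(1) by (simp add: subset_eq_diff_conv)
    next
      case x: False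
      obtain y where y: "y \<in># M" using False by blast
      have "M \<subseteq># mset xs" 
      proof (rule mset_subset_eqI)
        show "count M a \<le> count (mset xs) a" for a
          using mset_subset_eq_count[OF Cons.prems(1), of a] x by (cases "a = x") (auto simp: not_in_iff)
      qed
      moreover from this have "y \<in># mset xs" using y by (meson mset_subset_eqD)
      ultimately show ?thesis using that[of y] y Cons.prems(2)
        by (auto intro: subset_mset.order_trans[OF diff_subset_eq_self])
    qed
    have "\<Sum>\<^sub># (M - {#y#}) \<le> sum_list (take k xs)"
      using y Cons.prems n by (intro Cons.IH) (auto simp: size_Diff_singleton)
    moreover have "\<Sum>\<^sub># M = y + \<Sum>\<^sub># (M - {#y#})" 

    proof -
      have "\<Sum>\<^sub># (add_mset y N) = y + \<Sum>\<^sub># N" for N by simp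
      from this[of "M - {#y#}"] show ?thesis using y(1) by (simp only: insert_DiffM)
    qed
    ultimately show ?thesis using y(3) n by simp
  qed simp
qed simp

text \<open>Dominance for monomials with unsorted exponents: quantifying over all finite sets of
  variables replaces the sorting, because the largest exponents give the strongest
  condition.\<close>

definition below :: "nat list \<Rightarrow> monomial \<Rightarrow> bool" where
  "below lam m \<longleftrightarrow> mdeg m = sum_list lam \<and>
     (\<forall>A. finite A \<longrightarrow> (\<Sum>i\<in>A. lookup m i) \<le> sum_list (take (card A) lam))"

lemma sum_lookup_le_sum_take:
  assumes "exps m = mset mu" "sorted_wrt (\<ge>) mu" "finite A"
  shows "(\<Sum>i\<in>A. lookup m i) \<le> sum_list (take (card A) mu)"
proof -
  let ?M = "image_mset (lookup m) (mset_set (A \<inter> keys m))"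
  have "(\<Sum>i\<in>A. lookup m i) = (\<Sum>i\<in>A \<inter> keys m. lookup m i)"
    using assms(3) by (intro sum.mono_neutral_right) (auto simp: in_keys_iff)
  also have "\<dots> = \<Sum>\<^sub># ?M" by (simp add: sum_unfold_sum_mset)
  also have "\<dots> \<le> sum_list (take (card A) mu)"
  proof (rule sum_mset_le_sum_take[OF _ assms(2)])
    show "?M \<subseteq># mset mu" unfolding assms(1)[symmetric] exps_def
      by (intro image_mset_subseteq_mono subset_imp_msubset_mset_set) auto
    show "size ?M \<le> card A" using assms(3) by (simp add: card_mono)
  qed
  finally show ?thesis .
qed

lemma below_if_dominates:
  assumes "dominates lam mu" "exps m = mset mu" "mu \<in> partitions"
  shows "below lam m"
  unfolding below_def
proof (intro conjI allI impI)
  show "mdeg m = sum_list lam"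
    using assms by (simp add: mdeg_exps dominates_def sum_mset_sum_list)
  fix A :: "nat set" assume "finite A"
  hence "(\<Sum>i\<in>A. lookup m i) \<le> sum_list (take (card A) mu)"
    using assms by (intro sum_lookup_le_sum_take) (auto simp: partitions_def)
  also have "\<dots> \<le> sum_list (take (card A) lam)" using assms(1) by (simp add: dominates_def)
  finally show "(\<Sum>i\<in>A. lookup m i) \<le> sum_list (take (card A) lam)" .
qed

lemma dominates_if_below_mon: "below lam (mon mu) \<Longrightarrow> dominates lam mu"
  unfolding below_def dominates_def
  by (metis card_lessThan finite_lessThan mdeg_mon sum_mon)

lemma ex_exps_partition: "\<exists>mu\<in>partitions. exps m = mset mu"
  using ex_partition[OF exps_nonzero] by metis

lemma exps_mon_partition: "mu \<in> partitions \<Longrightarrow> exps (mon mu) = mset mu"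
  by (simp add: exps_mon partitions_def)

lemma mcoeff_eq_mon:
  assumes "exps m = mset mu" "mu \<in> partitions"
  shows "mcoeff f m = mcoeff f (mon mu)"
  using assms by (intro mcoeff_cong_exps) (simp add: exps_mon_partition)

definition triangular :: "nat list \<Rightarrow> 'a::zero symfun \<Rightarrow> bool" where
  "triangular lam f \<longleftrightarrow> (\<forall>m. mcoeff f m \<noteq> 0 \<longrightarrow> below lam m)"

lemma triangularI:
  assumes "\<And>mu. mu \<in> partitions \<Longrightarrow> mcoeff f (mon mu) \<noteq> 0 \<Longrightarrow> dominates lam mu"
  shows "triangular lam f"
  unfolding triangular_def
proof (intro allI impI)
  fix m assume m: "mcoeff f m \<noteq> 0"
  obtain mu where mu: "mu \<in> partitions" "exps m = mset mu" using ex_exps_partition by blast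
  hence "dominates lam mu" using assms m mcoeff_eq_mon[OF mu(2,1), of f] by simp
  thus "below lam m" using mu below_if_dominates by blast
qed

lemma triangularD:
  "triangular lam f \<Longrightarrow> mcoeff f (mon mu) \<noteq> 0 \<Longrightarrow> dominates lam mu"
  unfolding triangular_def using dominates_if_below_mon by blast

lemma triangular_homogeneous: "triangular lam f \<Longrightarrow> homogeneous (sum_list lam) f"
  by (auto simp: triangular_def homogeneous_def below_def)

lemma sum_update:
  assumes "finite A"
  shows "(\<Sum>l\<in>A. lookup (update m i x) l) + (if i \<in> A then lookup m i else 0)
       = (\<Sum>l\<in>A. lookup m l) + (if i \<in> A then x else 0)"
proof (cases "i \<in> A")
  case True
  have "(\<Sum>l\<in>A. lookup (update m i x) l) = x + (\<Sum>l\<in>A - {i}. lookup m l)"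
    using assms True by (subst sum.remove[of _ i]) (auto simp: lookup_update intro!: sum.cong)
  thus ?thesis using assms True by (simp add: sum.remove[of A i "lookup m"])
next
  case False
  have "(\<Sum>l\<in>A. lookup (update m i x) l) = (\<Sum>l\<in>A. lookup m l)"
    using False by (intro sum.cong) (auto simp: lookup_update)
  thus ?thesis using False by simp
qed

text \<open>Moving weight from position j to an earlier i can only increase prefix sums. As
  \<open>mu\<close> is sorted, its prefix sums alone decide dominance.\<close>

lemma below_raise:
  assumes mu: "mu \<in> partitions" and ij: "i < j" and xy: "x + y = lookup (mon mu) i + lookup (mon mu) j"
    and x: "lookup (mon mu) i \<le> x" and below: "below lam (update (update (mon mu) i x) j y)"
  shows "below lam (mon mu)"
proof -
  let ?m = "mon mu"
  let ?m' = "update (update ?m i x) j y"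
  have deg: "mdeg ?m' = mdeg ?m" using ij xy by (intro mdeg_update2) auto
  have "sum_list (take n mu) \<le> sum_list (take n lam)" for n
  proof -
    have "sum_list (take n mu) = (\<Sum>l<n. lookup ?m l)" by (simp add: sum_mon)
    also have "\<dots> \<le> (\<Sum>l<n. lookup ?m' l)"
      using sum_update[of "{..<n}" j y "update ?m i x"] sum_update[of "{..<n}" i x ?m] ij xy x
      by (auto simp: lookup_update split: if_splits)
    also have "\<dots> \<le> sum_list (take n lam)"
      using below unfolding below_def by (metis card_lessThan finite_lessThan)
    finally show ?thesis .
  qed
  moreover have "sum_list lam = sum_list mu" using below deg by (simp add: below_def mdeg_mon)
  ultimately have "dominates lam mu" by (simp add: dominates_def)
  thus ?thesis using mu by (intro below_if_dominates[of _ mu]) (auto simp: exps_mon_partition)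
qed

text \<open>For i < j the one-sided expansion only sees monomials with weight moved from j to i, and
  these are not below \<open>lam\<close> when \<open>mon mu\<close> is not. Pairs with i > j are
  reduced to this by symmetry.\<close>

lemma triangular_lap:
  assumes "triangular lam f"
  shows "triangular lam (lap f)"
proof (rule triangularI, rule ccontr)
  fix mu assume mu: "mu \<in> partitions" and nz: "mcoeff (lap f) (mon mu) \<noteq> 0" and nd: "\<not> dominates lam mu"
  let ?m = "mon mu"
  have nb: "\<not> below lam ?m" using nd dominates_if_below_mon by blast
  have lt: "var_pair i j (mcoeff f) ?m = 0" if ij: "i < j" for i j
  proof (rule var_pair_eq_0I)
    fix x y assume "x + y = lookup ?m i + lookup ?m j" "lookup ?m i \<le> x"
    hence "\<not> below lam (update (update ?m i x) j y)" using below_raise[OF mu ij] nb by blast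
    thus "mcoeff f (update (update ?m i x) j y) = 0" using assms by (auto simp: triangular_def)
  qed (use ij in simp)
  have "var_pair i j (mcoeff f) ?m = 0" if "i \<noteq> j" for i j
  proof (cases "i < j")
    case False
    thus ?thesis using lt[of j i] that by (subst var_pair_commute) auto
  qed (rule lt)
  moreover have "mcoeff f ?m = 0" using nb assms by (auto simp: triangular_def)
  ultimately have "mcoeff (lap f) ?m = 0"
    by (simp add: mcoeff_lap_keys lap_coeff_def)
  thus False using nz by simp
qed

lemma belowD:
  "below lam m \<Longrightarrow> finite A \<Longrightarrow> (\<Sum>i\<in>A. lookup m i) \<le> sum_list (take (card A) lam)"
  by (simp add: below_def)

lemma below_cons_mon_top:
  assumes "below (r # lam) (cons_mon c m)"
  shows "c \<le> r"
  using belowD[OF assms, of "{0}"] by simp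

lemma below_cons_mon_tail:
  assumes "below (r # lam) (cons_mon r m)"
  shows "below lam m"
  unfolding below_def
proof (intro conjI allI impI)
  show "mdeg m = sum_list lam" using assms by (simp add: below_def mdeg_cons_mon)
  fix A :: "nat set" assume A: "finite A"
  have "card (insert 0 (Suc ` A)) = Suc (card A)" using A by (simp add: card_image)
  moreover have "(\<Sum>i\<in>insert 0 (Suc ` A). lookup (cons_mon r m) i) = r + (\<Sum>i\<in>A. lookup m i)"
    using A by (subst sum_cons_mon) auto
  ultimately show "(\<Sum>i\<in>A. lookup m i) \<le> sum_list (take (card A) lam)"
    using belowD[OF assms, of "insert 0 (Suc ` A)"] A by (simp del: sum.insert card.insert)
qed

lemma triangular_var_coeff_above:
  assumes "triangular (r # lam) f" "c > r"
  shows "var_coeff c f = 0"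
proof (rule symfun_eqI)
  fix m
  have "\<not> below (r # lam) (cons_mon c m)" using assms(2) below_cons_mon_top by fastforce
  thus "mcoeff (var_coeff c f) m = mcoeff 0 m"
    using assms by (auto simp: triangular_def mcoeff_var_coeff zero_symfun.rep_eq)
qed

lemma triangular_var_coeff:
  assumes "triangular (r # lam) f"
  shows "triangular lam (var_coeff r f)"
  using assms below_cons_mon_tail by (auto simp: triangular_def mcoeff_var_coeff)

lemma homogeneous_var_coeff:
  assumes "homogeneous (c + d) f"
  shows "homogeneous d (var_coeff c f)"
  using assms by (auto simp: homogeneous_def mcoeff_var_coeff mdeg_cons_mon)

section \<open>Eigenvalues and their separation along the dominance order\<close>

primrec eigenval :: "nat list \<Rightarrow> ratfun" where
  "eigenval [] = 0"
| "eigenval (r # xs) = kk * (of_nat r * (of_nat r - 1) / 2) + eigenval xs - of_nat (sum_list xs)"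

lemma shear_0: "shear r 0 = 0"
proof -
  have "lap 0 = 0" using lap_scale[of 0 0] by simp
  thus ?thesis by (simp add: shear_def)
qed

lemma var_coeff_lap_top:
  assumes "triangular (r # lam) f"
  shows "var_coeff r (lap f) = lap (var_coeff r f)
      + const (kk * (of_nat r * (of_nat r - 1) / 2) - of_nat (sum_list lam)) * var_coeff r f"
proof -
  have "var_coeff (r + s) f = 0" if "s > 0" for s
    using triangular_var_coeff_above[OF assms] that by simp
  moreover from this[of 1] have "var_coeff (Suc r) f = 0" by simp
  ultimately show ?thesis
    using var_coeff_lap[of r f "sum_list lam"] triangular_homogeneous[OF triangular_var_coeff[OF assms]]
    by (simp add: shear_0)
qed

text \<open>The parts are stripped off one at a time as top powers of y. Each step adds the scalar
  of \<open>var_coeff_lap_top\<close>, which is the recursion defining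
  \<open>eigenval\<close>.\<close>

lemma lap_leading_coeff:
  assumes "triangular lam f"
  shows "mcoeff (lap f) (mon lam) = eigenval lam * mcoeff f (mon lam)"
  using assms
proof (induction lam arbitrary: f)
  case Nil
  show ?case by (simp add: mcoeff_lap_keys lap_coeff_def)
next
  case (Cons r lam)
  have "mcoeff (lap f) (mon (r # lam)) = mcoeff (var_coeff r (lap f)) (mon lam)"
    by (simp add: mcoeff_var_coeff)
  also have "\<dots> = eigenval (r # lam) * mcoeff (var_coeff r f) (mon lam)"
    unfolding var_coeff_lap_top[OF Cons.prems] plus_symfun.rep_eq mcoeff_const_mult
      Cons.IH[OF triangular_var_coeff[OF Cons.prems]]
    by (simp add: algebra_simps)
  finally show ?case by (simp add: mcoeff_var_coeff)
qed

text \<open>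
  This is $n(\lambda) = \sum_i (i-1)\lambda_i$ in Macdonald's notation; the eigenvalue above equals
  $k\,n(\lambda') - n(\lambda)$.
\<close>

primrec coarse_weight :: "nat list \<Rightarrow> nat" where
  "coarse_weight [] = 0"
| "coarse_weight (r # xs) = coarse_weight xs + sum_list xs"

text \<open>Only the k-free part is made explicit, as it alone separates eigenvalues. The
  coefficient of k just has to be an integer, which holds because r(r-1) is even.\<close>

lemma eigenval_eq: "\<exists>a::int. eigenval lam = kk * of_int a - of_nat (coarse_weight lam)"
proof (induction lam)
  case (Cons r lam)
  then obtain a :: int where a: "eigenval lam = kk * of_int a - of_nat (coarse_weight lam)" by blast
  have "even (int r * (int r - 1))" by auto
  then obtain b where b: "int r * (int r - 1) = 2 * b" by blast
  hence "(of_nat r * (of_nat r - 1) / 2 :: ratfun) = of_int b"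
  proof -
    have "(of_nat r * (of_nat r - 1) :: ratfun) = of_int (int r * (int r - 1))" by simp
    thus ?thesis unfolding b by simp
  qed
  thus ?case using a by (intro exI[of _ "a + b"]) (simp add: algebra_simps)
qed (auto intro: exI[of _ 0])

text \<open>Summation by parts: n(lambda) adds up the tails left after the first n parts. It turns
  bounds on prefix sums into bounds on \<open>coarse_weight\<close>.\<close>

lemma coarse_weight_eq:
  assumes "length xs \<le> L"
  shows "coarse_weight xs + (\<Sum>n=1..L. sum_list (take n xs)) = L * sum_list xs"
  using assms
proof (induction xs arbitrary: L)
  case (Cons r xs)
  then obtain L' where L: "L = Suc L'" "length xs \<le> L'" by (cases L) auto
  have "(\<Sum>n=1..L. sum_list (take n (r # xs))) = (\<Sum>n=0..L'. r + sum_list (take n xs))"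
    unfolding L using sum.shift_bounds_cl_Suc_ivl[of "\<lambda>n. sum_list (take n (r # xs))" 0 L'] by simp
  also have "\<dots> = Suc L' * r + (\<Sum>n=0..L'. sum_list (take n xs))" by (simp add: sum.distrib)
  also have "(\<Sum>n=0..L'. sum_list (take n xs)) = (\<Sum>n=1..L'. sum_list (take n xs))"
    by (simp add: sum.atLeast_Suc_atMost)
  finally show ?case using Cons.IH[OF L(2)] L by (simp add: algebra_simps)
qed simp

lemma partitions_Cons: "r # lam \<in> partitions \<longleftrightarrow> r > 0 \<and> (\<forall>x\<in>set lam. x \<le> r) \<and> lam \<in> partitions"
  by (auto simp: partitions_def)

lemma partitions_eqI:
  assumes "xs \<in> partitions" "ys \<in> partitions" "\<And>n. sum_list (take n xs) = sum_list (take n ys)"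
  shows "xs = ys"
  using assms
proof (induction xs arbitrary: ys)
  case Nil
  thus ?case using Nil.prems(3)[of 1] by (cases ys) (auto simp: partitions_Cons)
next
  case (Cons x xs)
  obtain y ys' where ys: "ys = y # ys'"
    using Cons.prems(1) Cons.prems(3)[of 1] by (cases ys) (auto simp: partitions_Cons)
  have xy: "x = y" using Cons.prems(3)[of 1] ys by simp
  have "sum_list (take n xs) = sum_list (take n ys')" for n
    using Cons.prems(3)[of "Suc n"] ys xy by simp
  thus ?case using Cons ys xy by (auto simp: partitions_Cons)
qed

lemma coarse_weight_less:
  assumes "lam \<in> partitions" "mu \<in> partitions" "dominates lam mu" "lam \<noteq> mu"
  shows "coarse_weight lam < coarse_weight mu"
proof -
  obtain n where n: "sum_list (take n mu) \<noteq> sum_list (take n lam)"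
    using partitions_eqI[OF assms(2,1)] assms(4) by metis
  obtain L where L: "n \<le> L" "length lam \<le> L" "length mu \<le> L"
    by (rule that[of "n + length lam + length mu"]) auto
  have n0: "n \<noteq> 0" using n by (intro notI) simp
  have le: "sum_list (take i mu) \<le> sum_list (take i lam)" for i
    using assms(3) by (simp add: dominates_def)
  have lt: "sum_list (take n mu) < sum_list (take n lam)" using le[of n] n by linarith
  have "(\<Sum>i=1..L. sum_list (take i mu)) < (\<Sum>i=1..L. sum_list (take i lam))"
    using le n0 lt L(1) by (intro sum_strict_mono_ex1 ballI bexI[of _ n]) auto
  moreover have "sum_list lam = sum_list mu" using assms(3) by (simp add: dominates_def)
  ultimately show ?thesis
    using coarse_weight_eq[OF L(2)] coarse_weight_eq[OF L(3)] by simp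
qed

text \<open>Strict dominance strictly lowers \<open>coarse_weight\<close>, so the k-free parts
  already differ.\<close>

lemma eigenval_inj:
  assumes "lam \<in> partitions" "mu \<in> partitions" "dominates lam mu" "lam \<noteq> mu"
  shows "eigenval lam \<noteq> eigenval mu"
proof
  assume e: "eigenval lam = eigenval mu"
  obtain a b :: int where "eigenval lam = kk * of_int a - of_nat (coarse_weight lam)"
    "eigenval mu = kk * of_int b - of_nat (coarse_weight mu)" using eigenval_eq by meson
  hence "of_int (int (coarse_weight mu) - int (coarse_weight lam)) + kk * of_int (a - b) = 0"
    using e by (simp add: algebra_simps)
  thus False using coarse_weight_less[OF assms] unfolding kk_linear_eq_0_iff by simp
qed

lemma dominates_refl: "dominates lam lam"
  by (simp add: dominates_def)

lemma dominates_trans: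
  assumes "dominates lam mu" "dominates mu nu"
  shows "dominates lam nu"
  unfolding dominates_def
proof (intro conjI allI)
  show "sum_list lam = sum_list nu" using assms by (simp add: dominates_def)
  show "sum_list (take n nu) \<le> sum_list (take n lam)" for n
    by (rule order_trans[of _ "sum_list (take n mu)"]) (use assms in \<open>simp_all add: dominates_def\<close>)
qed

section \<open>Jack families\<close>

lemma symfun_eq_0I:
  assumes "\<And>mu. mu \<in> partitions \<Longrightarrow> mcoeff f (mon mu) = 0"
  shows "f = 0"
proof (rule symfun_eqI)
  fix m
  obtain mu where "mu \<in> partitions" "exps m = mset mu" using ex_exps_partition by blast
  thus "mcoeff f m = mcoeff 0 m" using assms mcoeff_eq_mon by (metis zero_symfun.rep_eq)
qed

section \<open>Homogeneity and nondegeneracy of the inner product\<close>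

lemma homogeneous_psum_mult:
  assumes "homogeneous d f"
  shows "homogeneous (r + d) (psum r * f)"
  unfolding homogeneous_def
proof (intro allI impI)
  fix m assume "mcoeff (psum r * f) m \<noteq> 0"
  then obtain i b where "m = Poly_Mapping.single i r + b" "mcoeff f b \<noteq> 0" by (rule psum_mult_support)
  thus "mdeg m = r + d" using assms by (simp add: homogeneous_def mdeg_add) (simp add: mdeg_def)
qed

lemma homogeneous_pprod: "homogeneous (sum_list xs) (pprod xs)"
proof (induction xs)
  case Nil
  show ?case by (auto simp: homogeneous_def pprod_def one_symfun.rep_eq mdeg_def)
next
  case (Cons r xs)
  thus ?case using homogeneous_psum_mult by (simp add: pprod_Cons)
qed

lemma homogeneous_add: "homogeneous d f \<Longrightarrow> homogeneous d g \<Longrightarrow> homogeneous d (f + g)"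
  unfolding homogeneous_def plus_symfun.rep_eq by (metis add_0)

lemma homogeneous_diff: "homogeneous d f \<Longrightarrow> homogeneous d g \<Longrightarrow> homogeneous d (f - g)"
  unfolding homogeneous_def minus_symfun.rep_eq by (metis diff_self)

lemma homogeneous_scale: "homogeneous d f \<Longrightarrow> homogeneous d (scale c f)"
  unfolding homogeneous_def scale.rep_eq by (metis mult_zero_right)

lemma homogeneous_sum: "(\<And>x. x \<in> A \<Longrightarrow> homogeneous d (f x)) \<Longrightarrow> homogeneous d (sum f A)"
proof (induction A rule: infinite_finite_induct)
  case (insert x A)
  thus ?case by (simp add: homogeneous_add)
qed (simp_all add: homogeneous_def zero_symfun.rep_eq)

lemma pcoord_eq_0_imp:
  assumes "\<And>xs. xs \<in> partitions \<Longrightarrow> pcoord f xs = 0"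
  shows "f = 0"
proof -
  let ?B = "pprod ` partitions :: ratfun symfun set"
  have "symfun.representation ?B f b = 0" for b
    using symfun.representation_ne_zero[of ?B f b] assms by (auto simp: pcoord_def)
  thus ?thesis
    using symfun.sum_nonzero_representation_eq[OF independent_pprod, of f] by (simp add: span_pprod)
qed

lemma jack_inner_nondegenerate:
  assumes "\<And>xs. xs \<in> partitions \<Longrightarrow> jack_inner f (pprod xs) = 0"
  shows "f = 0"
proof (rule pcoord_eq_0_imp)
  fix xs assume xs: "xs \<in> partitions"
  have "jack_inner f (pprod xs) = jack_inner (pprod xs) f" by (rule jack_inner_commute)
  also have "\<dots> = (\<Sum>ys\<in>{xs}. pcoord (pprod xs) ys * pcoord f ys * kk ^ length ys * of_nat (zee ys))"
    using xs by (intro jack_inner_eq) (auto simp: pcoord_pprod split: if_splits)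
  also have "\<dots> = pcoord f xs * kk ^ length xs * of_nat (zee xs)"
    using xs by (simp add: pcoord_pprod)
  finally have "pcoord f xs * kk ^ length xs * of_nat (zee xs) = 0" using assms[OF xs] by simp
  moreover have "zee xs \<noteq> 0" using xs by (auto simp: zee_def partitions_def)
  ultimately show "pcoord f xs = 0" by simp
qed

lemma below_degree: "below lam m \<Longrightarrow> mdeg m = sum_list lam"
  by (simp add: below_def)

text \<open>The index sets over which a function supported on them can be expanded in the P by
  elimination.\<close>

definition down_closed :: "nat list set \<Rightarrow> bool" where
  "down_closed U \<longleftrightarrow> U \<subseteq> partitions \<and> (\<forall>lam\<in>U. \<forall>mu\<in>partitions. dominates lam mu \<longrightarrow> mu \<in> U)"

lemma down_closed_dominated: "down_closed {mu \<in> partitions. dominates lam mu}"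
  by (auto simp: down_closed_def intro: dominates_trans)

lemma finite_dominated_refl: "finite {mu \<in> partitions. dominates lam mu}"
  by (rule finite_subset[OF _ finite_partitions_of[of "sum_list lam"]]) (auto simp: dominates_def)

lemma down_closed_degree: "down_closed {mu \<in> partitions. sum_list mu = d}"
  by (auto simp: down_closed_def dominates_def)

lemma down_closed_first_part:
  "down_closed {mu \<in> partitions. sum_list mu = d \<and> sum_list (take 1 mu) \<le> x}"
  unfolding down_closed_def
proof (intro conjI ballI impI)
  fix lam mu
  assume *: "lam \<in> {mu \<in> partitions. sum_list mu = d \<and> sum_list (take 1 mu) \<le> x}" "mu \<in> partitions" "dominates lam mu"
  hence "sum_list (take 1 mu) \<le> sum_list (take 1 lam)" unfolding dominates_def by blast
  also have "\<dots> \<le> x" using * by simp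
  finally show "mu \<in> {mu \<in> partitions. sum_list mu = d \<and> sum_list (take 1 mu) \<le> x}"
    using * by (simp add: dominates_def)
qed auto

locale jack_family =
  fixes P :: "nat list \<Rightarrow> ratfun symfun"
  assumes jack: "is_jack_family P"
begin

lemma
  assumes "lam \<in> partitions"
  shows P_triangular: "triangular lam (P lam)"
    and P_leading: "mcoeff (P lam) (mon lam) = 1"
proof -
  let ?U = "{mu. mu \<in> partitions \<and> dominates lam mu \<and> mu \<noteq> lam}"
  obtain u where u: "P lam = msym lam + (\<Sum>mu\<in>?U. scale (u mu) (msym mu))"
    using jack assms unfolding is_jack_family_def by blast
  have c: "mcoeff (P lam) m = (if exps m = mset lam then 1 else 0)
      + (\<Sum>mu\<in>?U. u mu * (if exps m = mset mu then 1 else 0))" for m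
    unfolding u by (simp add: plus_symfun.rep_eq mcoeff_sum scale.rep_eq msym.rep_eq)
  show "triangular lam (P lam)"
  proof (rule triangularI)
    fix mu assume mu: "mu \<in> partitions" and nz: "mcoeff (P lam) (mon mu) \<noteq> 0"
    show "dominates lam mu"
    proof (rule ccontr)
      assume nd: "\<not> dominates lam mu"
      have "mset mu \<noteq> mset lam" using nd mu assms partitions_mset_eq dominates_refl by metis
      moreover have "(\<Sum>nu\<in>?U. u nu * (if exps (mon mu) = mset nu then 1 else 0)) = 0"
      proof (intro sum.neutral ballI)
        fix nu assume "nu \<in> ?U"
        hence "mset mu \<noteq> mset nu" using nd mu partitions_mset_eq by blast
        thus "u nu * (if exps (mon mu) = mset nu then 1 else 0) = 0"
          using exps_mon_partition[OF mu] by simp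
      qed
      ultimately have "mcoeff (P lam) (mon mu) = 0" unfolding c using exps_mon_partition[OF mu] by simp
      thus False using nz by simp
    qed
  qed
  have "(\<Sum>nu\<in>?U. u nu * (if exps (mon lam) = mset nu then 1 else 0)) = 0"
  proof (intro sum.neutral ballI)
    fix nu assume "nu \<in> ?U"
    hence "mset lam \<noteq> mset nu" using assms partitions_mset_eq by blast
    thus "u nu * (if exps (mon lam) = mset nu then 1 else 0) = 0"
      using exps_mon_partition[OF assms] by simp
  qed
  thus "mcoeff (P lam) (mon lam) = 1" unfolding c using exps_mon_partition[OF assms] by simp
qed

lemma P_homogeneous: "lam \<in> partitions \<Longrightarrow> homogeneous (sum_list lam) (P lam)"
  using P_triangular triangular_homogeneous by blast

lemma P_orthogonal: "lam \<in> partitions \<Longrightarrow> mu \<in> partitions \<Longrightarrow> lam \<noteq> mu \<Longrightarrow> jack_inner (P lam) (P mu) = 0"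
  using jack unfolding is_jack_family_def by blast

text \<open>Gaussian elimination: subtract the multiple of P that removes the coefficient at a
  dominance-maximal element of \<open>U\<close>. Only coefficients inside \<open>U\<close> change,
  and the remaining set is still down-closed.\<close>

lemma P_expansion:
  assumes "finite U" "down_closed U" "\<And>mu. mu \<in> partitions \<Longrightarrow> mcoeff f (mon mu) \<noteq> 0 \<Longrightarrow> mu \<in> U"
  shows "\<exists>a. f = (\<Sum>nu\<in>U. scale (a nu) (P nu))"
  using assms
proof (induction "card U" arbitrary: U f)
  case 0
  hence "f = 0" by (intro symfun_eq_0I) auto
  thus ?case using 0 by simp
next
  case (Suc n)
  have U: "U \<noteq> {}" "U \<subseteq> partitions" using Suc.hyps(2) Suc.prems(2) by (auto simp: down_closed_def)
  \<comment> \<open>A strictly dominating partition has smaller \<open>coarse_weight\<close>, so a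
    minimum is maximal in dominance.\<close>
  define lam where "lam = arg_min_on coarse_weight U"
  have lam: "lam \<in> U" "\<And>mu. mu \<in> U \<Longrightarrow> coarse_weight lam \<le> coarse_weight mu"
    using arg_min_if_finite[OF Suc.prems(1) U(1), of coarse_weight] unfolding lam_def
    by (auto simp: not_less)
  have lp: "lam \<in> partitions" using lam U by blast
  let ?c = "mcoeff f (mon lam)" and ?U = "U - {lam}"
  have "\<exists>a. f - scale ?c (P lam) = (\<Sum>nu\<in>?U. scale (a nu) (P nu))"
  proof (rule Suc.hyps(1))
    show "n = card ?U" using Suc.hyps(2) Suc.prems(1) lam by simp
    show "finite ?U" using Suc.prems(1) by simp
    have "nu \<noteq> lam" if "mu \<in> ?U" "nu \<in> partitions" "dominates mu nu" for mu nu
      using coarse_weight_less[of mu lam] lam(2)[of mu] that U lp by auto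
    thus "down_closed ?U" using Suc.prems(2) by (auto simp: down_closed_def)
    fix mu assume mu: "mu \<in> partitions" and nz: "mcoeff (f - scale ?c (P lam)) (mon mu) \<noteq> 0"
    have "mu \<noteq> lam" using nz P_leading[OF lp] by (auto simp: minus_symfun.rep_eq scale.rep_eq)
    moreover have "mcoeff f (mon mu) \<noteq> 0 \<or> mcoeff (P lam) (mon mu) \<noteq> 0"
      using nz by (auto simp: minus_symfun.rep_eq scale.rep_eq)
    hence "mu \<in> U"
      using Suc.prems(2,3) mu lam(1) triangularD[OF P_triangular[OF lp], of mu]
      by (auto simp: down_closed_def)
    ultimately show "mu \<in> ?U" by simp
  qed
  then obtain a where a: "f - scale ?c (P lam) = (\<Sum>nu\<in>?U. scale (a nu) (P nu))" by blast
  have "f = scale ?c (P lam) + (\<Sum>nu\<in>?U. scale (a nu) (P nu))" unfolding a[symmetric] by simp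
  also have "\<dots> = (\<Sum>nu\<in>U. scale ((a(lam := ?c)) nu) (P nu))"
    using Suc.prems(1) lam(1) by (subst (2) sum.remove[of _ lam]) auto
  finally show ?case by blast
qed

lemma jack_inner_P_sum:
  assumes "finite U" "U \<subseteq> partitions" "lam \<in> partitions"
  shows "jack_inner (\<Sum>nu\<in>U. scale (a nu) (P nu)) (P lam)
       = (if lam \<in> U then a lam * jack_inner (P lam) (P lam) else 0)"
proof -
  have "jack_inner (\<Sum>nu\<in>U. scale (a nu) (P nu)) (P lam) = (\<Sum>nu\<in>U. if nu = lam then a lam * jack_inner (P lam) (P lam) else 0)"
    unfolding jack_inner_sum_left jack_inner_scale_left
    using assms P_orthogonal by (intro sum.cong refl) (auto simp: subset_iff)
  thus ?thesis using assms by simp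
qed

lemma homogeneous_expansion:
  assumes "homogeneous d f"
  shows "\<exists>a. f = (\<Sum>nu | nu \<in> partitions \<and> sum_list nu = d. scale (a nu) (P nu))"
  using assms finite_partitions_of[of d] down_closed_degree[of d]
  by (intro P_expansion) (auto simp: homogeneous_def mdeg_mon)

lemma P_nonzero: "lam \<in> partitions \<Longrightarrow> P lam \<noteq> 0"
  using P_leading[of lam] by (auto simp: zero_symfun.rep_eq)

text \<open>Otherwise P lam would be orthogonal to every P nu. These span each degree, so it would
  be orthogonal to all power sum products, contradicting nondegeneracy.\<close>

lemma P_norm_nonzero:
  assumes lam: "lam \<in> partitions"
  shows "jack_inner (P lam) (P lam) \<noteq> 0"
proof
  assume z: "jack_inner (P lam) (P lam) = 0"
  have "P lam = 0"
  proof (rule jack_inner_nondegenerate)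
    fix xs
    obtain a where "pprod xs = (\<Sum>nu | nu \<in> partitions \<and> sum_list nu = sum_list xs. scale (a nu) (P nu))"
      using homogeneous_expansion[OF homogeneous_pprod] by blast
    hence "jack_inner (pprod xs) (P lam) = 0"
      using lam z finite_partitions_of by (simp add: jack_inner_P_sum)
    thus "jack_inner (P lam) (pprod xs) = 0" by (simp add: jack_inner_commute)
  qed
  thus False using P_nonzero[OF lam] by simp
qed

lemma triangular_expansion:
  assumes "triangular lam f"
  shows "\<exists>a. f = (\<Sum>nu | nu \<in> partitions \<and> dominates lam nu. scale (a nu) (P nu))"
  using finite_dominated_refl down_closed_dominated triangularD[OF assms] by (intro P_expansion) auto

lemma dominates_antisym:
  "lam \<in> partitions \<Longrightarrow> mu \<in> partitions \<Longrightarrow> dominates lam mu \<Longrightarrow> dominates mu lam \<Longrightarrow> lam = mu"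
  using coarse_weight_less[of lam mu] coarse_weight_less[of mu lam] by force

text \<open>A component along a lower \<open>mu\<close> is computed by moving the operator to P mu.
  There it only produces partitions dominated by \<open>mu\<close>, hence not \<open>lam\<close>,
  and the pairing vanishes; the leading coefficient then gives the eigenvalue.\<close>

lemma lap_P:
  assumes lam: "lam \<in> partitions"
  shows "lap (P lam) = scale (eigenval lam) (P lam)"
proof -
  let ?U = "\<lambda>lam. {nu. nu \<in> partitions \<and> dominates lam nu}"
  note fin = finite_dominated_refl
  obtain a where a: "lap (P lam) = (\<Sum>nu\<in>?U lam. scale (a nu) (P nu))"
    using triangular_expansion[OF triangular_lap[OF P_triangular[OF lam]]] by blast
  have "a mu = 0" if mu: "mu \<in> ?U lam" "mu \<noteq> lam" for mu
  proof -
    have mp: "mu \<in> partitions" using mu by simp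
    obtain b where b: "lap (P mu) = (\<Sum>nu\<in>?U mu. scale (b nu) (P nu))"
      using triangular_expansion[OF triangular_lap[OF P_triangular[OF mp]]] by blast
    have "lam \<notin> ?U mu" using mu lam dominates_antisym by blast
    hence "jack_inner (lap (P mu)) (P lam) = 0"
      unfolding b using lam fin[of mu] by (subst jack_inner_P_sum) auto
    hence "jack_inner (lap (P lam)) (P mu) = 0"
      by (simp add: jack_inner_lap jack_inner_commute[of "P lam"])
    moreover have "jack_inner (lap (P lam)) (P mu) = a mu * jack_inner (P mu) (P mu)"
      unfolding a using mu fin[of lam] by (subst jack_inner_P_sum) auto
    ultimately show ?thesis using P_norm_nonzero[OF mp] by simp
  qed
  hence "lap (P lam) = (\<Sum>nu\<in>{lam}. scale (a nu) (P nu))"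
    unfolding a using lam fin[of lam] dominates_refl by (intro sum.mono_neutral_right) auto
  hence e: "lap (P lam) = scale (a lam) (P lam)" by simp
  have "mcoeff (lap (P lam)) (mon lam) = eigenval lam"
    using lap_leading_coeff[OF P_triangular[OF lam]] P_leading[OF lam] by simp
  moreover have "mcoeff (lap (P lam)) (mon lam) = a lam"
    unfolding e using P_leading[OF lam] by (simp add: scale.rep_eq)
  ultimately show ?thesis using e by simp
qed

lemma jack_inner_lap_P: "lam \<in> partitions \<Longrightarrow> jack_inner (lap f) (P lam) = eigenval lam * jack_inner f (P lam)"
  by (simp add: jack_inner_lap lap_P scale_conv_const jack_inner_const_right)

text \<open>The top coefficient in y is triangular for \<open>lam\<close> and is an eigenvector for
  \<open>eigenval lam\<close>. Separation of eigenvalues leaves only a multiple of P lam, and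
  comparing leading coefficients fixes the factor as 1.\<close>

lemma var_coeff_P_top:
  assumes rl: "r # lam \<in> partitions"
  shows "var_coeff r (P (r # lam)) = P lam"
proof -
  have lam: "lam \<in> partitions" using rl by (simp add: partitions_Cons)
  let ?F = "var_coeff r (P (r # lam))" and ?U = "{nu. nu \<in> partitions \<and> dominates lam nu}"
  let ?c = "kk * (of_nat r * (of_nat r - 1) / 2) - of_nat (sum_list lam)"
  have "scale (eigenval (r # lam)) ?F = lap ?F + const ?c * ?F"
    using var_coeff_lap_top[OF P_triangular[OF rl]] by (simp only: lap_P[OF rl] var_coeff_scale)
  hence "lap ?F = const (eigenval (r # lam) - ?c) * ?F"
    by (simp only: const_diff left_diff_distrib scale_conv_const) (simp add: algebra_simps)
  hence ev: "lap ?F = const (eigenval lam) * ?F" by simp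
  obtain a where a: "?F = (\<Sum>nu\<in>?U. scale (a nu) (P nu))"
    using triangular_expansion[OF triangular_var_coeff[OF P_triangular[OF rl]]] by blast
  have "a nu = 0" if nu: "nu \<in> ?U" "nu \<noteq> lam" for nu
  proof -
    have "eigenval lam * jack_inner ?F (P nu) = eigenval nu * jack_inner ?F (P nu)"
      using jack_inner_lap_P[of nu ?F, unfolded ev jack_inner_const_left] nu by blast
    moreover have "eigenval lam \<noteq> eigenval nu" using eigenval_inj[OF lam, of nu] nu by auto
    ultimately have "jack_inner ?F (P nu) = 0" by auto
    moreover have "jack_inner ?F (P nu) = a nu * jack_inner (P nu) (P nu)"
      unfolding a using nu finite_dominated_refl[of lam] by (subst jack_inner_P_sum) auto
    ultimately show ?thesis using P_norm_nonzero[of nu] nu by simp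
  qed
  hence "?F = (\<Sum>nu\<in>{lam}. scale (a nu) (P nu))"
    unfolding a using lam finite_dominated_refl[of lam] dominates_refl by (intro sum.mono_neutral_right) auto
  hence e: "?F = scale (a lam) (P lam)" by simp
  have "mcoeff ?F (mon lam) = 1" using P_leading[OF rl] by (simp add: mcoeff_var_coeff)
  hence "a lam = 1" unfolding e using P_leading[OF lam] by (simp add: scale.rep_eq)
  thus ?thesis using e by simp
qed

section \<open>The second coefficient in y and the coefficients of the product\<close>

lemma var_coeff_P_above: "r # lam \<in> partitions \<Longrightarrow> c > r \<Longrightarrow> var_coeff c (P (r # lam)) = 0"
  using triangular_var_coeff_above P_triangular by blast

text \<open>
  The coefficient of $y^{r-1}$ of the eigenvalue equation determines the second coefficient
  in $y$ of $P_{(r,\lambda)}$ in terms of $p_1 P_\lambda$.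
\<close>

lemma jack_inner_var_coeff_P_second:
  assumes rl: "r # lam \<in> partitions" and nu: "nu \<in> partitions"
  shows "kk * (eigenval nu - eigenval lam - kk * (of_nat r - 1) - 1) * jack_inner (var_coeff (r - 1) (P (r # lam))) (P nu)
       = (eigenval nu - eigenval lam - kk * of_nat r) * jack_inner (psum 1 * P lam) (P nu)"
proof -
  have lam: "lam \<in> partitions" and r: "r > 0" using rl by (auto simp: partitions_Cons)
  let ?c = "r - 1" and ?F = "P lam"
  let ?G = "var_coeff ?c (P (r # lam))"
  let ?g = "jack_inner ?G (P nu)" and ?p = "jack_inner (psum 1 * P lam) (P nu)"
  have "homogeneous (?c + (sum_list lam + 1)) (P (r # lam))"
    using P_homogeneous[OF rl] r by simp
  hence hom: "homogeneous (sum_list lam + 1) ?G" by (rule homogeneous_var_coeff)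
  have top: "var_coeff (?c + s) (P (r # lam)) = 0" if "s \<ge> 2" for s
    using that r by (intro var_coeff_P_above[OF rl]) auto
  have c1: "?c + 1 = r" using r by simp
  have "scale (eigenval (r # lam)) ?G = lap ?G
      + const (kk * (of_nat ?c * (of_nat ?c - 1) / 2) - of_nat (sum_list lam + 1)) * ?G
      + of_nat r * (psum 1 * ?F) - shear 1 ?F"
    using var_coeff_lap[OF top hom] unfolding c1 lap_P[OF rl] var_coeff_scale var_coeff_P_top[OF rl] .
  hence "jack_inner (scale (eigenval (r # lam)) ?G + shear 1 ?F) (P nu) = jack_inner (lap ?G
      + const (kk * (of_nat ?c * (of_nat ?c - 1) / 2) - of_nat (sum_list lam + 1)) * ?G
      + of_nat r * (psum 1 * ?F)) (P nu)" by simp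
  hence 1: "eigenval (r # lam) * ?g + jack_inner (shear 1 ?F) (P nu) = eigenval nu * ?g
      + (kk * (of_nat ?c * (of_nat ?c - 1) / 2) - of_nat (sum_list lam + 1)) * ?g + of_nat r * ?p"
    unfolding jack_inner_add_left jack_inner_scale_left jack_inner_lap_P[OF nu] jack_inner_const_left
      jack_inner_of_nat_left .
  \<comment> \<open>For p_1 all correction terms of the commutator vanish except the derivation.
    Pairing with P nu thus expresses \<open>shear 1\<close> through p_1 P_lam.\<close>
  have "lap (psum 1 * ?F) = psum 1 * scale (eigenval lam) ?F + K * shear 1 ?F"
    using lap_psum_mult[of 1 ?F] by (simp add: lap_P[OF lam])
  hence "lap (psum 1 * ?F) = const (eigenval lam) * (psum 1 * ?F) + K * shear 1 ?F"
    by (simp add: scale_conv_const mult.left_commute)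
  hence "jack_inner (lap (psum 1 * ?F)) (P nu) = eigenval lam * ?p + kk * jack_inner (shear 1 ?F) (P nu)"
    by (simp only: jack_inner_add_left jack_inner_const_left)
  hence 2: "kk * jack_inner (shear 1 ?F) (P nu) = (eigenval nu - eigenval lam) * ?p"
    unfolding jack_inner_lap_P[OF nu] by (simp add: left_diff_distrib)
  have 3: "of_nat ?c = (of_nat r - 1 :: ratfun)" using r by (simp add: of_nat_diff)
  have "kk * (eigenval nu + (kk * ((of_nat r - 1) * (of_nat r - 1 - 1) / 2) - of_nat (sum_list lam + 1)) - eigenval (r # lam)) * ?g
      = kk * jack_inner (shear 1 ?F) (P nu) - kk * of_nat r * ?p"
    using arg_cong[OF 1[unfolded 3], of "\<lambda>x. kk * x"] by (simp add: algebra_simps)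
  also have "\<dots> = (eigenval nu - eigenval lam - kk * of_nat r) * ?p"
    unfolding 2 by (simp add: algebra_simps)
  also have "eigenval nu + (kk * ((of_nat r - 1) * (of_nat r - 1 - 1) / 2) - of_nat (sum_list lam + 1)) - eigenval (r # lam)
      = eigenval nu - eigenval lam - kk * (of_nat r - 1) - 1"
    by (simp add: field_simps)
  finally show ?thesis .
qed

text \<open>The preceding relation gives this once its left factor is nonzero. That holds for every
  \<open>nu\<close> that can occur in the second coefficient: there n(nu) >= n(lambda), so the
  k-free part of the factor is negative.\<close>

lemma jack_inner_var_coeff_P_second_eq_0:
  assumes rl: "r # lam \<in> partitions" and nu: "nu \<in> partitions"
    and z: "jack_inner (psum 1 * P lam) (P nu) = 0"
  shows "jack_inner (var_coeff (r - 1) (P (r # lam))) (P nu) = 0"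
proof -
  have r: "r > 0" using rl by (auto simp: partitions_Cons)
  let ?G = "var_coeff (r - 1) (P (r # lam))"
  \<comment> \<open>The slack 1 in the prefix sums comes from comparing the lists (r - 1) # mu and r
    # lam.\<close>
  let ?U = "{mu \<in> partitions. sum_list mu = sum_list lam + 1 \<and> (\<forall>n. sum_list (take n mu) \<le> sum_list (take n lam) + 1)}"
  have fin: "finite ?U" by (rule finite_subset[OF _ finite_partitions_of[of "sum_list lam + 1"]]) auto
  have "\<exists>a. ?G = (\<Sum>mu\<in>?U. scale (a mu) (P mu))"
  proof (rule P_expansion[OF fin])
    have "kap \<in> ?U" if *: "mu \<in> ?U" "kap \<in> partitions" "dominates mu kap" for mu kap
    proof -
      have "sum_list (take n kap) \<le> sum_list (take n lam) + 1" for n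
      proof (rule order_trans)
        show "sum_list (take n kap) \<le> sum_list (take n mu)" using * unfolding dominates_def by blast
      qed (use * in blast)
      thus ?thesis using * by (simp add: dominates_def)
    qed
    thus "down_closed ?U" unfolding down_closed_def by blast
    fix mu assume mu: "mu \<in> partitions" "mcoeff ?G (mon mu) \<noteq> 0"
    hence d: "dominates (r # lam) ((r - 1) # mu)"
      using triangularD[OF P_triangular[OF rl], of "(r - 1) # mu"] by (simp add: mcoeff_var_coeff)
    have "sum_list (take n mu) \<le> sum_list (take n lam) + 1" for n
    proof -
      have "sum_list (take (Suc n) ((r - 1) # mu)) \<le> sum_list (take (Suc n) (r # lam))"
        using d unfolding dominates_def by blast
      thus ?thesis using r by simp
    qed
    thus "mu \<in> ?U" using d mu(1) r by (auto simp: dominates_def)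
  qed
  then obtain a where a: "?G = (\<Sum>mu\<in>?U. scale (a mu) (P mu))" by blast
  show ?thesis
  proof (cases "nu \<in> ?U")
    case True
    let ?L = "max (length lam) (length nu)"
    have "(\<Sum>n=1..?L. sum_list (take n nu)) \<le> (\<Sum>n=1..?L. sum_list (take n lam) + 1)"
      using True by (intro sum_mono) auto
    hence "(\<Sum>n=1..?L. sum_list (take n nu)) \<le> (\<Sum>n=1..?L. sum_list (take n lam)) + ?L"
      unfolding sum.distrib by simp
    moreover have "coarse_weight nu + (\<Sum>n=1..?L. sum_list (take n nu)) = ?L * (sum_list lam + 1)"
      using coarse_weight_eq[of nu ?L] True by simp
    moreover have "coarse_weight lam + (\<Sum>n=1..?L. sum_list (take n lam)) = ?L * sum_list lam"
      by (rule coarse_weight_eq) simp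
    ultimately have cw: "coarse_weight lam \<le> coarse_weight nu" by simp
    obtain a b :: int where "eigenval lam = kk * of_int a - of_nat (coarse_weight lam)"
      "eigenval nu = kk * of_int b - of_nat (coarse_weight nu)" using eigenval_eq by meson
    hence "eigenval nu - eigenval lam - kk * (of_nat r - 1) - 1
        = of_int (int (coarse_weight lam) - int (coarse_weight nu) - 1) + kk * of_int (b - a - (int r - 1))"
      by (simp add: algebra_simps)
    also have "\<dots> \<noteq> 0" unfolding kk_linear_eq_0_iff using cw by simp
    finally show ?thesis using jack_inner_var_coeff_P_second[OF rl nu] z by simp
  next
    case False
    show ?thesis unfolding a using fin nu False by (subst jack_inner_P_sum) auto
  qed
qed

text \<open>If no first part exceeds x, then taking the coefficient of y^x removes all terms with a
  smaller first part and turns P (x # l) into P l, so orthogonality isolates one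
  coefficient.\<close>

lemma jack_inner_var_coeff_sum:
  assumes U: "finite U" "U \<subseteq> partitions" and x: "x > 0" "x # l \<in> U"
    and top: "\<And>lam. lam \<in> U \<Longrightarrow> a lam \<noteq> 0 \<Longrightarrow> sum_list (take 1 lam) \<le> x"
  shows "jack_inner (var_coeff x (\<Sum>lam\<in>U. scale (a lam) (P lam))) (P l) = a (x # l) * jack_inner (P l) (P l)"
proof -
  have l: "l \<in> partitions" using U x by (auto simp: partitions_Cons)
  have "a lam * jack_inner (var_coeff x (P lam)) (P l) = (if lam = x # l then a (x # l) * jack_inner (P l) (P l) else 0)"
    if lam: "lam \<in> U" for lam
  proof (cases lam)
    \<comment> \<open>P [] has degree 0, so y^x with x > 0 does not occur in it.\<close>
    case Nil
    have "var_coeff x (P []) = 0"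
    proof (rule symfun_eqI)
      have "homogeneous 0 (P [])" using P_homogeneous[of "[]"] by (simp add: partitions_def)
      thus "mcoeff (var_coeff x (P [])) m = mcoeff 0 m" for m
        using x by (auto simp: homogeneous_def mcoeff_var_coeff mdeg_cons_mon zero_symfun.rep_eq)
    qed
    thus ?thesis using Nil by (simp add: jack_inner_0_left)
  next
    case (Cons y ys)
    have yp: "y # ys \<in> partitions" "ys \<in> partitions" using U lam Cons by (auto simp: partitions_Cons)
    show ?thesis
    proof (cases "y = x")
      case True
      thus ?thesis using Cons var_coeff_P_top[of y ys] yp P_orthogonal[of ys l] l by auto
    next
      case False
      show ?thesis
      proof (cases "a lam = 0")
        case nz: False
        hence "y < x" using top[OF lam] Cons False by auto
        thus ?thesis using False Cons var_coeff_P_above[OF yp(1)] by (simp add: jack_inner_0_left)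
      qed (use False Cons in auto)
    qed
  qed
  hence "jack_inner (var_coeff x (\<Sum>lam\<in>U. scale (a lam) (P lam))) (P l)
      = (\<Sum>lam\<in>U. if lam = x # l then a (x # l) * jack_inner (P l) (P l) else 0)"
    by (simp add: var_coeff_sum var_coeff_scale jack_inner_sum_left jack_inner_scale_left)
  thus ?thesis using U x by simp
qed

text \<open>Multiplication by $p_1$ is adjoint to $k\,\partial/\partial p_1$, which does not increase the first part.\<close>

lemma jack_inner_psum_1_mult_eq_0:
  assumes mu: "r # mu \<in> partitions" and lam: "lam \<in> partitions" and less: "sum_list (take 1 lam) < r"
  shows "jack_inner (psum 1 * P (r # mu)) (P lam) = 0"
proof -
  have r: "r > 0" using mu by (simp add: partitions_Cons)
  let ?h = "var_coeff 1 (P lam)" and ?x = "sum_list (take 1 lam)"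
  let ?U = "{nu \<in> partitions. sum_list nu = sum_list lam - 1 \<and> sum_list (take 1 nu) \<le> ?x}"
  have fin: "finite ?U" by (rule finite_subset[OF _ finite_partitions_of[of "sum_list lam - 1"]]) auto
  have "\<exists>a. ?h = (\<Sum>nu\<in>?U. scale (a nu) (P nu))"
  proof (rule P_expansion[OF fin down_closed_first_part])
    fix nu assume nu: "nu \<in> partitions" "mcoeff ?h (mon nu) \<noteq> 0"
    hence nz: "mcoeff (P lam) (cons_mon 1 (mon nu)) \<noteq> 0" by (simp add: mcoeff_var_coeff)
    have b: "below lam (cons_mon 1 (mon nu))" using P_triangular[OF lam] nz by (auto simp: triangular_def)
    have "sum_list nu = sum_list lam - 1" using below_degree[OF b] by (simp add: mdeg_cons_mon mdeg_mon)
    \<comment> \<open>Index 1 carries the first part of \<open>nu\<close>, because the split-off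
      variable occupies index 0.\<close>
    moreover have "sum_list (take 1 nu) \<le> ?x"
      using belowD[OF b, of "{1}"] sum_mon[of nu 1] by simp
    ultimately show "nu \<in> ?U" using nu by simp
  qed
  then obtain a where a: "?h = (\<Sum>nu\<in>?U. scale (a nu) (P nu))" by blast
  have "r # mu \<notin> ?U" using less by simp
  hence "jack_inner ?h (P (r # mu)) = 0"
    unfolding a using fin mu by (subst jack_inner_P_sum) auto
  thus ?thesis
    using jack_inner_psum_mult[of 1 "P (r # mu)" "P lam"]
    unfolding psum_deriv_1_eq by (simp add: jack_inner_commute)
qed

text \<open>With \<open>c\<close> chosen to match y^r, the remainder \<open>R\<close> vanishes
  coefficient by coefficient, sorted by first part: below r by adjointness, r + 1 from y^(r+1), and
  r from y^r. The last reading is legitimate only after first part r + 1 has been excluded.\<close>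

lemma psum_1_mult_P_Cons:
  assumes rm: "r # m \<in> partitions"
  defines "V \<equiv> {l. r # l \<in> partitions \<and> sum_list l = sum_list m + 1}"
  defines "c \<equiv> \<lambda>l. (jack_inner (psum 1 * P m) (P l) + jack_inner (var_coeff (r - 1) (P (r # m))) (P l)
      - jack_inner (var_coeff r (P ((r + 1) # m))) (P l)) / jack_inner (P l) (P l)"
  shows "psum 1 * P (r # m) = P ((r + 1) # m) + (\<Sum>l\<in>V. scale (c l) (P (r # l)))"
proof -
  have m: "m \<in> partitions" and r: "r > 0" and rm1: "(r + 1) # m \<in> partitions"
    using rm by (auto simp: partitions_Cons)
  have V: "l \<in> partitions" "r # l \<in> partitions" if "l \<in> V" for l
    using that by (auto simp: V_def partitions_Cons)
  have finV: "finite V"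
    by (rule finite_subset[OF _ finite_partitions_of[of "sum_list m + 1"]]) (auto simp: V_def partitions_Cons)
  let ?S = "\<Sum>l\<in>V. scale (c l) (P (r # l))"
  define R where "R = psum 1 * P (r # m) - P ((r + 1) # m) - ?S"
  let ?U = "{nu \<in> partitions. sum_list nu = sum_list (r # m) + 1 \<and> sum_list (take 1 nu) \<le> r + 1}"
  have fin: "finite ?U" by (rule finite_subset[OF _ finite_partitions_of[of "sum_list (r # m) + 1"]]) auto
  have vS: "var_coeff x ?S = 0" if "x > r" for x
    using V that by (simp add: var_coeff_sum var_coeff_scale var_coeff_P_above)
  have vp: "var_coeff x (psum 1 * P (r # m)) = psum 1 * var_coeff x (P (r # m)) + var_coeff (x - 1) (P (r # m))"
    if "x > 0" for x
    using var_coeff_psum_mult[of 1 x "P (r # m)"] that by simp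
  have homR: "homogeneous (sum_list (r # m) + 1) R"
    unfolding R_def
  proof (intro homogeneous_diff homogeneous_sum homogeneous_scale)
    show "homogeneous (sum_list (r # m) + 1) (psum 1 * P (r # m))"
      using homogeneous_psum_mult[OF P_homogeneous[OF rm], of 1] by simp
    show "homogeneous (sum_list (r # m) + 1) (P ((r + 1) # m))"
      using P_homogeneous[OF rm1] by simp
    show "homogeneous (sum_list (r # m) + 1) (P (r # l))" if "l \<in> V" for l
      using P_homogeneous[OF V(2)[OF that]] that by (simp add: V_def)
  qed
  have "\<exists>a. R = (\<Sum>nu\<in>?U. scale (a nu) (P nu))"
  proof (rule P_expansion[OF fin down_closed_first_part])
    fix nu assume nu: "nu \<in> partitions" "mcoeff R (mon nu) \<noteq> 0"
    hence "sum_list nu = sum_list (r # m) + 1" using homR by (auto simp: homogeneous_def mdeg_mon)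
    moreover have "sum_list (take 1 nu) \<le> r + 1"
    proof (cases nu)
      case (Cons x xs)
      show ?thesis
      proof (rule ccontr)
        assume "\<not> ?thesis"
        hence x: "x > r + 1" using Cons by simp
        hence "var_coeff x R = 0"
          using vS[of x] vp[of x] var_coeff_P_above[OF rm, of x] var_coeff_P_above[OF rm, of "x - 1"]
            var_coeff_P_above[OF rm1, of x] by (simp add: R_def var_coeff_diff)
        thus False using nu(2) Cons by (simp add: zero_symfun.rep_eq flip: mcoeff_var_coeff)
      qed
    qed simp
    ultimately show "nu \<in> ?U" using nu by simp
  qed
  then obtain a where a: "R = (\<Sum>nu\<in>?U. scale (a nu) (P nu))" by blast
  have inner: "jack_inner R (P lam) = a lam * jack_inner (P lam) (P lam)" if "lam \<in> ?U" for lam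
    unfolding a using that fin by (subst jack_inner_P_sum) auto
  have low: "a lam = 0" if lam: "lam \<in> ?U" "sum_list (take 1 lam) < r" for lam
  proof -
    have lp: "lam \<in> partitions" using lam by simp
    have ne: "lam \<noteq> (r + 1) # m" "\<And>l. lam \<noteq> r # l" using lam(2) by auto
    have "jack_inner (P ((r + 1) # m)) (P lam) = 0" using P_orthogonal[OF rm1 lp] ne by blast
    moreover have "jack_inner ?S (P lam) = 0"
      unfolding jack_inner_sum_left jack_inner_scale_left
      using P_orthogonal[OF V(2) lp] ne(2) by (intro sum.neutral) auto
    moreover have "jack_inner (psum 1 * P (r # m)) (P lam) = 0"
      by (rule jack_inner_psum_1_mult_eq_0[OF rm lp lam(2)])
    moreover have "jack_inner R (P lam) + jack_inner (P ((r + 1) # m)) (P lam) + jack_inner ?S (P lam)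
        = jack_inner (psum 1 * P (r # m)) (P lam)"
      unfolding R_def jack_inner_add_left[symmetric] by simp
    ultimately have "jack_inner R (P lam) = 0" by simp
    thus ?thesis using inner[OF lam(1)] P_norm_nonzero[OF lp] by simp
  qed
  have "var_coeff (r + 1) R = 0"
    using vS[of "r + 1"] vp[of "r + 1"] var_coeff_P_above[OF rm, of "r + 1"]
      var_coeff_P_top[OF rm1] var_coeff_P_top[OF rm] by (simp add: R_def var_coeff_diff)
  hence high: "a ((r + 1) # l) = 0" if l: "(r + 1) # l \<in> ?U" for l
    using jack_inner_var_coeff_sum[of ?U "r + 1" l a] fin l P_norm_nonzero[of l]
    unfolding a[symmetric] by (auto simp: jack_inner_0_left partitions_Cons)
  have "jack_inner (var_coeff r R) (P l) = 0" if l: "l \<in> V" for l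
  proof -
    have "var_coeff r ?S = (\<Sum>l\<in>V. scale (c l) (P l))"
      using V by (simp add: var_coeff_sum var_coeff_scale var_coeff_P_top)
    moreover have "jack_inner (\<Sum>l\<in>V. scale (c l) (P l)) (P l) = c l * jack_inner (P l) (P l)"
      using l V finV by (subst jack_inner_P_sum) auto
    moreover have "var_coeff r R + var_coeff r (P ((r + 1) # m)) + var_coeff r ?S
        = psum 1 * P m + var_coeff (r - 1) (P (r # m))"
      using vp[OF r] var_coeff_P_top[OF rm] by (simp add: R_def var_coeff_diff)
    hence "jack_inner (var_coeff r R) (P l) + jack_inner (var_coeff r (P ((r + 1) # m))) (P l) + jack_inner (var_coeff r ?S) (P l)
        = jack_inner (psum 1 * P m) (P l) + jack_inner (var_coeff (r - 1) (P (r # m))) (P l)"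
      by (metis jack_inner_add_left)
    moreover have "c l * jack_inner (P l) (P l) = jack_inner (psum 1 * P m) (P l) + jack_inner (var_coeff (r - 1) (P (r # m))) (P l)
      - jack_inner (var_coeff r (P ((r + 1) # m))) (P l)"
      using P_norm_nonzero[OF V(1)[OF l]] by (simp add: c_def)
    ultimately show ?thesis by simp
  qed
  moreover have "jack_inner (var_coeff r R) (P l) = a (r # l) * jack_inner (P l) (P l)" if l: "r # l \<in> ?U" for l
    unfolding a
  proof (rule jack_inner_var_coeff_sum[OF fin _ r l])
    fix lam assume lam: "lam \<in> ?U" "a lam \<noteq> 0"
    \<comment> \<open>This is where the vanishing of all coefficients with first part r + 1
      enters.\<close>
    have "sum_list (take 1 lam) \<noteq> r + 1"
    proof (cases lam)
      case (Cons x xs)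
      thus ?thesis using high[of xs] lam by auto
    qed simp
    thus "sum_list (take 1 lam) \<le> r" using lam by auto
  qed auto
  ultimately have mid: "a (r # l) = 0" if "r # l \<in> ?U" for l
    using that P_norm_nonzero[of l] by (auto simp: V_def partitions_Cons)
  have "a lam = 0" if lam: "lam \<in> ?U" for lam
  proof (cases lam)
    case Nil
    thus ?thesis using lam by simp
  next
    case (Cons x xs)
    consider "x < r" | "x = r" | "x = r + 1" using lam Cons by fastforce
    thus ?thesis using low[OF lam] mid[of xs] high[of xs] lam Cons by cases auto
  qed
  hence "R = 0" unfolding a by (intro sum.neutral) auto
  thus ?thesis by (simp add: R_def algebra_simps)
qed

end

section \<open>Adding a box\<close>

lemma part_0 [simp]: "part xs 0 = 0"
  and part_Nil [simp]: "part [] i = 0"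
  by (simp_all add: part_def)

lemma part_Cons: "part (r # xs) i = (if i = 1 then r else part xs (i - 1))"
  by (cases i) (auto simp: part_def nth_Cons')

lemma diagram_Nil [simp]: "diagram [] = {}"
  by (auto simp: diagram_def)

lemma diagram_Cons: "diagram (r # xs) = {1} \<times> {1..r} \<union> map_prod Suc id ` diagram xs"
proof (intro set_eqI, clarify)
  fix i j
  show "(i, j) \<in> diagram (r # xs) \<longleftrightarrow> (i, j) \<in> {1} \<times> {1..r} \<union> map_prod Suc id ` diagram xs"
  proof (cases i)
    case (Suc k)
    thus ?thesis by (cases k) (auto simp: diagram_def part_Cons image_iff)
  qed (auto simp: diagram_def)
qed

lemma diagram_Cons_iff:
  "(i, j) \<in> diagram (r # xs) \<longleftrightarrow> i = 1 \<and> 1 \<le> j \<and> j \<le> r \<or> (\<exists>k. i = Suc k \<and> (k, j) \<in> diagram xs)"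
  by (force simp: diagram_Cons image_iff)

lemma diagram_0: "(0, j) \<notin> diagram xs"
  by (simp add: diagram_def)

lemma diagram_Cons_subset_iff:
  "diagram (r # m) \<subseteq> diagram (s # l) \<longleftrightarrow> r \<le> s \<and> diagram m \<subseteq> diagram l"
proof
  assume sub: "diagram (r # m) \<subseteq> diagram (s # l)"
  have "r \<le> s"
  proof (cases "r = 0")
    case False
    hence "(1, r) \<in> diagram (r # m)" by (simp add: diagram_Cons_iff)
    hence "(1, r) \<in> diagram (s # l)" using sub by blast
    thus ?thesis by (auto simp: diagram_Cons_iff diagram_0)
  qed simp
  moreover have "diagram m \<subseteq> diagram l"
  proof clarify
    fix i j assume ij: "(i, j) \<in> diagram m"
    hence "(Suc i, j) \<in> diagram (r # m)" by (simp add: diagram_Cons_iff)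
    hence "(Suc i, j) \<in> diagram (s # l)" using sub by blast
    thus "(i, j) \<in> diagram l" using ij diagram_0 by (auto simp: diagram_Cons_iff)
  qed
  ultimately show "r \<le> s \<and> diagram m \<subseteq> diagram l" ..
qed (auto simp: diagram_Cons)

lemma diagram_subset_imp:
  assumes "m \<in> partitions" "l \<in> partitions" "diagram m \<subseteq> diagram l"
  shows "sum_list m \<le> sum_list l \<and> (sum_list m = sum_list l \<longrightarrow> m = l)"
  using assms
proof (induction m arbitrary: l)
  case Nil
  show ?case using Nil by (cases l) (auto simp: partitions_def)
next
  case (Cons r m)
  have r: "r > 0" using Cons.prems by (simp add: partitions_Cons)
  hence "(1, r) \<in> diagram (r # m)" by (simp add: diagram_Cons_iff)
  then obtain s l' where l: "l = s # l'" using Cons.prems(3) by (cases l) auto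
  have "r \<le> s" "diagram m \<subseteq> diagram l'" using Cons.prems(3) by (simp_all add: l diagram_Cons_subset_iff)
  thus ?case using Cons.IH[of l'] Cons.prems by (auto simp: l partitions_Cons)
qed

definition covers :: "nat list \<Rightarrow> nat list set" where
  "covers mu = {lam. lam \<in> partitions \<and> sum_list lam = sum_list mu + 1 \<and> diagram mu \<subseteq> diagram lam}"

lemma covers_Nil: "covers [] = {[1]}"
proof -
  have 1: "lam = [1]" if "lam \<in> partitions" "sum_list lam = 1" for lam
  proof (cases lam)
    case (Cons x xs)
    hence "x > 0" "x + sum_list xs = 1" using that by (simp_all add: partitions_Cons)
    hence "x = 1" "sum_list xs = 0" by linarith+
    thus ?thesis using that Cons by (cases xs) (auto simp: partitions_Cons)
  qed (use that in simp)
  have "{lam. lam \<in> partitions \<and> sum_list lam = 1} = {[1]}"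
  proof (intro equalityI subsetI)
    show "lam \<in> {[1]}" if "lam \<in> {lam. lam \<in> partitions \<and> sum_list lam = 1}" for lam
      using that 1 by blast
  qed (simp add: partitions_def)
  thus ?thesis by (simp add: covers_def)
qed

text \<open>The inclusion bounds the first part and the tail separately, and the sizes leave room
  for just one box; equal size together with inclusion forces equal tails.\<close>

lemma covers_Cons:
  assumes "r # m \<in> partitions"
  shows "covers (r # m) = insert ((r + 1) # m) ((#) r ` {l \<in> covers m. r # l \<in> partitions})"
proof (intro set_eqI iffI)
  fix lam assume lam: "lam \<in> covers (r # m)"
  then obtain s l where sl: "lam = s # l" by (cases lam) (auto simp: covers_def)
  have m: "m \<in> partitions" "l \<in> partitions" using assms lam sl by (auto simp: covers_def partitions_Cons)
  have *: "r \<le> s" "diagram m \<subseteq> diagram l" "s + sum_list l = r + sum_list m + 1"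
    using lam by (auto simp: sl covers_def diagram_Cons_subset_iff)
  note d = diagram_subset_imp[OF m *(2)]
  have "s = r \<and> sum_list l = sum_list m + 1 \<or> s = r + 1 \<and> sum_list l = sum_list m" using d * by linarith
  thus "lam \<in> insert ((r + 1) # m) ((#) r ` {l \<in> covers m. r # l \<in> partitions})"
    using d lam m * by (auto simp: sl covers_def)
next
  fix lam assume "lam \<in> insert ((r + 1) # m) ((#) r ` {l \<in> covers m. r # l \<in> partitions})"
  thus "lam \<in> covers (r # m)"
    using assms
    by (elim insertE imageE) (simp_all add: covers_def diagram_Cons_subset_iff partitions_Cons le_SucI)
qed

lemma finite_covers: "finite (covers mu)"
  by (rule finite_subset[OF _ finite_partitions_of[of "sum_list mu + 1"]]) (auto simp: covers_def)

section \<open>Contents, arms and legs when a box is added\<close>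

lemma conj_part_Nil [simp]: "conj_part [] j = 0"
  by (simp add: conj_part_def)

lemma conj_part_Cons: "conj_part (r # xs) j = (if j \<le> r then 1 else 0) + conj_part xs j"
proof -
  let ?A = "{i. 1 \<le> i \<and> i \<le> length xs \<and> j \<le> part xs i}"
  have fin: "finite ?A" by simp
  have "{i. 1 \<le> i \<and> i \<le> length (r # xs) \<and> j \<le> part (r # xs) i} = (if j \<le> r then {1} else {}) \<union> Suc ` ?A"
  proof (rule set_eqI)
    fix i
    show "i \<in> {i. 1 \<le> i \<and> i \<le> length (r # xs) \<and> j \<le> part (r # xs) i} \<longleftrightarrow> i \<in> (if j \<le> r then {1} else {}) \<union> Suc ` ?A"
    proof (cases i)
      case (Suc k)
      thus ?thesis by (cases k) (auto simp: part_Cons image_iff)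
    qed auto
  qed
  moreover have "card ((if j \<le> r then {1} else {}) \<union> Suc ` ?A) = (if j \<le> r then 1 else 0) + card ?A"
    using fin by (subst card_Un_disjoint) (auto simp: card_image)
  ultimately show ?thesis by (simp add: conj_part_def)
qed

lemma conj_part_eq_0: "\<forall>x\<in>set xs. x < j \<Longrightarrow> conj_part xs j = 0"
  by (induction xs) (auto simp: conj_part_Cons)

lemma part_le: "\<forall>x\<in>set xs. x \<le> r \<Longrightarrow> part xs i \<le> r"
  by (auto simp: part_def)

text \<open>The new box (i,j) ends row j, which fixes the row lengths before and after. The
  eigenvalue difference is its k-deformed content k(j-1) - (i-1): each part passed during the
  induction loses one more unit through \<open>sum_list\<close>.\<close>

lemma covers_box:
  assumes "m \<in> partitions" "l \<in> covers m"
  obtains i j where "i \<ge> 1" "j \<ge> 1" "diagram l = insert (i, j) (diagram m)" "(i, j) \<notin> diagram m"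
    "conj_part l j = i" "conj_part m j = i - 1"
    "eigenval l - eigenval m = kk * (of_nat j - 1) - (of_nat i - 1)"
  using assms
proof (induction m arbitrary: l thesis)
  case Nil
  hence "l = [1]" by (simp add: covers_Nil)
  thus ?case using Nil(1)[of 1 1] by (simp add: diagram_Cons conj_part_Cons)
next
  case (Cons r m)
  have m: "m \<in> partitions" "\<forall>x\<in>set m. x \<le> r" using Cons.prems(2) by (auto simp: partitions_Cons)
  from Cons.prems(3) consider "l = (r + 1) # m" | l' where "l = r # l'" "l' \<in> covers m" "r # l' \<in> partitions"
    unfolding covers_Cons[OF Cons.prems(2)] by blast
  thus ?case
  proof cases
    case 1
    have c: "conj_part m (r + 1) = 0" using m by (intro conj_part_eq_0) auto
    show ?thesis
    proof (rule Cons.prems(1)[of 1 "r + 1"])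
      have "{1..r + 1} = insert (r + 1) {1..r}" by auto
      thus "diagram l = insert (1, r + 1) (diagram (r # m))" unfolding 1 diagram_Cons by auto
      show "(1, r + 1) \<notin> diagram (r # m)" by (auto simp: diagram_Cons_iff diagram_0)
      show "eigenval l - eigenval (r # m) = kk * (of_nat (r + 1) - 1) - (of_nat 1 - 1)"
        by (simp add: 1 field_simps)
    qed (use c in \<open>simp_all add: 1 conj_part_Cons\<close>)
  next
    case 2
    obtain i j where ij: "i \<ge> 1" "j \<ge> 1" "diagram l' = insert (i, j) (diagram m)" "(i, j) \<notin> diagram m"
      "conj_part l' j = i" "conj_part m j = i - 1"
      "eigenval l' - eigenval m = kk * (of_nat j - 1) - (of_nat i - 1)"
      using Cons.IH[OF _ m(1) 2(2)] by blast
    have "(i, j) \<in> diagram l'" using ij by simp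
    hence "j \<le> part l' i" by (simp add: diagram_def)
    also have "\<dots> \<le> r" using 2(3) by (intro part_le) (auto simp: partitions_Cons)
    finally have jr: "j \<le> r" .
    show ?thesis
    proof (rule Cons.prems(1)[of "Suc i" j])
      show "diagram l = insert (Suc i, j) (diagram (r # m))" unfolding 2 diagram_Cons ij(3) by auto
      show "(Suc i, j) \<notin> diagram (r # m)" using ij by (auto simp: diagram_Cons_iff)
      have "sum_list l' = sum_list m + 1" using 2 by (simp add: covers_def)
      thus "eigenval l - eigenval (r # m) = kk * (of_nat j - 1) - (of_nat (Suc i) - 1)"
        using ij(7) by (simp add: 2 algebra_simps)
    qed (use ij jr in \<open>simp_all add: 2 conj_part_Cons\<close>)
  qed
qed

definition pieri_coeff :: "nat list \<Rightarrow> nat list \<Rightarrow> ratfun" where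
  "pieri_coeff lam mu = (\<Prod>s\<in>row_boxes lam mu. bfun lam s / bfun mu s)"

text \<open>All parts are at most r, so row r + 1 contains no box of the smaller diagram and the
  product is empty.\<close>

lemma pieri_coeff_first_row:
  assumes "r # m \<in> partitions"
  shows "pieri_coeff ((r + 1) # m) (r # m) = 1"
proof -
  have "row_boxes ((r + 1) # m) (r # m) = {}"
  proof -
    have "snd t = r + 1" if "t \<in> diagram ((r + 1) # m) - diagram (r # m)" for t
      using that by (cases t) (auto simp: diagram_Cons_iff)
    moreover have "snd s \<le> r" if "s \<in> diagram (r # m)" for s
    proof -
      have "snd s \<le> part (r # m) (fst s)" using that by (auto simp: diagram_def)
      also have "\<dots> \<le> r" using assms by (intro part_le) (auto simp: partitions_Cons)
      finally show ?thesis .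
    qed
    ultimately show ?thesis by (force simp: row_boxes_def)
  qed
  thus ?thesis by (simp add: pieri_coeff_def)
qed

lemma row_boxes_box:
  assumes "diagram lam = insert (i, j) (diagram mu)" "(i, j) \<notin> diagram mu"
  shows "row_boxes lam mu = {s \<in> diagram mu. snd s = j}"
proof -
  have "diagram lam - diagram mu = {(i, j)}" using assms by auto
  thus ?thesis by (simp add: row_boxes_def)
qed

lemma bfun_Cons_Suc: "i \<ge> 1 \<Longrightarrow> j \<le> r \<Longrightarrow> bfun (r # xs) (Suc i, j) = bfun xs (i, j)"
  by (simp add: bfun_def leg_def arm_def part_Cons conj_part_Cons)

text \<open>Prepending a part adds the box (1,j) to R. The other boxes move one column on without
  change of arm or leg, since their row gains one box in front of them.\<close>

lemma pieri_coeff_Cons: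
  assumes box: "diagram l = insert (i, j) (diagram m)" "(i, j) \<notin> diagram m" and j: "1 \<le> j" "j \<le> r"
  shows "pieri_coeff (r # l) (r # m) = bfun (r # l) (1, j) / bfun (r # m) (1, j) * pieri_coeff l m"
proof -
  let ?f = "map_prod Suc id :: nat \<times> nat \<Rightarrow> nat \<times> nat"
  let ?h = "\<lambda>s. bfun (r # l) s / bfun (r # m) s"
  have "(i, j) \<in> diagram l" using box by simp
  hence "i \<ge> 1" by (simp add: diagram_def)
  hence "diagram (r # l) = insert (Suc i, j) (diagram (r # m))" "(Suc i, j) \<notin> diagram (r # m)"
    using box by (simp_all add: diagram_Cons_iff) (auto simp: diagram_Cons)
  hence "row_boxes (r # l) (r # m) = {s \<in> diagram (r # m). snd s = j}" by (rule row_boxes_box)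
  also have "\<dots> = insert (1, j) (?f ` row_boxes l m)"
    unfolding row_boxes_box[OF box] diagram_Cons using j by auto
  finally have rb: "row_boxes (r # l) (r # m) = \<dots>" .
  have fin: "finite (row_boxes l m)"
    using finite_diagram[of m] by (simp add: row_boxes_def)
  have "(1, j) \<notin> ?f ` row_boxes l m"
    by (auto simp: row_boxes_def diagram_def)
  hence "pieri_coeff (r # l) (r # m) = ?h (1, j) * (\<Prod>s\<in>?f ` row_boxes l m. ?h s)"
    using fin by (simp add: pieri_coeff_def rb)
  also have "(\<Prod>s\<in>?f ` row_boxes l m. ?h s) = (\<Prod>s\<in>row_boxes l m. ?h (?f s))"
    by (subst prod.reindex) (auto simp: inj_on_def)
  also have "\<dots> = pieri_coeff l m"
    unfolding pieri_coeff_def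
  proof (rule prod.cong)
    fix s assume "s \<in> row_boxes l m"
    then obtain a where "s = (a, j)" "a \<ge> 1"
      unfolding row_boxes_box[OF box] by (cases s) (auto simp: diagram_def)
    thus "?h (?f s) = bfun l s / bfun m s" using j by (simp add: bfun_Cons_Suc)
  qed simp
  finally show ?thesis .
qed

text \<open>The heart of the coefficient computation: 1 + (x+k-1)/(kx) - (x+2k-1)/(k(x+k)) =
  (x+1)(x+k-1)/(x(x+k)). Here c n pairs p_1 P_m with P_l, while g and h are the pairings of the
  second coefficients of P_(r,m) and P_(r+1,m).\<close>

lemma pieri_factor_identity:
  fixes k x c n g h :: "'a::field"
  assumes nz: "k \<noteq> 0" "x \<noteq> 0" "x + k \<noteq> 0" "x + k - 1 \<noteq> 0" "n \<noteq> 0"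
    and g: "k * x * g = (x + k - 1) * (c * n)" and h: "k * (x + k) * h = (x + 2 * k - 1) * (c * n)"
  shows "(c * n + g - h) / n = ((x + 1) / (x + k)) / (x / (x + k - 1)) * c"
proof -
  have "k * x * (x + k) * (c * n + g - h)
      = k * x * (x + k) * (c * n) + (x + k) * (k * x * g) - x * (k * (x + k) * h)"
    by (simp add: algebra_simps)
  also have "\<dots> = k * ((x + 1) * (x + k - 1)) * (c * n)"
    unfolding g h by (simp add: algebra_simps)
  finally have "k * (x * (x + k) * (c * n + g - h)) = k * ((x + 1) * (x + k - 1) * c * n)"
    by (simp add: mult_ac)
  hence "x * (x + k) * (c * n + g - h) = (x + 1) * (x + k - 1) * c * n" using nz(1) by simp
  hence "c * n + g - h = (x + 1) * (x + k - 1) * c * n / (x * (x + k))"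
    using nz by (simp add: eq_divide_eq mult_ac)
  thus ?thesis using nz by (simp add: divide_simps) (simp add: mult_ac)
qed

section \<open>The Pieri formula\<close>

context jack_family
begin

lemma P_Nil: "P [] = 1"
proof -
  have n: "[] \<in> partitions" by (simp add: partitions_def)
  have "mcoeff (P []) m = mcoeff 1 m" for m
  proof (cases "m = 0")
    case True
    thus ?thesis using P_leading[OF n] by (simp add: one_symfun.rep_eq)
  next
    case False
    hence "mdeg m \<noteq> 0" by (auto simp: mdeg_def in_keys_iff poly_mapping_eq_iff fun_eq_iff)
    thus ?thesis using False P_homogeneous[OF n] by (auto simp: homogeneous_def one_symfun.rep_eq)
  qed
  thus ?thesis by (rule symfun_eqI)
qed

lemma P_1: "P [1] = psum 1"
proof -
  have one: "[1] \<in> partitions" by (simp add: partitions_def)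
  have "homogeneous 0 (1 :: ratfun symfun)"
    by (auto simp: homogeneous_def one_symfun.rep_eq mdeg_def split: if_splits)
  hence "homogeneous 1 (psum 1 :: ratfun symfun)"
    using homogeneous_psum_mult[of 0 1 1] by simp
  hence h: "homogeneous 1 (P [1] - psum 1)" using P_homogeneous[OF one] by (auto intro: homogeneous_diff)
  have "P [1] - psum 1 = 0"
  proof (rule symfun_eq_0I)
    fix mu assume mu: "mu \<in> partitions"
    show "mcoeff (P [1] - psum 1) (mon mu) = 0"
    proof (rule ccontr)
      assume nz: "mcoeff (P [1] - psum 1) (mon mu) \<noteq> 0"
      hence "sum_list mu = 1" using h by (auto simp: homogeneous_def mdeg_mon)
      hence "mu \<in> covers []" using mu by (simp add: covers_def)
      hence mu: "mu = [1]" by (simp add: covers_Nil)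
      have "mon [1] = Poly_Mapping.single 0 1"
        by (rule poly_mapping_eqI) (auto simp: lookup_cons_mon lookup_single when_def split: nat.splits)
      hence "mcoeff (psum 1 :: ratfun symfun) (mon [1]) = 1" by (auto simp: psum.rep_eq)
      thus False using nz P_leading[OF one] by (simp add: mu minus_symfun.rep_eq)
    qed
  qed
  thus ?thesis by simp
qed

theorem pieri:
  "mu \<in> partitions \<Longrightarrow> psum 1 * P mu = (\<Sum>lam\<in>covers mu. scale (pieri_coeff lam mu) (P lam))"
proof (induction mu)
  case Nil
  have "row_boxes [1] [] = {}" by (simp add: row_boxes_def)
  thus ?case by (simp add: P_Nil covers_Nil pieri_coeff_def P_1[simplified])
next
  case (Cons r m)
  let ?V = "{l. r # l \<in> partitions \<and> sum_list l = sum_list m + 1}"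
  let ?W = "{l \<in> covers m. r # l \<in> partitions}"
  have m: "m \<in> partitions" and rm: "r # m \<in> partitions" and rm1: "(r + 1) # m \<in> partitions"
    using Cons.prems by (auto simp: partitions_Cons)
  define n where "n = (\<lambda>l. jack_inner (P l) (P l))"
  define p where "p = (\<lambda>l. jack_inner (psum 1 * P m) (P l))"
  define g where "g = (\<lambda>l. jack_inner (var_coeff (r - 1) (P (r # m))) (P l))"
  define h where "h = (\<lambda>l. jack_inner (var_coeff r (P ((r + 1) # m))) (P l))"
  have p: "p l = (if l \<in> covers m then pieri_coeff l m * n l else 0)" if "l \<in> partitions" for l
    unfolding p_def Cons.IH[OF m] n_def
    using that finite_covers by (intro jack_inner_P_sum) (auto simp: covers_def)
  \<comment> \<open>The index set of \<open>psum_1_mult_P_Cons\<close> also contains partitions that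
    do not contain m; by induction p_1 P_m has no component there, and then neither second
    coefficient has one.\<close>
  have outside: "(p l + g l - h l) / n l = 0" if l: "l \<in> ?V - ?W" for l
  proof -
    have lp: "l \<in> partitions" and "l \<notin> covers m" using l by (auto simp: partitions_Cons)
    hence p0: "p l = 0" using p by simp
    moreover have "g l = 0" "h l = 0"
      using jack_inner_var_coeff_P_second_eq_0[OF rm lp] jack_inner_var_coeff_P_second_eq_0[OF rm1 lp] p0
      by (simp_all add: g_def h_def p_def)
    ultimately show ?thesis by simp
  qed
  have inside: "(p l + g l - h l) / n l = pieri_coeff (r # l) (r # m)" if l: "l \<in> ?W" for l
  proof -
    have lp: "l \<in> partitions" and rl: "r # l \<in> partitions" and lc: "l \<in> covers m"
      using l by (auto simp: partitions_Cons)
    obtain i j where ij: "i \<ge> 1" "j \<ge> 1" "diagram l = insert (i, j) (diagram m)" "(i, j) \<notin> diagram m"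
      "conj_part l j = i" "conj_part m j = i - 1"
      "eigenval l - eigenval m = kk * (of_nat j - 1) - (of_nat i - 1)"
      using covers_box[OF m lc] by blast
    have "(i, j) \<in> diagram l" using ij by simp
    hence "j \<le> part l i" by (simp add: diagram_def)
    also have "\<dots> \<le> r" using rl by (intro part_le) (auto simp: partitions_Cons)
    finally have jr: "j \<le> r" .
    \<comment> \<open>This is leg + 1 + k arm of the box (1,j) in r # m, the numerator of its
      b-factor. It is nonzero since i \<ge> 1, and x + k - 1 is nonzero since j \<le> r.\<close>
    define x :: ratfun where "x = of_nat i + kk * (of_nat r - of_nat j)"
    have x: "x \<noteq> 0" "x + kk \<noteq> 0" "x + kk - 1 \<noteq> 0"
      using kk_linear_eq_0_iff[of "int i" "int r - int j"] kk_linear_eq_0_iff[of "int i" "int r - int j + 1"]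
        kk_linear_eq_0_iff[of "int i - 1" "int r - int j + 1"] ij jr
      by (simp_all add: x_def algebra_simps)
    \<comment> \<open>With the content inserted, the two linear forms become -x and -(x+k-1);
      replacing r by r + 1 turns them into -(x+k) and -(x+2k-1).\<close>
    have 1: "kk * (kk * (of_nat j - 1) - (of_nat i - 1) - kk * (of_nat r - 1) - 1) * g l
        = (kk * (of_nat j - 1) - (of_nat i - 1) - kk * of_nat r) * p l"
      using jack_inner_var_coeff_P_second[OF rm lp] unfolding ij(7) g_def p_def .
    have "kk * x * g l = - (kk * (kk * (of_nat j - 1) - (of_nat i - 1) - kk * (of_nat r - 1) - 1) * g l)"
      by (simp add: x_def algebra_simps)
    also have "\<dots> = (x + kk - 1) * p l" unfolding 1 by (simp add: x_def algebra_simps)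
    finally have gl: "kk * x * g l = (x + kk - 1) * p l" .
    have 2: "kk * (kk * (of_nat j - 1) - (of_nat i - 1) - kk * of_nat r - 1) * h l
        = (kk * (of_nat j - 1) - (of_nat i - 1) - kk * (of_nat r + 1)) * p l"
      using jack_inner_var_coeff_P_second[OF rm1 lp] unfolding ij(7) by (simp add: h_def p_def add.commute)
    have "kk * (x + kk) * h l = - (kk * (kk * (of_nat j - 1) - (of_nat i - 1) - kk * of_nat r - 1) * h l)"
      by (simp add: x_def algebra_simps)
    also have "\<dots> = (x + 2 * kk - 1) * p l" unfolding 2 by (simp add: x_def algebra_simps)
    finally have hl: "kk * (x + kk) * h l = (x + 2 * kk - 1) * p l" .
    have pl: "p l = pieri_coeff l m * n l" using p[OF lp] lc by simp
    have "n l \<noteq> 0" using P_norm_nonzero[OF lp] by (simp add: n_def)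
    hence "(p l + g l - h l) / n l = ((x + 1) / (x + kk)) / (x / (x + kk - 1)) * pieri_coeff l m"
      unfolding pl using gl hl x by (intro pieri_factor_identity) (simp_all add: pl)
    moreover have "bfun (r # l) (1, j) = (x + 1) / (x + kk)" "bfun (r # m) (1, j) = x / (x + kk - 1)"
      using ij jr by (simp_all add: bfun_def arm_def leg_def part_Cons conj_part_Cons x_def of_nat_diff algebra_simps)
    ultimately show ?thesis using pieri_coeff_Cons[OF ij(3,4,2) jr] by simp
  qed
  have finV: "finite ?V"
    by (rule finite_subset[OF _ finite_partitions_of[of "sum_list m + 1"]]) (auto simp: partitions_Cons)
  have "psum 1 * P (r # m) = P ((r + 1) # m) + (\<Sum>l\<in>?V. scale ((p l + g l - h l) / n l) (P (r # l)))"
    using psum_1_mult_P_Cons[OF rm] unfolding p_def g_def h_def n_def .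
  also have "(\<Sum>l\<in>?V. scale ((p l + g l - h l) / n l) (P (r # l))) = (\<Sum>l\<in>?W. scale (pieri_coeff (r # l) (r # m)) (P (r # l)))"
    using finV outside inside by (intro sum.mono_neutral_cong_right) (auto simp: covers_def)
  also have "\<dots> = (\<Sum>lam\<in>(#) r ` ?W. scale (pieri_coeff lam (r # m)) (P lam))"
    by (subst sum.reindex) auto
  also have "P ((r + 1) # m) + \<dots> = (\<Sum>lam\<in>covers (r # m). scale (pieri_coeff lam (r # m)) (P lam))"
    unfolding covers_Cons[OF rm] using finite_covers[of m]
    by (subst sum.insert) (auto simp: pieri_coeff_first_row[OF rm, simplified])
  finally show ?case .
qed

end

theorem theorem3p28:
  fixes P :: "nat list \<Rightarrow> ratfun symfun" and mu :: "nat list"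
  assumes "is_jack_family P"
    and "mu \<in> partitions"
  shows "psum 1 * P mu =
    (\<Sum>lam | lam \<in> partitions \<and> sum_list lam = sum_list mu + 1 \<and> diagram mu \<subseteq> diagram lam.
       scale (\<Prod>s\<in>row_boxes lam mu. bfun lam s / bfun mu s) (P lam))"
proof -
  interpret jack_family P by unfold_locales (rule assms(1))
  show ?thesis using pieri[OF assms(2)] by (simp only: covers_def pieri_coeff_def)
qed

end
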